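(* Let $\phi(z;\tau)$ be a meromorphic Jacobi form of weight $k$ and index $m$ whose divisor $D=\mathrm{Div}_\tau(\phi)=\sum_{w\in\mathbb{C}/\Lambda_\tau}a_w[w]$ consists of torsion points, and let $a$ be the order of $\phi(z;\tau)$ at $z=0$. For $n\ge0$ define \[\widehat{\mathrm{Tr}}_n(D,\psi_J;\tau):=\sum_{0\le j\le\frac n2}\frac{\left(\frac{\pi m}{v}\right)^j}{j!}(2\pi i)^{n-2j+a}\,\mathrm{Tr}_{n-2j}(D,\psi_J;\tau).\] Then: (1) $\widehat{\mathrm{Tr}}_n(D,\psi_J;\tau)$ is an almost holomorphic modular form of weight $n$ and depth at most $\lfloor\frac n2\rfloor$, with $\lim_{\overline{\tau}\to-i\infty}\widehat{\mathrm{Tr}}_n(D,\psi_J;\tau)=(2\pi i)^{n+a}\mathrm{Tr}_n(D,\psi_J;\tau)$. (2) $\widehat{\mathrm{Tr}}_0(D,\psi_J;\tau)=(2\pi i)^a$, $\widehat{\mathrm{Tr}}_1(D,\psi_J;\tau)=-(2\pi i)^{1+a}G_{1,D}(\tau)$, and for $n\ge2$, $L\big(\widehat{\mathrm{Tr}}_n(D,\psi_J;\tau)\big)=-\pi m\,\widehat{\mathrm{Tr}}_{n-2}(D,\psi_J;\tau)$, where $L:=-2iv^2\frac{\partial}{\partial\overline\tau}$.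
   Context: Throughout $\tau=u+iv\in\mathbb{H}$, $q=e^{2\pi i\tau}$, $\zeta=e^{2\pi iz}$, $\Lambda_\tau=\mathbb{Z}+\mathbb{Z}\tau$. A meromorphic Jacobi form of weight $k$ and index $m\in\frac12\mathbb{N}$ is a meromorphic $\phi:\mathbb{C}\times\mathbb{H}\to\mathbb{C}$ with, for all $\begin{psmallmatrix}a&b\\c&d\end{psmallmatrix}\in\mathrm{SL}_2(\mathbb{Z})$, $\lambda,\mu\in\mathbb{Z}$: $\phi\big(\frac{z}{c\tau+d};\frac{a\tau+b}{c\tau+d}\big)=(c\tau+d)^k e^{\frac{2\pi i mcz^2}{c\tau+d}}\phi(z;\tau)$, $\phi(z+\lambda\tau+\mu;\tau)=(-1)^{2m\mu+\lambda\varepsilon}e^{-2\pi im(\lambda^2\tau+2\lambda z)}\phi(z;\tau)$ for some fixed $\varepsilon\in\{0,1\}$, and a Fourier expansion $\sum c(n,r)q^n\zeta^r$ allowing finite order poles in $\tau$ at cusps. The divisor $\mathrm{Div}_\tau(\phi)=\sum_{w\in\mathbb{C}/\Lambda_\tau}a_w[w]$ records the order $a_w$ of $z\mapsto\phi(z;\tau)$ at $w$ (a finite formal sum); $w=\alpha\tau+\beta$ is a torsion point if $\alpha,\beta\in\mathbb{Q}$. Let $\vartheta(z;\tau):=\sum_{n\in\mathbb{Z}+\frac12}e^{2\pi in(z+\frac12)}q^{n^2/2}$. Let $B_\ell$ be the Bernoulli numbers, $\sigma_\ell(n)=\sum_{d\mid n}d^\ell$, and $G_{2k}(\tau):=-\frac{B_{2k}}{2k}+2\sum_{n\ge1}\sigma_{2k-1}(n)q^n$.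 For a nonzero torsion point $w$, $G_{k,w}(\tau):=-\big[\big(\frac{1}{2\pi i}\frac{\partial}{\partial z}\big)^k\log(|\vartheta(z;\tau)|^2)\big]_{z=w}$; also $G_{2k,0}:=G_{2k}$ and $G_{2k+1,0}:=0$. For $D=\sum a_w[w]$, $G_{k,D}:=\sum_w a_wG_{k,w}$. For a partition $\lambda=(1^{m_1},\ldots,n^{m_n})\vdash n$, $\mathcal{G}_{D,\lambda}:=G_{1,D}^{m_1}\cdots G_{n,D}^{m_n}$, $\ell(\lambda)=\sum m_j$, $\psi_J(\lambda):=\frac{(-1)^{\ell(\lambda)}}{\prod_{j=1}^n m_j!\,j!^{m_j}}$, and $\mathrm{Tr}_n(D,\psi_J;\tau):=\sum_{\lambda\vdash n}\psi_J(\lambda)\mathcal{G}_{D,\lambda}(\tau)$ (with $\mathrm{Tr}_0=1$). An almost holomorphic modular form of weight $k$ is a function on $\mathbb{H}$ transforming as $f\big(\frac{a\tau+b}{c\tau+d}\big)=(c\tau+d)^kf(\tau)$ for $\mathrm{SL}_2(\mathbb{Z})$ that is a polynomial in $\frac1v$ with holomorphic coefficients; its depth is the degree. For $f=\sum_j f_j(\tau)v^{-j}$, $\lim_{\overline\tau\to-i\infty}f(\tau):=f_0(\tau)$ (treating $\tau,\overline\tau$ as independent).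
   Formalization: Since G_{1,w} depends on the representative w=ατ+β modulo Λ_τ, the representatives of the points of D are assumed chosen with Σ a_w α_w = 0 over nonzero classes; such a choice always exists, and without it (1) fails for n=1. *)

theory Defs
  imports "HOL-Complex_Analysis.Complex_Analysis"
    "HOL-Computational_Algebra.Formal_Power_Series"
begin

section \<open>Meromorphic Jacobi forms\<close>

definition uhp :: "complex set" where
  "uhp = {\<tau>. Im \<tau> > 0}"

definition holomorphic2_on :: "(complex \<times> complex \<Rightarrow> complex) \<Rightarrow> (complex \<times> complex) set \<Rightarrow> bool" where
  "holomorphic2_on f U \<longleftrightarrow>
     open U \<and> (\<forall>x\<in>U. \<exists>A B. (f has_derivative (\<lambda>h. A * fst h + B * snd h)) (at x))"

text \<open>Locally a quotient of holomorphic functions. HOL functions are total, so a value has to be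
  assigned at the poles as well; as \<open>y / 0 = 0\<close>, it is 0. In particular, if \<open>U \<times> {t}\<close> is
  contained in the polar set, then the restriction to it is identically 0.\<close>

definition meromorphic2_on :: "(complex \<times> complex \<Rightarrow> complex) \<Rightarrow> (complex \<times> complex) set \<Rightarrow> bool" where
  "meromorphic2_on F S \<longleftrightarrow>
     (\<forall>x\<in>S. \<exists>U f g. x \<in> U \<and> holomorphic2_on f U \<and> holomorphic2_on g U \<and>
        interior {y \<in> U. g y = 0} = {} \<and> (\<forall>y\<in>U. F y = f y / g y))"

text \<open>The Fourier expansion runs over \<open>n \<ge> n\<^sub>0\<close> (finite order at the cusp) and
  \<open>r \<in> \<int> + m\<close>, \<open>r = s + m\<close>. A meromorphic form has several expansions, depending on the chamber
  in which \<open>Im z / Im \<tau>\<close> lies; the one asked for is that to the right of \<open>Im z / Im \<tau> = 0\<close>.\<close>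

definition fourier_expandable :: "real \<Rightarrow> (complex \<Rightarrow> complex \<Rightarrow> complex) \<Rightarrow> bool" where
  "fourier_expandable m \<phi> \<longleftrightarrow>
     (\<exists>(n\<^sub>0::int) (c :: int \<Rightarrow> int \<Rightarrow> complex) (V::real) (Y::real) (\<delta>::real). \<delta> > 0 \<and>
        (\<forall>\<tau>\<in>uhp. \<forall>z. Im \<tau> > V \<longrightarrow> Y < Im z \<longrightarrow> Im z < \<delta> * Im \<tau> \<longrightarrow>
           ((\<lambda>(n, s). c n s * exp (2 * pi * \<i> * of_int n * \<tau>)
                            * exp (2 * pi * \<i> * (of_int s + of_real m) * z))
              has_sum \<phi> z \<tau>) ({n\<^sub>0..} \<times> UNIV)))"

definition meromorphic_jacobi_form :: "int \<Rightarrow> real \<Rightarrow> (complex \<Rightarrow> complex \<Rightarrow> complex) \<Rightarrow> bool" where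
  "meromorphic_jacobi_form k m \<phi> \<longleftrightarrow>
     2 * m \<in> \<nat> \<and>
     meromorphic2_on (\<lambda>(z, \<tau>). \<phi> z \<tau>) (UNIV \<times> uhp) \<and>
     (\<forall>a b c d :: int. a * d - b * c = 1 \<longrightarrow> (\<forall>\<tau>\<in>uhp. \<forall>z.
        \<phi> (z / (of_int c * \<tau> + of_int d))
          ((of_int a * \<tau> + of_int b) / (of_int c * \<tau> + of_int d)) =
        (of_int c * \<tau> + of_int d) powi k
          * exp (2 * pi * \<i> * m * of_int c * z\<^sup>2 / (of_int c * \<tau> + of_int d)) * \<phi> z \<tau>)) \<and>
     (\<exists>\<epsilon>\<in>{0, 1 :: int}. \<forall>l \<mu> :: int. \<forall>\<tau>\<in>uhp. \<forall>z.
        \<phi> (z + of_int l * \<tau> + of_int \<mu>) \<tau> =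
        (-1) powi (\<lfloor>2 * m\<rfloor> * \<mu> + l * \<epsilon>)
          * exp (- 2 * pi * \<i> * m * ((of_int l)\<^sup>2 * \<tau> + 2 * of_int l * z)) * \<phi> z \<tau>) \<and>
     fourier_expandable m \<phi>"


section \<open>Torsion divisors\<close>

text \<open>\<open>divisor_at \<phi> \<tau> w\<close> is the coefficient of \<open>[w]\<close> in \<open>Div\<^sub>\<tau>(\<phi>)\<close>. It is meaningful only
  if \<open>\<tau>\<close> is regular, that is, \<open>\<phi>(\<cdot>;\<tau>)\<close> is not identically 0. (The other \<open>\<tau>\<close> come from factors
  depending on \<open>\<tau>\<close> alone, such as an Eisenstein series in the numerator or the denominator.)\<close>

definition divisor_at :: "(complex \<Rightarrow> complex \<Rightarrow> complex) \<Rightarrow> complex \<Rightarrow> complex \<Rightarrow> int" where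
  "divisor_at \<phi> \<tau> w = zorder (\<lambda>z. \<phi> z \<tau>) w"

definition regular_at :: "(complex \<Rightarrow> complex \<Rightarrow> complex) \<Rightarrow> complex \<Rightarrow> bool" where
  "regular_at \<phi> \<tau> \<longleftrightarrow> \<tau> \<in> uhp \<and> (\<exists>z. \<phi> z \<tau> \<noteq> 0)"

definition period_lattice :: "complex \<Rightarrow> complex set" where
  "period_lattice \<tau> = {of_int a + of_int b * \<tau> | a b. True}"

text \<open>The pair \<open>(\<alpha>, \<beta>)\<close> stands for the torsion point \<open>\<alpha>\<tau> + \<beta>\<close>, for all \<open>\<tau>\<close> simultaneously.\<close>

definition torsion_point :: "rat \<times> rat \<Rightarrow> complex \<Rightarrow> complex" where
  "torsion_point p \<tau> = of_rat (fst p) * \<tau> + of_rat (snd p)"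

abbreviation integral_pairs :: "(rat \<times> rat) set" where
  "integral_pairs \<equiv> \<int> \<times> \<int>"

text \<open>A formal sum \<open>D = \<Sum> D p [p]\<close> over rational pairs is the divisor of \<open>\<phi>\<close> if its image in the
  divisor group of \<open>\<complex>/\<Lambda>\<^sub>\<tau>\<close> is \<open>Div\<^sub>\<tau>(\<phi>)\<close>; the pairs are arbitrary representatives of
  their classes. The coefficients \<open>D p\<close> do not depend on \<open>\<tau>\<close>: the zeros and poles of \<open>\<phi>\<close> are the
  curves \<open>z = \<alpha>\<tau> + \<beta>\<close>, with fixed multiplicities.\<close>

definition has_torsion_divisor ::
    "(complex \<Rightarrow> complex \<Rightarrow> complex) \<Rightarrow> (rat \<times> rat \<Rightarrow> int) \<Rightarrow> bool" where
  "has_torsion_divisor \<phi> D \<longleftrightarrow>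
     finite {p. D p \<noteq> 0} \<and>
     (\<exists>\<tau>. regular_at \<phi> \<tau>) \<and>
     (\<forall>\<tau> w. regular_at \<phi> \<tau> \<longrightarrow>
        divisor_at \<phi> \<tau> w =
          (\<Sum>p | D p \<noteq> 0 \<and> w - torsion_point p \<tau> \<in> period_lattice \<tau>. D p))"

text \<open>With \<open>\<theta>\<close> as below, \<open>(2\<pi>i)\<^sup>-\<^sup>1 \<theta>'/\<theta>\<close> is not elliptic: it drops by 1 under \<open>z \<mapsto> z + \<tau>\<close>.
  So \<open>G\<^sub>1\<^sub>,\<^sub>w\<close> (unlike \<open>G\<^sub>k\<^sub>,\<^sub>w\<close> for \<open>k \<ge> 2\<close>) depends on the representative of \<open>w\<close>, and
  \<open>G\<^sub>1\<^sub>,\<^sub>D\<close> depends on the representatives of the points of \<open>D\<close> through \<open>\<Sum> a\<^sub>w \<alpha>\<^sub>w\<close>, where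
  \<open>w = \<alpha>\<^sub>w \<tau> + \<beta>\<^sub>w\<close>. The representatives have to be chosen such that this sum is 0 (the class of
  0 is left out, as \<open>G\<^sub>1\<^sub>,\<^sub>0 = 0\<close> by definition); otherwise \<open>G\<^sub>1\<^sub>,\<^sub>D\<close> is a nonzero constant. For the divisor of a
  Jacobi form that is always possible: it is symmetric under \<open>w \<mapsto> -w\<close>, and the classes of \<open>\<tau>/2\<close>
  and \<open>(\<tau>+1)/2\<close>, which have the same coefficient, can be represented with \<open>\<alpha> = 1/2\<close> and
  \<open>\<alpha> = -1/2\<close>.\<close>

definition balanced :: "(rat \<times> rat \<Rightarrow> int) \<Rightarrow> bool" where
  "balanced D \<longleftrightarrow> (\<Sum>p | D p \<noteq> 0 \<and> p \<notin> integral_pairs. of_int (D p) * fst p) = 0"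


section \<open>Eisenstein series attached to a divisor\<close>

text \<open>The Wirtinger derivatives \<open>(f\<^sub>x - i f\<^sub>y)/2\<close> with respect to \<open>z\<close> and \<open>(f\<^sub>x + i f\<^sub>y)/2\<close> with respect
  to the conjugate of \<open>z\<close>.\<close>

definition wirtinger :: "(complex \<Rightarrow> complex) \<Rightarrow> complex \<Rightarrow> complex" where
  "wirtinger f z = (frechet_derivative f (at z) 1 - \<i> * frechet_derivative f (at z) \<i>) / 2"

definition wirtinger_bar :: "(complex \<Rightarrow> complex) \<Rightarrow> complex \<Rightarrow> complex" where
  "wirtinger_bar f z = (frechet_derivative f (at z) 1 + \<i> * frechet_derivative f (at z) \<i>) / 2"

definition jtheta :: "complex \<Rightarrow> complex \<Rightarrow> complex" where
  "jtheta z \<tau> = (\<Sum>\<^sub>\<infinity>n::int. exp (2 * pi * \<i> * (of_int n + 1/2) * (z + 1/2))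
                            * exp (2 * pi * \<i> * \<tau> * ((of_int n + 1/2)\<^sup>2 / 2)))"

text \<open>\<open>t / (e\<^sup>t - 1) = \<Sum> B\<^sub>n t\<^sup>n / n!\<close>\<close>

definition bernoulli_number :: "nat \<Rightarrow> real" where
  "bernoulli_number n = fact n * fps_nth (fps_X / (fps_exp 1 - 1)) n"

definition divisor_sum :: "nat \<Rightarrow> nat \<Rightarrow> nat" where
  "divisor_sum l n = (\<Sum>d | d dvd n. d ^ l)"

text \<open>\<open>eisenstein j\<close> is \<open>G\<^sub>2\<^sub>j\<close>.\<close>

definition eisenstein :: "nat \<Rightarrow> complex \<Rightarrow> complex" where
  "eisenstein j \<tau> = - of_real (bernoulli_number (2 * j)) / (2 * of_nat j)
     + 2 * (\<Sum>n. of_nat (divisor_sum (2 * j - 1) (Suc n)) * exp (2 * pi * \<i> * \<tau>) ^ Suc n)"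

definition eisenstein_point :: "nat \<Rightarrow> rat \<times> rat \<Rightarrow> complex \<Rightarrow> complex" where
  "eisenstein_point k p \<tau> =
     (if p \<in> integral_pairs then (if even k then eisenstein (k div 2) \<tau> else 0)
      else - ((\<lambda>f z. wirtinger f z / (2 * pi * \<i>)) ^^ k)
               (\<lambda>z. of_real (ln ((cmod (jtheta z \<tau>))\<^sup>2))) (torsion_point p \<tau>))"

definition eisenstein_div :: "nat \<Rightarrow> (rat \<times> rat \<Rightarrow> int) \<Rightarrow> complex \<Rightarrow> complex" where
  "eisenstein_div k D \<tau> = (\<Sum>p | D p \<noteq> 0. of_int (D p) * eisenstein_point k p \<tau>)"


section \<open>Partition traces\<close>

text \<open>A partition \<open>(1\<^sup>\<nu>\<^sup>1, \<dots>, n\<^sup>\<nu>\<^sup>n)\<close> of \<open>n\<close> is given by its multiplicity function \<open>\<nu>\<close>.\<close>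

definition partitions_of :: "nat \<Rightarrow> (nat \<Rightarrow> nat) set" where
  "partitions_of n = {\<nu>. (\<forall>j. \<nu> j \<noteq> 0 \<longrightarrow> j \<in> {1..n}) \<and> (\<Sum>j\<in>{1..n}. j * \<nu> j) = n}"

definition eisenstein_partition ::
    "nat \<Rightarrow> (rat \<times> rat \<Rightarrow> int) \<Rightarrow> (nat \<Rightarrow> nat) \<Rightarrow> complex \<Rightarrow> complex" where
  "eisenstein_partition n D \<nu> \<tau> = (\<Prod>j\<in>{1..n}. eisenstein_div j D \<tau> ^ \<nu> j)"

definition psi_J :: "nat \<Rightarrow> (nat \<Rightarrow> nat) \<Rightarrow> complex" where
  "psi_J n \<nu> = (-1) ^ (\<Sum>j\<in>{1..n}. \<nu> j) / (\<Prod>j\<in>{1..n}. fact (\<nu> j) * fact j ^ \<nu> j)"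

definition partition_trace ::
    "nat \<Rightarrow> (rat \<times> rat \<Rightarrow> int) \<Rightarrow> (nat \<Rightarrow> (nat \<Rightarrow> nat) \<Rightarrow> complex) \<Rightarrow> complex \<Rightarrow> complex" where
  "partition_trace n D \<psi> \<tau> = (\<Sum>\<nu>\<in>partitions_of n. \<psi> n \<nu> * eisenstein_partition n D \<nu> \<tau>)"

definition completed_trace ::
    "real \<Rightarrow> int \<Rightarrow> nat \<Rightarrow> (rat \<times> rat \<Rightarrow> int) \<Rightarrow> (nat \<Rightarrow> (nat \<Rightarrow> nat) \<Rightarrow> complex) \<Rightarrow> complex \<Rightarrow> complex"
  where
  "completed_trace m a n D \<psi> \<tau> =
     (\<Sum>j\<in>{0..n div 2}. (of_real (pi * m / Im \<tau>)) ^ j / fact j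
        * (2 * pi * \<i>) powi (int n - 2 * int j + a) * partition_trace (n - 2 * j) D \<psi> \<tau>)"


section \<open>Almost holomorphic modular forms\<close>

definition ah_expansion :: "(complex \<Rightarrow> complex) \<Rightarrow> nat \<Rightarrow> (nat \<Rightarrow> complex \<Rightarrow> complex) \<Rightarrow> bool" where
  "ah_expansion f N c \<longleftrightarrow>
     (\<forall>j\<le>N. c j holomorphic_on uhp) \<and>
     (\<forall>\<tau>\<in>uhp. f \<tau> = (\<Sum>j\<le>N. c j \<tau> / of_real (Im \<tau>) ^ j))"

definition almost_holomorphic_modular_form :: "int \<Rightarrow> (complex \<Rightarrow> complex) \<Rightarrow> bool" where
  "almost_holomorphic_modular_form k f \<longleftrightarrow>
     (\<forall>a b c d :: int. a * d - b * c = 1 \<longrightarrow> (\<forall>\<tau>\<in>uhp.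
        f ((of_int a * \<tau> + of_int b) / (of_int c * \<tau> + of_int d)) =
        (of_int c * \<tau> + of_int d) powi k * f \<tau>)) \<and>
     (\<exists>N c. ah_expansion f N c)"

definition ah_depth :: "(complex \<Rightarrow> complex) \<Rightarrow> nat" where
  "ah_depth f = (LEAST N. \<exists>c. ah_expansion f N c)"

text \<open>The limit of \<open>f\<close> as \<open>\<tau>\<close> is fixed and its conjugate, treated as an independent variable, tends
  to \<open>-i\<infinity>\<close>: the coefficient of \<open>v\<^sup>0\<close>, which is determined by \<open>f\<close>.\<close>

definition ah_limit :: "(complex \<Rightarrow> complex) \<Rightarrow> complex \<Rightarrow> complex" where
  "ah_limit f \<tau> = (THE x. \<exists>N c. ah_expansion f N c \<and> c 0 \<tau> = x)"

definition lowering :: "(complex \<Rightarrow> complex) \<Rightarrow> complex \<Rightarrow> complex" where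
  "lowering f \<tau> = - 2 * \<i> * of_real (Im \<tau>) ^ 2 * wirtinger_bar f \<tau>"

end

theory Submission
  imports Defs
begin

text \<open>
  An entire function of \<open>z\<close> that has the quasi-periods of \<open>\<theta>(z;\<tau>)\<close> and vanishes at 0 is a multiple of
  the product \<open>(exp(\<pi>iz) - exp(-\<pi>iz)) \<Prod> (1 - q\<^sup>n \<zeta>)(1 - q\<^sup>n/\<zeta>)\<close>, since the quotient is elliptic and entire.
  This yields the zeros of \<open>\<theta>\<close>, and for \<open>exp(-\<pi>icz\<^sup>2/(c\<tau>+d)) \<theta>(z/(c\<tau>+d);\<gamma>\<tau>)\<close> the modular transformation up to
  a factor independent of \<open>z\<close>, which is enough for \<open>\<theta>'/\<theta>\<close>. The \<open>G\<^sub>k\<^sub>,\<^sub>w\<close> are Taylor coefficients of \<open>\<theta>'/\<theta>\<close>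
  at \<open>w\<close>, and by the product formula the \<open>G\<^sub>2\<^sub>k\<close> are those of \<open>\<theta>'/\<theta> - 1/z\<close> at 0.

  As \<open>D\<close> is \<open>SL\<^sub>2(\<int>)\<close>-invariant, \<open>G\<^sub>k\<^sub>,\<^sub>D\<close> is modular for \<open>k \<ge> 3\<close>, while
  \<open>G\<^sub>2\<^sub>,\<^sub>D\<close> has an anomaly proportional to \<open>deg D\<close>, and \<open>G\<^sub>1\<^sub>,\<^sub>D = 0\<close> because \<open>D\<close> is symmetric and balanced.
  The quotient of \<open>\<phi>\<close> by \<open>\<Prod> \<theta>(z - w)\<close> over \<open>D\<close> is entire without zeros, and the quasi-periods of
  its logarithmic derivative force \<open>deg D = 2m\<close>. So \<open>G\<^sub>2\<^sub>,\<^sub>D + m/(2\<pi>v)\<close> is modular, and by the binomial theorem the completed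
  trace is \<open>(2\<pi>i)\<close> to the power \<open>n + a\<close> times the trace in which \<open>G\<^sub>2\<^sub>,\<^sub>D\<close> is replaced by this function.
\<close>

section \<open>Partition traces\<close>

text \<open>The completion has the shape of a generating function. Weighted by \<open>psi_J\<close>,
  the partitions of n give the coefficient of X^n in exp(- \<Sum> g_j X^j / j!), so adding y to g_2
  multiplies the series by exp(- y X^2 / 2). This is why the completion consists of terms
  (\<pi>m/v)^j / j! times traces of index n - 2j. The obstacle is that D is a sum over chosen
  representatives, while \<phi> determines only multiplicities of classes modulo the lattice, and it
  is these classes that SL_2(Z) permutes. For k >= 2 the value G_k,w depends only on the class of w,
  because the quasi-period of \<theta>'/\<theta> is a constant, which one derivative removes; so it
  is enough that the class multiplicities are invariant. G_1 is not a class function and is treated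
  on its own. Since the coefficients of D are the same for all \<tau>, its invariance and its degree
  can be read off at one regular \<tau> and the images of that point.\<close>

definition trace_poly :: "nat \<Rightarrow> (nat \<Rightarrow> complex) \<Rightarrow> complex" where
  "trace_poly n g = (\<Sum>\<nu>\<in>partitions_of n. psi_J n \<nu> * (\<Prod>j\<in>{1..n}. g j ^ \<nu> j))"

text \<open>The upper bound \<open>M\<close> is independent of the size of the partition, so that partitions of different
  sizes can be compared.\<close>

definition partition_weight :: "nat \<Rightarrow> (nat \<Rightarrow> complex) \<Rightarrow> (nat \<Rightarrow> nat) \<Rightarrow> complex" where
  "partition_weight M g \<nu> = (\<Prod>j\<in>{1..M}. (- g j / fact j) ^ \<nu> j / fact (\<nu> j))"

lemma partition_trace_eq: "partition_trace n D psi_J \<tau> = trace_poly n (\<lambda>j. eisenstein_div j D \<tau>)"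
  by (simp add: partition_trace_def trace_poly_def eisenstein_partition_def)

lemma partitions_of_alt:
  assumes "n \<le> M"
  shows "\<nu> \<in> partitions_of n \<longleftrightarrow> (\<forall>j. \<nu> j \<noteq> 0 \<longrightarrow> j \<in> {1..M}) \<and> (\<Sum>j\<in>{1..M}. j * \<nu> j) = n"
proof
  assume h: "\<nu> \<in> partitions_of n"
  have "(\<Sum>j\<in>{1..M}. j * \<nu> j) = (\<Sum>j\<in>{1..n}. j * \<nu> j)"
    using h assms by (intro sum.mono_neutral_right) (auto simp: partitions_of_def)
  moreover have "j \<in> {1..M}" if "\<nu> j \<noteq> 0" for j
    using h assms that by (auto simp: partitions_of_def intro: order_trans)
  ultimately show "(\<forall>j. \<nu> j \<noteq> 0 \<longrightarrow> j \<in> {1..M}) \<and> (\<Sum>j\<in>{1..M}. j * \<nu> j) = n"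
    using h unfolding partitions_of_def by auto
next
  assume h: "(\<forall>j. \<nu> j \<noteq> 0 \<longrightarrow> j \<in> {1..M}) \<and> (\<Sum>j\<in>{1..M}. j * \<nu> j) = n"
  have le: "j \<in> {1..n}" if "\<nu> j \<noteq> 0" for j
  proof -
    have "j * \<nu> j \<le> (\<Sum>j\<in>{1..M}. j * \<nu> j)"
      using h that by (intro member_le_sum) auto
    moreover have "j * 1 \<le> j * \<nu> j" using that by (intro mult_left_mono) auto
    ultimately show ?thesis using h that by (metis atLeastAtMost_iff le_trans mult.right_neutral)
  qed
  have "(\<Sum>j\<in>{1..M}. j * \<nu> j) = (\<Sum>j\<in>{1..n}. j * \<nu> j)"
    using le assms by (intro sum.mono_neutral_right) (auto, fastforce)
  then show "\<nu> \<in> partitions_of n" using h le by (auto simp: partitions_of_def)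
qed

lemma finite_partitions_of: "finite (partitions_of n)"
proof (rule finite_subset)
  show "finite {\<nu>. \<forall>j. (j \<in> {1..n} \<longrightarrow> \<nu> j \<in> {0..n}) \<and> (j \<notin> {1..n} \<longrightarrow> \<nu> j = (0::nat))}"
    by (intro finite_set_of_finite_funs) auto
  have "\<nu> j \<le> n" if "\<nu> \<in> partitions_of n" "j \<in> {1..n}" for \<nu> j
  proof -
    have "\<nu> j \<le> j * \<nu> j" using that by auto
    also have "\<dots> \<le> (\<Sum>j\<in>{1..n}. j * \<nu> j)" using that by (intro member_le_sum) auto
    finally show ?thesis using that by (simp add: partitions_of_def)
  qed
  then have le: "\<forall>\<nu>\<in>partitions_of n. \<forall>j\<in>{1..n}. \<nu> j \<le> n" by blast
  show "partitions_of n \<subseteq> {\<nu>. \<forall>j. (j \<in> {1..n} \<longrightarrow> \<nu> j \<in> {0..n}) \<and> (j \<notin> {1..n} \<longrightarrow> \<nu> j = (0::nat))}"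
  proof (intro subsetI CollectI allI conjI impI)
    fix \<nu> j assume \<nu>: "\<nu> \<in> partitions_of n"
    show "\<nu> j \<in> {0..n}" if "j \<in> {1..n}" using le \<nu> that by simp
    show "\<nu> j = 0" if "j \<notin> {1..n}" using \<nu> that unfolding partitions_of_def by blast
  qed
qed

text \<open>\<open>psi_J\<close> makes each summand a product over part sizes: size j contributes a
  divided power of - g_j / j!, a term of the series of exp(- g_j X^j / j!).\<close>

lemma trace_poly_eq_weight:
  assumes "n \<le> M"
  shows "trace_poly n g = (\<Sum>\<nu>\<in>partitions_of n. partition_weight M g \<nu>)"
  unfolding trace_poly_def
proof (rule sum.cong)
  fix \<nu> assume h: "\<nu> \<in> partitions_of n"
  have "partition_weight M g \<nu> = (\<Prod>j\<in>{1..n}. (- g j / fact j) ^ \<nu> j / fact (\<nu> j))"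
    unfolding partition_weight_def using h assms
    by (intro prod.mono_neutral_right) (force simp: partitions_of_def)+
  also have "\<dots> = (\<Prod>j\<in>{1..n}. (-1) ^ \<nu> j / (fact (\<nu> j) * fact j ^ \<nu> j) * g j ^ \<nu> j)"
  proof (intro prod.cong refl)
    fix j
    have "(- g j / fact j) ^ \<nu> j = ((-1) * g j / fact j) ^ \<nu> j" by simp
    also have "\<dots> = (-1) ^ \<nu> j * g j ^ \<nu> j / fact j ^ \<nu> j"
      by (simp only: power_divide power_mult_distrib)
    finally show "(- g j / fact j) ^ \<nu> j / fact (\<nu> j) = (-1) ^ \<nu> j / (fact (\<nu> j) * fact j ^ \<nu> j) * g j ^ \<nu> j"
      by simp
  qed
  also have "\<dots> = psi_J n \<nu> * (\<Prod>j\<in>{1..n}. g j ^ \<nu> j)"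
    by (simp add: psi_J_def prod.distrib prod_dividef power_sum)
  finally show "psi_J n \<nu> * (\<Prod>j\<in>{1..n}. g j ^ \<nu> j) = partition_weight M g \<nu>" ..
qed simp

lemma binomial_divided_power:
  "(a + b) ^ n / fact n = (\<Sum>i\<le>n. b ^ i / fact i * (a ^ (n - i) / fact (n - i)))"
  for a b :: "'a::field_char_0"
proof -
  have "(a + b) ^ n / fact n = (\<Sum>i\<le>n. of_nat (n choose i) * b ^ i * a ^ (n - i)) / fact n"
    by (subst add.commute) (simp add: binomial_ring)
  also have "\<dots> = (\<Sum>i\<le>n. b ^ i / fact i * (a ^ (n - i) / fact (n - i)))"
    unfolding sum_divide_distrib by (intro sum.cong) (auto simp: binomial_fact)
  finally show ?thesis .
qed

text \<open>Only the factor of the parts of size 2 changes. The binomial theorem for divided powers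
  assigns i of the \<open>\<nu> 2\<close> twos to \<open>y\<close>; the denominator 2 is 2!.\<close>

lemma partition_weight_shift:
  assumes "M \<ge> 2"
  shows "partition_weight M (g(2 := g 2 + y)) \<nu> =
           (\<Sum>i\<le>\<nu> 2. (- y / 2) ^ i / fact i * partition_weight M g (\<nu>(2 := \<nu> 2 - i)))"
proof -
  let ?C = "\<Prod>j\<in>{1..M}-{2}. (- g j / fact j) ^ \<nu> j / fact (\<nu> j)"
  have split: "partition_weight M h \<mu> = (- h 2 / 2) ^ \<mu> 2 / fact (\<mu> 2) *
       (\<Prod>j\<in>{1..M}-{2}. (- h j / fact j) ^ \<mu> j / fact (\<mu> j))" for h \<mu>
    unfolding partition_weight_def using assms by (subst prod.remove[of _ 2]) (auto simp: numeral_2_eq_2)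
  have "partition_weight M (g(2 := g 2 + y)) \<nu> = (- g 2 / 2 + - y / 2) ^ \<nu> 2 / fact (\<nu> 2) * ?C"
    by (simp add: split diff_divide_distrib add_divide_distrib)
  also have "\<dots> = (\<Sum>i\<le>\<nu> 2. (- y / 2) ^ i / fact i * ((- g 2 / 2) ^ (\<nu> 2 - i) / fact (\<nu> 2 - i) * ?C))"
    unfolding binomial_divided_power sum_distrib_right by (simp add: mult.assoc)
  also have "\<dots> = (\<Sum>i\<le>\<nu> 2. (- y / 2) ^ i / fact i * partition_weight M g (\<nu>(2 := \<nu> 2 - i)))"
    by (simp add: split)
  finally show ?thesis .
qed

text \<open>Coefficientwise form of the multiplication of the generating function by exp(- y X^2 /
  2).\<close>

lemma trace_poly_shift:
  "trace_poly n (g(2 := g 2 + y)) =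
     (\<Sum>j\<in>{0..n div 2}. (- y / 2) ^ j / fact j * trace_poly (n - 2 * j) g)"
proof -
  obtain M where M: "n \<le> M" "2 \<le> M" by (metis max.cobounded1 max.cobounded2)
  let ?w = "\<lambda>i \<mu>. (- y / 2) ^ i / fact i * partition_weight M g \<mu>"
  have upd: "(\<Sum>j\<in>{1..M}. j * (\<nu>(2 := k)) j) = 2 * k + (\<Sum>j\<in>{1..M}-{2}. j * \<nu> j)" for \<nu> :: "nat \<Rightarrow> nat" and k
    by (subst sum.remove[of _ 2]) (auto simp: M)
  have orig: "(\<Sum>j\<in>{1..M}. j * \<nu> j) = 2 * \<nu> 2 + (\<Sum>j\<in>{1..M}-{2}. j * \<nu> j)" for \<nu> :: "nat \<Rightarrow> nat"
    using upd[of \<nu> "\<nu> 2"] by simp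
  have mem: "\<nu> \<in> partitions_of n' \<longleftrightarrow> (\<forall>j. \<nu> j \<noteq> 0 \<longrightarrow> j \<in> {1..M}) \<and> (\<Sum>j\<in>{1..M}. j * \<nu> j) = n'"
    if "n' \<le> n" for n' \<nu>
    using that M by (intro partitions_of_alt) auto
  have "trace_poly n (g(2 := g 2 + y)) = (\<Sum>\<nu>\<in>partitions_of n. \<Sum>i\<le>\<nu> 2. ?w i (\<nu>(2 := \<nu> 2 - i)))"
    by (simp add: trace_poly_eq_weight[of n M] partition_weight_shift M)
  also have "\<dots> = (\<Sum>(\<nu>, i)\<in>Sigma (partitions_of n) (\<lambda>\<nu>. {..\<nu> 2}). ?w i (\<nu>(2 := \<nu> 2 - i)))"
    by (intro sum.Sigma) (auto simp: finite_partitions_of)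
  also have "\<dots> = (\<Sum>(j, \<mu>)\<in>Sigma {0..n div 2} (\<lambda>j. partitions_of (n - 2 * j)). ?w j \<mu>)"
  \<comment> \<open>The index i counts the twos assigned to \<open>y\<close>. Removing them leaves a
    partition of n - 2i, and adding them back is the inverse.\<close>
  proof (rule sum.reindex_bij_witness[where
        i = "\<lambda>(j, \<mu>). (\<mu>(2 := \<mu> 2 + j), j)" and j = "\<lambda>(\<nu>, i). (i, \<nu>(2 := \<nu> 2 - i))"], goal_cases)
    case (2 x)
    obtain \<nu> i where x: "x = (\<nu>, i)" by (cases x)
    with 2 have \<nu>: "\<nu> \<in> partitions_of n" "i \<le> \<nu> 2" by auto
    then have *: "2 * \<nu> 2 + (\<Sum>j\<in>{1..M}-{2}. j * \<nu> j) = n" using mem[of n \<nu>] orig[of \<nu>] by auto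
    then have "2 * i \<le> n" using \<nu> by linarith
    moreover have "\<nu>(2 := \<nu> 2 - i) \<in> partitions_of (n - 2 * i)"
    proof (subst mem)
      show "(\<forall>j. (\<nu>(2 := \<nu> 2 - i)) j \<noteq> 0 \<longrightarrow> j \<in> {1..M}) \<and>
        (\<Sum>j\<in>{1..M}. j * (\<nu>(2 := \<nu> 2 - i)) j) = n - 2 * i"
        unfolding upd using \<nu> * mem[of n \<nu>] M by (auto simp: diff_mult_distrib2)
    qed simp
    ultimately show ?case by (auto simp: x)
  next
    case (4 x)
    obtain j \<mu> where x: "x = (j, \<mu>)" by (cases x)
    with 4 have \<mu>: "\<mu> \<in> partitions_of (n - 2 * j)" "j \<le> n div 2" by auto
    then have *: "2 * \<mu> 2 + (\<Sum>j\<in>{1..M}-{2}. j * \<mu> j) = n - 2 * j"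
      using mem[of "n - 2 * j" \<mu>] orig[of \<mu>] by auto
    have "2 * j \<le> n" using \<mu> by auto
    have "\<mu>(2 := \<mu> 2 + j) \<in> partitions_of n"
    proof (subst mem)
      show "(\<forall>i. (\<mu>(2 := \<mu> 2 + j)) i \<noteq> 0 \<longrightarrow> i \<in> {1..M}) \<and>
        (\<Sum>i\<in>{1..M}. i * (\<mu>(2 := \<mu> 2 + j)) i) = n"
        unfolding upd using \<mu> * \<open>2 * j \<le> n\<close> mem[of "n - 2 * j" \<mu>] M by auto
    qed simp
    then show ?case by (auto simp: x)
  qed auto
  also have "\<dots> = (\<Sum>j\<in>{0..n div 2}. (- y / 2) ^ j / fact j * trace_poly (n - 2 * j) g)"
    by (subst sum.Sigma[symmetric])
       (auto simp: finite_partitions_of trace_poly_eq_weight[of _ M, OF le_trans[OF diff_le_self M(1)]] sum_distrib_left)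
  finally show ?thesis .
qed

text \<open>If \<open>g j\<close> is given weight j, every partition of n has total weight n. This
  turns modularity of the individual \<open>g j\<close> into modularity of the trace.\<close>

lemma trace_poly_scale: "trace_poly n (\<lambda>j. x ^ j * g j) = x ^ n * trace_poly n g"
proof -
  have "(\<Prod>j\<in>{1..n}. (x ^ j * g j) ^ \<nu> j) = x ^ n * (\<Prod>j\<in>{1..n}. g j ^ \<nu> j)"
    if "\<nu> \<in> partitions_of n" for \<nu>
  proof -
    have "(\<Prod>j\<in>{1..n}. (x ^ j) ^ \<nu> j) = x ^ (\<Sum>j\<in>{1..n}. j * \<nu> j)"
      by (simp add: power_sum power_mult)
    then show ?thesis using that by (simp add: power_mult_distrib prod.distrib partitions_of_def)
  qed
  then show ?thesis by (simp add: trace_poly_def sum_distrib_left mult.left_commute cong: sum.cong)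
qed

lemma trace_poly_cong: "(\<And>j. j \<in> {1..n} \<Longrightarrow> g j = h j) \<Longrightarrow> trace_poly n g = trace_poly n h"
  unfolding trace_poly_def by (intro sum.cong arg_cong2[where f = "(*)"] prod.cong) auto

lemma trace_poly_0: "trace_poly 0 g = 1"
proof -
  have "partitions_of 0 = {\<lambda>_. 0}" by (auto simp: partitions_of_def)
  then show ?thesis by (simp add: trace_poly_def psi_J_def)
qed

lemma trace_poly_1: "trace_poly 1 g = - g 1"
proof -
  have "partitions_of 1 = {\<lambda>j. if j = 1 then 1 else 0}"
    by (auto simp: partitions_of_def fun_eq_iff split: if_splits)
  then show ?thesis by (simp add: trace_poly_def psi_J_def)
qed

section \<open>The theta series\<close>

text \<open>The k-th derivative in z of a term of the theta series. Keeping k as a parameter lets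
  one majorant serve the series of all derivatives.\<close>

definition theta_term :: "nat \<Rightarrow> complex \<Rightarrow> complex \<Rightarrow> int \<Rightarrow> complex" where
  "theta_term k z \<tau> n = (2 * pi * \<i> * (of_int n + 1/2)) ^ k *
     exp (2 * pi * \<i> * (of_int n + 1/2) * (z + 1/2) + pi * \<i> * \<tau> * (of_int n + 1/2)\<^sup>2)"

definition theta_d :: "nat \<Rightarrow> complex \<Rightarrow> complex \<Rightarrow> complex" where
  "theta_d k z \<tau> = (\<Sum>\<^sub>\<infinity>n. theta_term k z \<tau> n)"

lemma theta_d_0: "theta_d 0 z \<tau> = jtheta z \<tau>"
  by (simp add: theta_d_def jtheta_def theta_term_def exp_add mult_ac)

lemma norm_theta_term:
  "norm (theta_term k z \<tau> n) =
     (2 * pi * \<bar>of_int n + 1/2\<bar>) ^ k * exp (- (2 * pi * (of_int n + 1/2) * Im z) - pi * Im \<tau> * (of_int n + 1/2)\<^sup>2)"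
proof -
  define h :: real where "h = of_int n + 1/2"
  have h: "(of_int n + 1/2 :: complex) = of_real h" by (simp add: h_def)
  show ?thesis
    unfolding theta_term_def h h_def[symmetric]
    by (simp add: norm_mult norm_power abs_mult flip: of_real_power)
qed

text \<open>The exponential series gives (2\<pi>x)^k <= k! exp(2\<pi>x), which trades the power for
  a linear exponent. Completing the square then bounds the quadratic exponent; the summand 1 in b +
  2\<pi> + 1 pays for the factor exp(-x) that is split off for summability.\<close>

lemma exp_poly_gauss_bound:
  fixes b v x :: real
  assumes "v > 0" "x \<ge> 0"
  shows "(2 * pi * x) ^ k * exp (b * x - v * x\<^sup>2) \<le> fact k * exp ((b + 2 * pi + 1)\<^sup>2 / (4 * v)) * exp (- x)"
proof -
  have "(2 * pi * x) ^ k / fact k \<le> exp (2 * pi * x)"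
  proof -
    have "(\<lambda>n. (2 * pi * x) ^ n /\<^sub>R fact n) sums exp (2 * pi * x)" by (rule exp_converges)
    then have "(\<lambda>n. (2 * pi * x) ^ n / fact n) sums exp (2 * pi * x)"
      by (simp add: field_simps)
    from sums_unique[OF this] sums_summable[OF this] show ?thesis
      using sum_le_suminf[of "\<lambda>n. (2 * pi * x) ^ n / fact n" "{k}"] assms by auto
  qed
  then have "(2 * pi * x) ^ k \<le> fact k * exp (2 * pi * x)" by (simp add: field_simps)
  then have "(2 * pi * x) ^ k * exp (b * x - v * x\<^sup>2) \<le> (fact k * exp (2 * pi * x)) * exp (b * x - v * x\<^sup>2)"
    by (rule mult_right_mono) simp
  also have "\<dots> = fact k * exp ((b + 2 * pi + 1) * x - v * x\<^sup>2) * exp (- x)"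
    by (simp add: exp_add[symmetric] mult.assoc algebra_simps)
  also have "(b + 2 * pi + 1) * x - v * x\<^sup>2 \<le> (b + 2 * pi + 1)\<^sup>2 / (4 * v)"
  proof -
    have "0 \<le> (2 * v * x - (b + 2 * pi + 1))\<^sup>2 / (4 * v)" using assms by simp
    also have "\<dots> = (b + 2 * pi + 1)\<^sup>2 / (4 * v) - ((b + 2 * pi + 1) * x - v * x\<^sup>2)"
      using assms by (simp add: field_simps power2_eq_square)
    finally show ?thesis by simp
  qed
  finally show ?thesis by simp
qed

lemma summable_on_exp_int: "(\<lambda>n::int. exp (- \<bar>of_int n + 1/2\<bar>) :: real) summable_on UNIV"
proof -
  let ?f = "\<lambda>n::int. exp (- \<bar>of_int n + 1/2\<bar>) :: real"
  have geo: "(\<lambda>n::nat. exp (- (real n + 1/2))) summable_on UNIV"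
  proof (subst summable_on_UNIV_nonneg_real_iff)
    have "summable (\<lambda>n. exp (-1/2) * exp (-1::real) ^ n)"
      by (intro summable_mult summable_geometric) simp
    then show "summable (\<lambda>n::nat. exp (- (real n + 1/2)))"
      by (simp add: exp_of_nat_mult[symmetric] exp_add[symmetric] algebra_simps)
  qed simp
  have "?f summable_on range int"
    using geo by (subst summable_on_reindex) (auto simp: o_def abs_if)
  \<comment> \<open>The reflection n |-> -1 - n negates n + 1/2 and exchanges the two halves of the
    integers.\<close>
  moreover have "?f summable_on range (\<lambda>n. - 1 - int n)"
    using geo by (subst summable_on_reindex) (auto simp: o_def inj_def abs_if algebra_simps)
  moreover have "range int \<inter> range (\<lambda>n. - 1 - int n) = {}" by auto
  ultimately have "?f summable_on (range int \<union> range (\<lambda>n. - 1 - int n))"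
    by (rule summable_on_Un_disjoint)
  moreover have "n \<in> range int \<union> range (\<lambda>n. - 1 - int n)" for n
  proof (cases "n \<ge> 0")
    case True
    then show ?thesis by (intro UnI1) (auto intro: range_eqI[of _ _ "nat n"])
  next
    case False
    then show ?thesis by (intro UnI2) (auto intro: range_eqI[of _ _ "nat (- 1 - n)"])
  qed
  then have "range int \<union> range (\<lambda>n. - 1 - int n) = UNIV" by blast
  ultimately show ?thesis by simp
qed

text \<open>The majorant depends on z and \<tau> only through bounds for their imaginary parts, so
  convergence is locally uniform in both variables jointly.\<close>

lemma theta_term_bound:
  assumes "v > 0" "\<bar>Im z\<bar> \<le> B" "v \<le> Im \<tau>"
  shows "norm (theta_term k z \<tau> n) \<le>
    fact k * exp ((2 * pi * B + 2 * pi + 1)\<^sup>2 / (4 * (pi * v))) * exp (- \<bar>of_int n + 1/2\<bar>)"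
proof -
  define h :: real where "h = of_int n + 1/2"
  have "- (2 * pi * h * Im z) = 2 * pi * (- (h * Im z))" by simp
  also have "\<dots> \<le> 2 * pi * (\<bar>h\<bar> * \<bar>Im z\<bar>)"
    using abs_ge_minus_self[of "h * Im z"] by (intro mult_left_mono) (auto simp: abs_mult)
  also have "\<dots> \<le> 2 * pi * (\<bar>h\<bar> * B)"
    using assms by (intro mult_left_mono) auto
  finally have 1: "- (2 * pi * h * Im z) \<le> 2 * pi * B * \<bar>h\<bar>" by (simp add: mult_ac)
  have 2: "pi * v * \<bar>h\<bar>\<^sup>2 \<le> pi * Im \<tau> * h\<^sup>2"
    using assms by (simp add: mult_right_mono)
  have "norm (theta_term k z \<tau> n) \<le> (2 * pi * \<bar>h\<bar>) ^ k * exp (2 * pi * B * \<bar>h\<bar> - pi * v * \<bar>h\<bar>\<^sup>2)"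
    unfolding norm_theta_term h_def[symmetric]
    by (intro mult_left_mono iffD2[OF exp_le_cancel_iff] diff_mono 1 2) auto
  also have "\<dots> \<le> fact k * exp ((2 * pi * B + 2 * pi + 1)\<^sup>2 / (4 * (pi * v))) * exp (- \<bar>h\<bar>)"
    using assms by (intro exp_poly_gauss_bound) auto
  finally show ?thesis by (simp add: h_def)
qed

lemma theta_uniform_limit:
  assumes "v > 0" "\<And>s. s \<in> S \<Longrightarrow> \<bar>Im (f s)\<bar> \<le> B" "\<And>s. s \<in> S \<Longrightarrow> v \<le> Im (g s)"
  shows "uniform_limit S (\<lambda>X s. \<Sum>n\<in>X. theta_term k (f s) (g s) n) (\<lambda>s. theta_d k (f s) (g s))
           (finite_subsets_at_top UNIV)"
  unfolding theta_d_def
proof (rule Weierstrass_m_test_general)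
  show "(\<lambda>n::int. fact k * exp ((2 * pi * B + 2 * pi + 1)\<^sup>2 / (4 * (pi * v))) *
           exp (- \<bar>of_int n + 1/2\<bar>)) summable_on UNIV"
    by (intro summable_on_cmult_right summable_on_exp_int)
qed (use assms theta_term_bound in auto)

lemma theta_term_summable:
  assumes "\<tau> \<in> uhp"
  shows "theta_term k z \<tau> summable_on UNIV"
proof (rule Infinite_Sum.abs_summable_summable, rule Infinite_Sum.abs_summable_on_comparison_test')
  show "(\<lambda>n::int. fact k * exp ((2 * pi * \<bar>Im z\<bar> + 2 * pi + 1)\<^sup>2 / (4 * (pi * Im \<tau>))) *
           exp (- \<bar>of_int n + 1/2\<bar>)) summable_on UNIV"
    by (intro summable_on_cmult_right summable_on_exp_int)
qed (use assms theta_term_bound[of "Im \<tau>" z "\<bar>Im z\<bar>" \<tau>] in \<open>auto simp: uhp_def\<close>)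

lemma theta_term_holomorphic:
  assumes "f holomorphic_on A" "g holomorphic_on A"
  shows "(\<lambda>s. theta_term k (f s) (g s) n) holomorphic_on A"
  unfolding theta_term_def using assms by (intro holomorphic_intros)

text \<open>Stated along an arbitrary holomorphic curve s |-> (f s, g s): a constant g gives
  holomorphy in z, and f a torsion point with g the identity gives holomorphy in \<tau>.\<close>

lemma theta_d_holomorphic:
  assumes "f holomorphic_on A" "g holomorphic_on A" "open A" "g ` A \<subseteq> uhp"
  shows "(\<lambda>s. theta_d k (f s) (g s)) holomorphic_on A"
proof -
  have "\<exists>r>0. (\<lambda>s. theta_d k (f s) (g s)) holomorphic_on ball x r" if x: "x \<in> A" for x
  proof -
    obtain r where r: "r > 0" "cball x r \<subseteq> A" using assms(3) x open_contains_cball by blast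
    have "continuous_on (cball x r) (\<lambda>s. Im (g s))" "continuous_on (cball x r) (\<lambda>s. \<bar>Im (f s)\<bar>)"
      using r assms by (auto intro!: continuous_intros holomorphic_on_imp_continuous_on
          intro: holomorphic_on_subset)
    note cont = this
    have ne: "cball x r \<noteq> {}" using r by auto
    obtain y where y: "y \<in> cball x r" "\<forall>s\<in>cball x r. Im (g y) \<le> Im (g s)"
      using continuous_attains_inf[OF compact_cball ne cont(1)] by blast
    obtain B where B: "\<forall>s\<in>cball x r. \<bar>Im (f s)\<bar> \<le> \<bar>Im (f B)\<bar>"
      using continuous_attains_sup[OF compact_cball ne cont(2)] by blast
    have "Im (g y) > 0" using y(1) r(2) assms(4) unfolding uhp_def by blast
    then have lim: "uniform_limit (cball x r) (\<lambda>X s. \<Sum>n\<in>X. theta_term k (f s) (g s) n)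
        (\<lambda>s. theta_d k (f s) (g s)) (finite_subsets_at_top UNIV)"
      using y B by (intro theta_uniform_limit) auto
    have "(\<lambda>s. \<Sum>n\<in>X. theta_term k (f s) (g s) n) holomorphic_on A" for X
      by (intro holomorphic_intros theta_term_holomorphic assms)
    then have "(\<lambda>s. \<Sum>n\<in>X. theta_term k (f s) (g s) n) holomorphic_on cball x r" for X
      using r(2) holomorphic_on_subset by blast
    then have "\<forall>\<^sub>F X in finite_subsets_at_top UNIV. continuous_on (cball x r) (\<lambda>s. \<Sum>n\<in>X. theta_term k (f s) (g s) n)
        \<and> (\<lambda>s. \<Sum>n\<in>X. theta_term k (f s) (g s) n) holomorphic_on ball x r"
      by (intro always_eventually allI conjI holomorphic_on_imp_continuous_on)
        (auto intro: holomorphic_on_subset[OF _ ball_subset_cball])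
    from holomorphic_uniform_limit[OF this lim] show ?thesis using r(1) by auto
  qed
  then show ?thesis
    by (metis analytic_imp_holomorphic analytic_on_def)
qed

lemma theta_d_has_derivative:
  assumes "\<tau> \<in> uhp"
  shows "((\<lambda>z. theta_d k z \<tau>) has_field_derivative theta_d (Suc k) z \<tau>) (at z)"
proof -
  let ?F = "finite_subsets_at_top (UNIV :: int set)"
  have "(\<lambda>z. theta_d k z \<tau>) holomorphic_on UNIV"
    using assms by (intro theta_d_holomorphic holomorphic_intros) auto
  then have hol: "((\<lambda>z. theta_d k z \<tau>) has_field_derivative deriv (\<lambda>z. theta_d k z \<tau>) z) (at z)"
    by (auto intro: holomorphic_derivI)
  have Im_le: "\<bar>Im s\<bar> \<le> \<bar>Im z\<bar> + 1" if "s \<in> ball z 1" for s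
  proof -
    have "\<bar>Im (z - s)\<bar> < 1" using that abs_Im_le_cmod[of "z - s"] by (simp add: dist_norm)
    then show ?thesis by auto
  qed
  have "((\<lambda>X. (deriv ^^ 1) (\<lambda>s. \<Sum>n\<in>X. theta_term k s \<tau> n) z) \<longlongrightarrow> (deriv ^^ 1) (\<lambda>s. theta_d k s \<tau>) z) ?F"
  proof (rule higher_deriv_complex_uniform_limit)
    show "uniform_limit (ball z 1) (\<lambda>X s. \<Sum>n\<in>X. theta_term k s \<tau> n) (\<lambda>s. theta_d k s \<tau>) ?F"
      using Im_le assms by (intro theta_uniform_limit[where v = "Im \<tau>" and B = "\<bar>Im z\<bar> + 1"]) (auto simp: uhp_def)
  qed (auto intro!: always_eventually holomorphic_intros theta_term_holomorphic)
  moreover have "deriv (\<lambda>s. \<Sum>n\<in>X. theta_term k s \<tau> n) z = (\<Sum>n\<in>X. theta_term (Suc k) z \<tau> n)" for X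
    unfolding theta_term_def
    by (rule DERIV_imp_deriv) (auto intro!: derivative_eq_intros sum.cong)
  ultimately have "((\<lambda>X. \<Sum>n\<in>X. theta_term (Suc k) z \<tau> n) \<longlongrightarrow> deriv (\<lambda>s. theta_d k s \<tau>) z) ?F"
    by simp
  moreover have "((\<lambda>X. \<Sum>n\<in>X. theta_term (Suc k) z \<tau> n) \<longlongrightarrow> theta_d (Suc k) z \<tau>) ?F"
    using has_sum_infsum[OF theta_term_summable[OF assms]] unfolding has_sum_def theta_d_def .
  ultimately have "deriv (\<lambda>s. theta_d k s \<tau>) z = theta_d (Suc k) z \<tau>"
    by (intro tendsto_unique[OF finite_subsets_at_top_neq_bot])
  with hol show ?thesis by simp
qed

lemma jtheta_holomorphic:
  assumes "\<tau> \<in> uhp" shows "(\<lambda>z. jtheta z \<tau>) holomorphic_on A"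
  using theta_d_has_derivative[OF assms, of 0] unfolding theta_d_0
  by (meson holomorphic_on_def field_differentiable_at_within field_differentiable_def)

section \<open>Quasi-periods, parity and nonvanishing of theta\<close>

lemma exp_2pi_int: "exp (z + 2 * pi * \<i> * of_int n) = exp z"
  unfolding exp_eq by (intro exI[of _ n]) simp

text \<open>Completing the square in the exponent turns translation by l\<tau> + \<mu> into the
  index shift n |-> n + l; what is left over is 2\<pi>i times the integer l - n\<mu>.\<close>

lemma jtheta_quasi_periodic:
  "jtheta (z + of_int l * \<tau> + of_int \<mu>) \<tau> =
     exp (pi * \<i> * (of_int l + of_int \<mu>) - pi * \<i> * (of_int l)\<^sup>2 * \<tau> - 2 * pi * \<i> * of_int l * z) * jtheta z \<tau>"
  (is "_ = ?E * _")
proof -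
  have "theta_term 0 (z + of_int l * \<tau> + of_int \<mu>) \<tau> n = ?E * theta_term 0 z \<tau> (n + l)" for n
  proof -
    have "?E * theta_term 0 z \<tau> (n + l) = exp (2 * pi * \<i> * (of_int n + 1/2) * (z + of_int l * \<tau> + of_int \<mu> + 1/2) + pi * \<i> * \<tau> * (of_int n + 1/2)\<^sup>2
        + 2 * pi * \<i> * of_int (l - n * \<mu>))"
      unfolding theta_term_def power_0 mult_1 exp_add[symmetric]
      by (rule arg_cong[where f = exp]) (simp add: field_simps power2_eq_square)
    then show ?thesis unfolding exp_2pi_int by (simp add: theta_term_def)
  qed
  then have "jtheta (z + of_int l * \<tau> + of_int \<mu>) \<tau> = (\<Sum>\<^sub>\<infinity>n. ?E * theta_term 0 z \<tau> (n + l))"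
    unfolding theta_d_0[symmetric] theta_d_def by (intro infsum_cong)
  also have "\<dots> = (\<Sum>\<^sub>\<infinity>n. ?E * theta_term 0 z \<tau> n)"
    by (rule infsum_reindex_bij_betw) (rule bij_betwI[of _ _ _ "\<lambda>n. n - l"], auto)
  also have "\<dots> = ?E * jtheta z \<tau>"
    unfolding theta_d_0[symmetric] theta_d_def by (rule infsum_cmult_right') 
  finally show ?thesis .
qed

text \<open>The reflection n |-> -1 - n negates n + 1/2; the sign arises from the shift by 1/2 in z
  + 1/2.\<close>

lemma jtheta_minus: "jtheta (- z) \<tau> = - jtheta z \<tau>"
proof -
  have "theta_term 0 (- z) \<tau> n = - theta_term 0 z \<tau> (- 1 - n)" for n
  proof -
    have "- theta_term 0 z \<tau> (- 1 - n) = exp (pi * \<i>) * theta_term 0 z \<tau> (- 1 - n)" by simp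
    also have "\<dots> = exp (2 * pi * \<i> * (of_int n + 1/2) * (- z + 1/2) + pi * \<i> * \<tau> * (of_int n + 1/2)\<^sup>2
        + 2 * pi * \<i> * of_int (- n))"
      unfolding theta_term_def power_0 mult_1 exp_add[symmetric]
      by (rule arg_cong[where f = exp]) (simp add: field_simps power2_eq_square)
    finally show ?thesis unfolding exp_2pi_int by (simp add: theta_term_def)
  qed
  then have "jtheta (- z) \<tau> = (\<Sum>\<^sub>\<infinity>n. - theta_term 0 z \<tau> (- 1 - n))"
    unfolding theta_d_0[symmetric] theta_d_def by (intro infsum_cong)
  also have "\<dots> = (\<Sum>\<^sub>\<infinity>n. - theta_term 0 z \<tau> n)"
    by (rule infsum_reindex_bij_betw) (rule bij_betwI[of _ _ _ "\<lambda>n. - 1 - n"], auto)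
  also have "\<dots> = - jtheta z \<tau>"
    unfolding theta_d_0[symmetric] theta_d_def by (rule infsum_uminus)
  finally show ?thesis .
qed

lemma jtheta_0: "jtheta 0 \<tau> = 0"
  using jtheta_minus[of 0 \<tau>] by simp

lemma has_integral_exp_int:
  assumes "n \<noteq> 0"
  shows "((\<lambda>x::real. exp (2 * pi * \<i> * of_int n * of_real x)) has_integral 0) {0..1}"
proof -
  define c where "c = 2 * pi * \<i> * of_int n"
  have c: "c \<noteq> 0" using assms by (simp add: c_def)
  have "((\<lambda>x::real. exp (c * of_real x)) has_integral exp (c * of_real 1) / c - exp (c * of_real 0) / c) {0..1}"
  proof (rule fundamental_theorem_of_calculus)
    fix x :: real
    have "((\<lambda>z. exp (c * z) / c) has_field_derivative exp (c * x)) (at (of_real x))"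
      using c by (auto intro!: derivative_eq_intros)
    then show "((\<lambda>x. exp (c * of_real x) / c) has_vector_derivative exp (c * x)) (at x within {0..1})"
      using has_vector_derivative_real_field has_vector_derivative_at_within by blast
  qed simp
  moreover have "exp c = 1" using exp_2pi_int[of 0 n] by (simp add: c_def)
  ultimately show ?thesis by (simp add: c_def)
qed

text \<open>The constant Fourier coefficient of \<open>exp (- \<pi> \<i> x) * jtheta x \<tau>\<close> does not vanish.\<close>

lemma jtheta_nonzero:
  assumes "\<tau> \<in> uhp"
  obtains z where "jtheta z \<tau> \<noteq> 0"
proof (rule ccontr)
  assume "\<not> thesis"
  with that have zero: "jtheta z \<tau> = 0" for z by auto
  define a :: "int \<Rightarrow> complex" where
    "a n = exp (pi * \<i> * (of_int n + 1/2) + pi * \<i> * \<tau> * (of_int n + 1/2)\<^sup>2)" for n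
  let ?F = "finite_subsets_at_top (UNIV :: int set)"
  let ?f = "\<lambda>X (x::real). exp (- pi * \<i> * x) * (\<Sum>n\<in>X. theta_term 0 x \<tau> n)"
  have lim: "uniform_limit {0..1} (\<lambda>X x::real. \<Sum>n\<in>X. theta_term 0 x \<tau> n) (\<lambda>_. 0) ?F"
    using theta_uniform_limit[of "Im \<tau>" "{0..1}" complex_of_real 0 "\<lambda>_. \<tau>" 0] assms zero
    by (simp add: uhp_def theta_d_0)
  have lim': "uniform_limit {0..1} ?f (\<lambda>_. 0) ?F"
  proof -
    show ?thesis
      using lim unfolding uniform_limit_iff by (simp add: norm_mult)
  qed
  have term_eq: "exp (- pi * \<i> * x) * theta_term 0 x \<tau> n = a n * exp (2 * pi * \<i> * of_int n * x)" for x :: real and n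
    unfolding theta_term_def a_def power_0 mult_1 exp_add[symmetric]
    by (rule arg_cong[where f = exp]) (simp add: field_simps)
  have cont: "continuous_on {0..1} (?f X)" for X
    unfolding theta_term_def by (intro continuous_intros)
  obtain I J where I: "\<And>X. (?f X has_integral I X) {0..1}"
    and J: "((\<lambda>x. 0) has_integral J) {0..1::real}" and IJ: "(I \<longlongrightarrow> J) ?F"
    by (rule uniform_limit_integral[OF lim' cont finite_subsets_at_top_neq_bot]) (rule that)
  have "J = 0" using J by (simp add: has_integral_iff)
  have "I X = a 0" if X: "finite X" "0 \<in> X" for X
  proof (rule has_integral_unique[OF I])
    have *: "((\<lambda>x::real. a n * exp (2 * pi * \<i> * of_int n * x)) has_integral (if n = 0 then a 0 else 0)) {0..1}" for n
    proof (cases "n = 0")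
      case True
      then show ?thesis using has_integral_const_real[of "a 0" 0 1] by simp
    next
      case False
      then show ?thesis using has_integral_mult_right[OF has_integral_exp_int[OF False], of "a n"] by simp
    qed
    have "((\<lambda>x::real. \<Sum>n\<in>X. a n * exp (2 * pi * \<i> * of_int n * x)) has_integral (\<Sum>n\<in>X. if n = 0 then a 0 else 0)) {0..1}"
      using X by (intro has_integral_sum *) auto
    then show "(?f X has_integral a 0) {0..1}"
      using X by (simp add: sum_distrib_left term_eq del: of_real_minus)
  qed
  then have "\<forall>\<^sub>F X in ?F. I X = a 0"
    unfolding eventually_finite_subsets_at_top by (intro exI[of _ "{0}"]) auto
  then have "(I \<longlongrightarrow> a 0) ?F" by (rule tendsto_eventually)
  with IJ \<open>J = 0\<close> have "a 0 = 0"
    using tendsto_unique finite_subsets_at_top_neq_bot by metis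
  then show False by (simp add: a_def)
qed

section \<open>The theta product\<close>

lemma period_latticeI: "of_int a + of_int b * \<tau> \<in> period_lattice \<tau>"
  by (auto simp: period_lattice_def)

text \<open>The value type is arbitrary so that predicates count as periodic functions too, for
  instance the vanishing of a quasi-periodic function or membership in the lattice.\<close>

lemma periodic_lattice:
  fixes P :: "complex \<Rightarrow> 'b"
  assumes "\<And>z. P (z + 1) = P z" "\<And>z. P (z + \<tau>) = P z"
  shows "P (z + (of_int a + of_int b * \<tau>)) = P z"
proof -
  have 1: "P (z + of_int a) = P z" for z a
  proof (induction a rule: int_induct[where k = 0])
    case (step1 i)
    then show ?case using assms(1)[of "z + of_int i"] by (simp add: add_ac)
  next
    case (step2 i)
    then show ?case using assms(1)[of "z + of_int i - 1"] by (simp add: algebra_simps)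
  qed simp
  have "P (z + of_int b * \<tau>) = P z"
  proof (induction b rule: int_induct[where k = 0])
    case (step1 i)
    then show ?case using assms(2)[of "z + of_int i * \<tau>"] by (simp add: algebra_simps)
  next
    case (step2 i)
    then show ?case using assms(2)[of "z + of_int i * \<tau> - \<tau>"] by (simp add: algebra_simps)
  qed simp
  then show ?thesis using 1[of "z + of_int b * \<tau>" a] by (simp add: algebra_simps)
qed

text \<open>All values are attained on the compact period parallelogram, so Liouville's theorem
  applies; x and y are the coordinates of z in the real basis 1, \<tau>.\<close>

lemma elliptic_entire_imp_constant:
  assumes "\<tau> \<in> uhp" "f holomorphic_on UNIV" "\<And>z. f (z + 1) = f z" "\<And>z. f (z + \<tau>) = f z"
  obtains c where "\<And>z. f z = c"
proof -
  let ?K = "(\<lambda>(x, y). of_real x + of_real y * \<tau>) ` ({0..1} \<times> {0..1::real})"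
  have "compact ?K"
    unfolding case_prod_unfold
    by (intro compact_continuous_image compact_Times continuous_intros) auto
  moreover have "continuous_on ?K f"
    using assms(2) holomorphic_on_imp_continuous_on continuous_on_subset by blast
  ultimately have "compact (f ` ?K)" by (rule compact_continuous_image[rotated])
  then have "bounded (f ` ?K)" by (rule compact_imp_bounded)
  moreover have "range f \<subseteq> f ` ?K"
  proof clarify
    fix z
    define y where "y = Im z / Im \<tau>"
    define x where "x = Re z - y * Re \<tau>"
    have "Im \<tau> \<noteq> 0" using assms(1) by (simp add: uhp_def)
    then have "z = of_real x + of_real y * \<tau>"
      by (simp add: complex_eq_iff x_def y_def)
    also have "\<dots> = (of_real (frac x) + of_real (frac y) * \<tau>) + (of_int \<lfloor>x\<rfloor> + of_int \<lfloor>y\<rfloor> * \<tau>)"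
      by (simp add: frac_def algebra_simps)
    finally have "f z = f (of_real (frac x) + of_real (frac y) * \<tau>)"
      using periodic_lattice[of f, OF assms(3,4)] by simp
    moreover have "(frac x, frac y) \<in> {0..1} \<times> {0..1}"
      using frac_lt_1[of x] frac_lt_1[of y] by (simp add: frac_ge_0 less_imp_le)
    ultimately show "f z \<in> f ` ?K" by (metis (mono_tags, lifting) case_prod_conv image_eqI)
  qed
  ultimately have "bounded (range f)" using bounded_subset by blast
  then have "f constant_on UNIV" using Liouville_theorem assms(2) by blast
  then show ?thesis using that by (auto simp: constant_on_def)
qed

section \<open>The infinite product, its zeros and its quasi-periods\<close>

definition nome :: "complex \<Rightarrow> complex" where "nome \<tau> = exp (2 * pi * \<i> * \<tau>)"

lemma norm_nome: "\<tau> \<in> uhp \<Longrightarrow> norm (nome \<tau>) < 1"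
  by (simp add: nome_def uhp_def)

definition theta_factor :: "complex \<Rightarrow> nat \<Rightarrow> complex \<Rightarrow> complex" where
  "theta_factor \<tau> n z =
     (1 - nome \<tau> ^ Suc n * exp (2 * pi * \<i> * z)) * (1 - nome \<tau> ^ Suc n * exp (- 2 * pi * \<i> * z))"

definition theta_tail :: "complex \<Rightarrow> complex \<Rightarrow> complex" where
  "theta_tail \<tau> z = (\<Prod>n. theta_factor \<tau> n z)"

definition theta_product :: "complex \<Rightarrow> complex \<Rightarrow> complex" where
  "theta_product \<tau> z = (exp (pi * \<i> * z) - exp (- pi * \<i> * z)) * theta_tail \<tau> z"

lemma theta_factor_bound:
  assumes "\<tau> \<in> uhp" "\<bar>Im z\<bar> \<le> B"
  shows "norm (theta_factor \<tau> n z - 1) \<le> norm (nome \<tau>) ^ Suc n * (2 * exp (2 * pi * B) + 1)"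
proof -
  define q where "q = norm (nome \<tau>)"
  have q: "0 \<le> q" "q < 1" using norm_nome[OF assms(1)] by (auto simp: q_def)
  have e: "norm (exp (2 * pi * \<i> * z)) \<le> exp (2 * pi * B)" "norm (exp (- 2 * pi * \<i> * z)) \<le> exp (2 * pi * B)"
    using assms(2) mult_left_mono[of "- Im z" B pi] mult_left_mono[of "Im z" B pi] by (auto simp: abs_le_iff mult_ac)
  \<comment> \<open>As \<zeta> and 1/\<zeta> cancel, three terms remain after subtracting 1. The
    last one, of size |q|^(2n+2) <= |q|^(n+1), accounts for the summand 1 in the bound.\<close>
  have "theta_factor \<tau> n z - 1 = - (nome \<tau> ^ Suc n * exp (2 * pi * \<i> * z)) - nome \<tau> ^ Suc n * exp (- 2 * pi * \<i> * z)
      + nome \<tau> ^ Suc n * nome \<tau> ^ Suc n * (exp (2 * pi * \<i> * z) * exp (- 2 * pi * \<i> * z))"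
    by (simp add: theta_factor_def algebra_simps)
  also have "exp (2 * pi * \<i> * z) * exp (- 2 * pi * \<i> * z) = 1" by (simp add: exp_minus_inverse)
  finally have "norm (theta_factor \<tau> n z - 1) \<le> norm (nome \<tau> ^ Suc n * exp (2 * pi * \<i> * z))
      + norm (nome \<tau> ^ Suc n * exp (- 2 * pi * \<i> * z)) + norm (nome \<tau> ^ Suc n * nome \<tau> ^ Suc n)"
    by (metis (no_types, opaque_lifting) mult.right_neutral norm_minus_cancel norm_triangle_ineq4
        norm_triangle_le add_mono order_refl)
  also have "\<dots> \<le> q ^ Suc n * exp (2 * pi * B) + q ^ Suc n * exp (2 * pi * B) + q ^ Suc n * 1"
    unfolding norm_mult norm_power q_def[symmetric]
    using q e by (intro add_mono mult_mono power_le_one) auto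
  finally show ?thesis by (simp add: q_def algebra_simps)
qed

lemma theta_factor_summable:
  assumes "\<tau> \<in> uhp"
  shows "summable (\<lambda>n. norm (nome \<tau>) ^ Suc n * C)"
  using norm_nome[OF assms] by (intro summable_mult2) (simp add: summable_geometric)

lemma theta_factor_convergent_prod:
  assumes "\<tau> \<in> uhp"
  shows "convergent_prod (\<lambda>n. theta_factor \<tau> n z)"
proof (rule abs_convergent_prod_imp_convergent_prod, subst abs_convergent_prod_conv_summable)
  show "summable (\<lambda>n. norm (theta_factor \<tau> n z - 1))"
    by (rule summable_comparison_test'[OF theta_factor_summable[OF assms, of "2 * exp (2 * pi * \<bar>Im z\<bar>) + 1"]])
      (use theta_factor_bound[OF assms, of z "\<bar>Im z\<bar>"] in auto)
qed

lemma theta_factor_holomorphic: "theta_factor \<tau> n holomorphic_on A"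
  unfolding theta_factor_def by (intro holomorphic_intros)

lemma theta_tail_uniform_limit:
  assumes "\<tau> \<in> uhp" "compact A"
  shows "uniform_limit A (\<lambda>N z. \<Prod>n<N. theta_factor \<tau> n z) (theta_tail \<tau>) sequentially"
proof -
  have "\<exists>B. \<forall>z\<in>A. \<bar>Im z\<bar> \<le> B"
    using compact_imp_bounded[OF assms(2)] unfolding bounded_iff
    by (meson abs_Im_le_cmod order_trans)
  then obtain B where B: "\<forall>z\<in>A. \<bar>Im z\<bar> \<le> B" by blast
  have "uniformly_convergent_on A (\<lambda>N z. \<Sum>n<N. norm (theta_factor \<tau> n z - 1))"
    by (rule Weierstrass_m_test'[OF _ theta_factor_summable[OF assms(1), of "2 * exp (2 * pi * B) + 1"]])
      (use theta_factor_bound[OF assms(1)] B in auto)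
  then have "uniformly_convergent_on A (\<lambda>N z. \<Prod>n<N. theta_factor \<tau> n z)"
    using assms(2) theta_factor_holomorphic
    by (intro uniformly_convergent_on_prod') (auto intro: holomorphic_on_imp_continuous_on)
  then have "uniform_limit A (\<lambda>N z. \<Prod>n<N. theta_factor \<tau> n z) (\<lambda>z. lim (\<lambda>N. \<Prod>n<N. theta_factor \<tau> n z)) sequentially"
    by (simp add: uniformly_convergent_uniform_limit_iff)
  moreover have "lim (\<lambda>N. \<Prod>n<N. theta_factor \<tau> n z) = theta_tail \<tau> z" for z
    unfolding theta_tail_def
    by (intro limI has_prod_imp_tendsto' convergent_prod_has_prod theta_factor_convergent_prod assms(1))
  ultimately show ?thesis by simp
qed

lemma theta_tail_LIMSEQ:
  "\<tau> \<in> uhp \<Longrightarrow> (\<lambda>N. \<Prod>n<N. theta_factor \<tau> n z) \<longlonglongrightarrow> theta_tail \<tau> z"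
  unfolding theta_tail_def
  by (intro has_prod_imp_tendsto' convergent_prod_has_prod theta_factor_convergent_prod)

lemma theta_tail_holomorphic:
  assumes "\<tau> \<in> uhp"
  shows "theta_tail \<tau> holomorphic_on A"
proof -
  have "theta_tail \<tau> holomorphic_on UNIV"
  proof (rule holomorphic_uniform_sequence)
    show "(\<lambda>z. \<Prod>n<N. theta_factor \<tau> n z) holomorphic_on UNIV" for N
      by (intro holomorphic_intros theta_factor_holomorphic)
    show "\<exists>d>0. cball x d \<subseteq> UNIV \<and> uniform_limit (cball x d) (\<lambda>N z. \<Prod>n<N. theta_factor \<tau> n z) (theta_tail \<tau>) sequentially" for x
      using theta_tail_uniform_limit[OF assms compact_cball] by (intro exI[of _ 1]) auto
  qed auto
  then show ?thesis by (rule holomorphic_on_subset) auto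
qed

lemma theta_tail_eq_0_iff:
  assumes "\<tau> \<in> uhp"
  shows "theta_tail \<tau> z = 0 \<longleftrightarrow> (\<exists>n. theta_factor \<tau> n z = 0)"
  using has_prod_eq_0_iff[OF convergent_prod_has_prod[OF theta_factor_convergent_prod[OF assms]], of z]
  unfolding theta_tail_def image_def by auto

lemma nome_power: "nome \<tau> ^ n = exp (2 * pi * \<i> * (of_nat n * \<tau>))"
  by (simp add: nome_def exp_of_nat_mult[symmetric] mult_ac)

lemma exp_2pii_eq_1_iff: "exp (2 * pi * \<i> * w) = 1 \<longleftrightarrow> (\<exists>n::int. w = of_int n)"
proof -
  have "exp (2 * pi * \<i> * w) = 1 \<longleftrightarrow> exp (2 * pi * \<i> * w) = exp 0" by simp
  also have "\<dots> \<longleftrightarrow> (\<exists>n::int. 2 * pi * \<i> * w = 0 + (of_int (2 * n) * pi) * \<i>)" by (rule exp_eq)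
  also have "\<dots> \<longleftrightarrow> (\<exists>n::int. w = of_int n)" by (auto simp: algebra_simps)
  finally show ?thesis .
qed

text \<open>A convergent product vanishes only where a factor does, and every factor vanishes
  exactly when exp(2\<pi>iw) = 1 for w = z or w = \<plusminus>z + (n+1)\<tau>.\<close>

lemma theta_product_zero_imp_lattice:
  assumes "\<tau> \<in> uhp" "theta_product \<tau> z = 0"
  shows "z \<in> period_lattice \<tau>"
proof -
  have eqI: "z \<in> period_lattice \<tau>" if "s * z + of_int b * \<tau> = of_int n" "s = 1 \<or> s = - 1" for s b n
  proof -
    have "z = of_int n + of_int (- b) * \<tau> \<or> z = of_int (- n) + of_int b * \<tau>"
      using that by (auto simp: algebra_simps)
    then show ?thesis using period_latticeI by metis
  qed
  consider "exp (pi * \<i> * z) - exp (- pi * \<i> * z) = 0" | n where "theta_factor \<tau> n z = 0"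
    using assms theta_tail_eq_0_iff[OF assms(1)] by (auto simp: theta_product_def)
  then show ?thesis
  proof cases
    case 1
    have "exp (2 * pi * \<i> * z) = exp (pi * \<i> * z) * exp (pi * \<i> * z)"
      unfolding exp_add[symmetric] by (rule arg_cong[where f = exp]) simp
    also have "\<dots> = exp (pi * \<i> * z) * exp (- pi * \<i> * z)" using 1 by simp
    also have "\<dots> = 1" by (simp add: exp_minus_inverse)
    finally have "exp (2 * pi * \<i> * z) = 1" .
    then show ?thesis unfolding exp_2pii_eq_1_iff using eqI[of 1 0] by auto
  next
    case (2 n)
    moreover have "exp (2 * pi * \<i> * (z + of_nat (Suc n) * \<tau>)) = nome \<tau> ^ Suc n * exp (2 * pi * \<i> * z)"
      "exp (2 * pi * \<i> * (- z + of_nat (Suc n) * \<tau>)) = nome \<tau> ^ Suc n * exp (- 2 * pi * \<i> * z)"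
      unfolding nome_power exp_add[symmetric] by (rule arg_cong[where f = exp], simp add: algebra_simps)+
    ultimately have "exp (2 * pi * \<i> * (z + of_nat (Suc n) * \<tau>)) = 1 \<or> exp (2 * pi * \<i> * (- z + of_nat (Suc n) * \<tau>)) = 1"
      unfolding theta_factor_def by auto
    then show ?thesis
      unfolding exp_2pii_eq_1_iff using eqI[of 1 "int (Suc n)"] eqI[of "-1" "int (Suc n)"] by auto
  qed
qed

lemma theta_product_0: "theta_product \<tau> 0 = 0"
  by (simp add: theta_product_def)

lemma theta_product_holomorphic: "\<tau> \<in> uhp \<Longrightarrow> theta_product \<tau> holomorphic_on A"
  unfolding theta_product_def by (intro holomorphic_intros theta_tail_holomorphic)

lemma theta_product_plus_1: "theta_product \<tau> (z + 1) = - theta_product \<tau> z"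
proof -
  have "exp (2 * pi * \<i> * (z + 1)) = exp (2 * pi * \<i> * z)" "exp (- 2 * pi * \<i> * (z + 1)) = exp (- 2 * pi * \<i> * z)"
    using exp_2pi_int[of "2 * pi * \<i> * z" 1] exp_2pi_int[of "- 2 * pi * \<i> * z" "-1"]
    by (simp_all add: algebra_simps)
  then have "theta_tail \<tau> (z + 1) = theta_tail \<tau> z"
    unfolding theta_tail_def theta_factor_def by simp
  moreover have "exp (pi * \<i> * (z + 1)) = - exp (pi * \<i> * z)" "exp (- pi * \<i> * (z + 1)) = - exp (- pi * \<i> * z)"
    by (simp_all add: distrib_left exp_add exp_diff exp_minus)
  ultimately show ?thesis unfolding theta_product_def by (simp only:) (simp add: algebra_simps)
qed

text \<open>The shift by \<tau> moves the factors with \<zeta> one power of q up and those with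
  1/\<zeta> one power down, so the finite products telescope. The identity is multiplied out because
  the boundary factors may vanish.\<close>

lemma theta_tail_plus_tau:
  assumes "\<tau> \<in> uhp"
  shows "theta_tail \<tau> (z + \<tau>) * (1 - nome \<tau> * exp (2 * pi * \<i> * z)) = theta_tail \<tau> z * (1 - exp (- 2 * pi * \<i> * z))"
proof -
  define q where "q = nome \<tau>"
  define x where "x = exp (2 * pi * \<i> * z)"
  define y where "y = exp (- 2 * pi * \<i> * z)"
  have ex: "exp (2 * pi * \<i> * (z + \<tau>)) = q * x" by (simp add: q_def x_def nome_def exp_add algebra_simps)
  have ey: "q * exp (- 2 * pi * \<i> * (z + \<tau>)) = y"
    by (simp add: q_def y_def nome_def exp_add[symmetric] algebra_simps)
  have fz: "theta_factor \<tau> n z = (1 - q ^ Suc n * x) * (1 - q ^ Suc n * y)" for n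
    by (simp add: theta_factor_def q_def x_def y_def)
  have fzt: "theta_factor \<tau> n (z + \<tau>) = (1 - q ^ Suc (Suc n) * x) * (1 - q ^ n * y)" for n
    unfolding theta_factor_def ex ey[symmetric] q_def[symmetric] by (simp add: mult_ac)
  have telescope: "(\<Prod>n<N. theta_factor \<tau> n (z + \<tau>)) * ((1 - q * x) * (1 - q ^ N * y)) =
        (\<Prod>n<N. theta_factor \<tau> n z) * ((1 - q ^ Suc N * x) * (1 - y))" for N
  proof (induction N)
    case (Suc N)
    have "(\<Prod>n<Suc N. theta_factor \<tau> n (z + \<tau>)) * ((1 - q * x) * (1 - q ^ Suc N * y)) =
      ((\<Prod>n<N. theta_factor \<tau> n (z + \<tau>)) * ((1 - q * x) * (1 - q ^ N * y))) * (1 - q ^ Suc (Suc N) * x) * (1 - q ^ Suc N * y)"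
      by (simp add: fzt)
    also have "\<dots> = (\<Prod>n<Suc N. theta_factor \<tau> n z) * ((1 - q ^ Suc (Suc N) * x) * (1 - y))"
      unfolding Suc.IH by (simp add: fz)
    finally show ?case .
  qed simp
  have q0: "(\<lambda>N. q ^ N) \<longlonglongrightarrow> 0"
    using norm_nome[OF assms] by (simp add: q_def LIMSEQ_power_zero)
  note q1 = LIMSEQ_Suc[OF q0]
  have "(\<lambda>N. (\<Prod>n<N. theta_factor \<tau> n (z + \<tau>)) * ((1 - q * x) * (1 - q ^ N * y)))
     \<longlonglongrightarrow> theta_tail \<tau> (z + \<tau>) * ((1 - q * x) * (1 - 0 * y))"
    by (intro tendsto_intros theta_tail_LIMSEQ assms q0)
  moreover have "(\<lambda>N. (\<Prod>n<N. theta_factor \<tau> n z) * ((1 - q ^ Suc N * x) * (1 - y)))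
     \<longlonglongrightarrow> theta_tail \<tau> z * ((1 - 0 * x) * (1 - y))"
    by (intro tendsto_intros theta_tail_LIMSEQ assms q1)
  ultimately have "theta_tail \<tau> (z + \<tau>) * ((1 - q * x) * (1 - 0 * y)) = theta_tail \<tau> z * ((1 - 0 * x) * (1 - y))"
    unfolding telescope by (rule LIMSEQ_unique)
  then show ?thesis by (simp add: q_def x_def y_def)
qed

lemma theta_product_plus_tau:
  assumes "\<tau> \<in> uhp"
  shows "theta_product \<tau> (z + \<tau>) = - exp (- 2 * pi * \<i> * z - pi * \<i> * \<tau>) * theta_product \<tau> z"
proof -
  define E where "E = exp (pi * \<i> * z)"
  define F where "F = exp (pi * \<i> * \<tau>)"
  have nz: "E \<noteq> 0" "F \<noteq> 0" by (auto simp: E_def F_def)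
  have e: "exp (pi * \<i> * (z + \<tau>)) = E * F" "exp (- pi * \<i> * (z + \<tau>)) = 1 / (E * F)"
    "exp (- pi * \<i> * z) = 1 / E" "exp (2 * pi * \<i> * z) = E\<^sup>2" "exp (- 2 * pi * \<i> * z) = 1 / E\<^sup>2"
    "nome \<tau> = F\<^sup>2" "exp (- 2 * pi * \<i> * z - pi * \<i> * \<tau>) = 1 / (E\<^sup>2 * F)"
    by (simp_all add: E_def F_def nome_def exp_add exp_diff exp_minus power2_eq_square
        distrib_left field_simps flip: exp_add)
  \<comment> \<open>The exponential prefactor at z + \<tau> supplies exactly the boundary factor 1 -
    q\<zeta> with which the tail identity is multiplied.\<close>
  have "theta_product \<tau> (z + \<tau>) = - 1 / (E * F) * (theta_tail \<tau> (z + \<tau>) * (1 - F\<^sup>2 * E\<^sup>2))"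
    using nz unfolding theta_product_def e by (simp add: field_simps power2_eq_square)
  also have "theta_tail \<tau> (z + \<tau>) * (1 - F\<^sup>2 * E\<^sup>2) = theta_tail \<tau> z * (1 - 1 / E\<^sup>2)"
    using theta_tail_plus_tau[OF assms, of z] unfolding e .
  also have "- 1 / (E * F) * \<dots> = - (1 / (E\<^sup>2 * F)) * theta_product \<tau> z"
    using nz unfolding theta_product_def e E_def[symmetric] by (simp add: field_simps power2_eq_square)
  finally show ?thesis unfolding e by simp
qed

text \<open>The zero at the origin is simple; hence dividing by the product costs at most one order
  of vanishing.\<close>

lemma theta_product_deriv_0:
  assumes "\<tau> \<in> uhp"
  obtains t where "t \<noteq> 0" "(theta_product \<tau> has_field_derivative t) (at 0)"
proof -
  have "theta_factor \<tau> n 0 \<noteq> 0" for n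
  proof -
    have "norm (nome \<tau> ^ Suc n) < 1"
      unfolding norm_power by (rule power_Suc_less_one) (use norm_nome[OF assms] in \<open>auto simp: nome_def\<close>)
    then have "nome \<tau> ^ Suc n \<noteq> 1" by (metis norm_one order_less_irrefl)
    then show ?thesis by (simp add: theta_factor_def)
  qed
  then have ne: "theta_tail \<tau> 0 \<noteq> 0" using theta_tail_eq_0_iff[OF assms] by simp
  have "(theta_tail \<tau> has_field_derivative deriv (theta_tail \<tau>) 0) (at 0)"
    using theta_tail_holomorphic[OF assms, of UNIV] by (auto intro: holomorphic_derivI)
  then have "(theta_product \<tau> has_field_derivative 2 * pi * \<i> * theta_tail \<tau> 0) (at 0)"
    unfolding theta_product_def by (auto intro!: derivative_eq_intros)
  with ne show ?thesis by (intro that[of "2 * pi * \<i> * theta_tail \<tau> 0"]) auto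
qed

text \<open>The quotient by the theta product is elliptic with at most removable singularities.\<close>

lemma theta_quasi_periodic_unique:
  assumes "\<tau> \<in> uhp" "F holomorphic_on UNIV" "F 0 = 0" "\<And>z. F (z + 1) = - F z"
    "\<And>z. F (z + \<tau>) = - exp (- 2 * pi * \<i> * z - pi * \<i> * \<tau>) * F z"
  obtains C where "\<And>z. F z = C * theta_product \<tau> z"
proof -
  define T where "T = theta_product \<tau>"
  define R where "R = (\<lambda>z. F z / T z)"
  define G where "G = remove_sings R"
  have T: "T holomorphic_on UNIV" unfolding T_def using theta_product_holomorphic[OF assms(1)] .
  have R1: "R (z + 1) = R z" for z
    by (simp add: R_def T_def theta_product_plus_1 assms)
  have R2: "R (z + \<tau>) = R z" for z
    by (simp add: R_def T_def theta_product_plus_tau assms)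
  obtain t where t: "t \<noteq> 0" "(T has_field_derivative t) (at 0)"
    unfolding T_def by (rule theta_product_deriv_0[OF assms(1)])
  obtain t' where t': "(F has_field_derivative t') (at 0)"
    using holomorphic_derivI[OF assms(2), of 0] by auto
  \<comment> \<open>By l'Hopital's rule; it is enough that the zero of the denominator is simple,
    whatever the order of \<open>F\<close> at 0.\<close>
  have lim0: "R \<midarrow>0\<rightarrow> t' / t"
    unfolding R_def using t t' assms(3) theta_product_0[of \<tau>] by (intro lhopital_complex_simple) (auto simp: T_def)
  have lim: "\<exists>c. R \<midarrow>z\<rightarrow> c" for z
  proof (cases "z \<in> period_lattice \<tau>")
    case True
    then obtain a b where z: "z = of_int a + of_int b * \<tau>" by (auto simp: period_lattice_def)
    have "(\<lambda>w. R (w - z)) \<midarrow>0 + z\<rightarrow> t' / t"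
      using LIM_offset[OF lim0, of "- z"] by simp
    moreover have "R (w - z) = R w" for w
      using periodic_lattice[of R, OF R1 R2, of "w - z" a b] by (simp add: z)
    ultimately show ?thesis by auto
  next
    case False
    then have "T z \<noteq> 0" using theta_product_zero_imp_lattice[OF assms(1)] by (auto simp: T_def)
    moreover have "continuous (at z) T" "continuous (at z) F"
      using T assms(2) holomorphic_on_imp_continuous_on continuous_on_eq_continuous_at open_UNIV by blast+
    ultimately have "isCont R z" unfolding R_def by (intro continuous_intros)
    then show ?thesis by (auto simp: isCont_def)
  qed
  have "R meromorphic_on UNIV"
    unfolding R_def using T assms(2)
    by (intro meromorphic_intros analytic_on_imp_meromorphic_on) (auto simp: analytic_on_open)
  then have iso: "isolated_singularity_at R z" for z
    using meromorphic_on_isolated_singularity[of R z] by (auto intro: meromorphic_on_subset)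
  have "G analytic_on {z}" for z
    using lim[of z] iso[of z] remove_sings_analytic_at unfolding G_def by blast
  then have "G holomorphic_on UNIV" using analytic_imp_holomorphic analytic_on_analytic_at by blast
  moreover have Gp: "G (z + w) = G z" if "\<And>z. R (z + w) = R z" for w z
  proof -
    obtain c where c: "R \<midarrow>z\<rightarrow> c" using lim by blast
    have "R (s - w) = R s" for s using that[of "s - w"] by simp
    then have "R \<midarrow>z + w\<rightarrow> c" using LIM_offset[OF c, of "- w"] by simp
    then show ?thesis using c unfolding G_def by (metis remove_sings_eqI)
  qed
  ultimately obtain C where C: "\<And>z. G z = C"
    using elliptic_entire_imp_constant[OF assms(1), of G] Gp[OF R1] Gp[OF R2] by blast
  have "F z = C * T z" for z
  proof (cases "T z = 0")
    case False
    have "R analytic_on {z}"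
      unfolding R_def using False T assms(2)
      by (intro analytic_intros) (auto simp: holomorphic_on_imp_analytic_at)
    then have "R z = C" using C[of z] unfolding G_def by simp
    then show ?thesis using False by (simp add: R_def field_simps)
  next
    case True
    then obtain a b where z: "z = of_int a + of_int b * \<tau>"
      using theta_product_zero_imp_lattice[OF assms(1)] unfolding T_def period_lattice_def by blast
    \<comment> \<open>The multipliers of \<open>F\<close> never vanish, so the predicate that
      \<open>F\<close> vanishes is doubly periodic although \<open>F\<close> is not.\<close>
    have "(F (0 + (of_int a + of_int b * \<tau>)) = 0) = (F 0 = 0)"
      by (rule periodic_lattice) (simp_all add: assms)
    then show ?thesis using True assms(3) z by simp
  qed
  then show ?thesis using that unfolding T_def by blast
qed

section \<open>Modular transformation of the theta function\<close>

lemma jtheta_plus_1: "jtheta (z + 1) \<tau> = - jtheta z \<tau>"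
  using jtheta_quasi_periodic[of z 0 \<tau> 1] by simp

lemma jtheta_plus_tau:
  "jtheta (z + \<tau>) \<tau> = - exp (- 2 * pi * \<i> * z - pi * \<i> * \<tau>) * jtheta z \<tau>"
proof -
  have "jtheta (z + \<tau>) \<tau> = exp (pi * \<i> + (- 2 * pi * \<i> * z - pi * \<i> * \<tau>)) * jtheta z \<tau>"
    using jtheta_quasi_periodic[of z 1 \<tau> 0] by (simp add: algebra_simps)
  then show ?thesis by (simp only: exp_add exp_pi_i mult_minus1)
qed

text \<open>The Jacobi triple product up to its constant, a function of \<tau> alone that cancels in
  logarithmic derivatives.\<close>

lemma jtheta_eq_product:
  assumes "\<tau> \<in> uhp"
  obtains C where "C \<noteq> 0" "\<And>z. jtheta z \<tau> = C * theta_product \<tau> z"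
proof -
  obtain C where C: "\<And>z. jtheta z \<tau> = C * theta_product \<tau> z"
    using theta_quasi_periodic_unique[OF assms jtheta_holomorphic[OF assms] jtheta_0 jtheta_plus_1 jtheta_plus_tau]
    by blast
  moreover have "C \<noteq> 0" using jtheta_nonzero[OF assms] C by (metis mult_zero_left)
  ultimately show ?thesis using that by blast
qed

lemma jtheta_eq_0_iff:
  assumes "\<tau> \<in> uhp"
  shows "jtheta z \<tau> = 0 \<longleftrightarrow> z \<in> period_lattice \<tau>"
proof
  assume "jtheta z \<tau> = 0"
  then show "z \<in> period_lattice \<tau>"
    using jtheta_eq_product[OF assms] theta_product_zero_imp_lattice[OF assms] by (metis mult_eq_0_iff)
next
  assume "z \<in> period_lattice \<tau>"
  then obtain a b where z: "z = of_int a + of_int b * \<tau>" by (auto simp: period_lattice_def)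
  show "jtheta z \<tau> = 0"
    using jtheta_quasi_periodic[of 0 b \<tau> a] by (simp add: z jtheta_0 add_ac)
qed

lemma theta_d_1_0_nonzero:
  assumes "\<tau> \<in> uhp"
  shows "theta_d 1 0 \<tau> \<noteq> 0"
proof -
  obtain C where C: "C \<noteq> 0" "\<And>z. jtheta z \<tau> = C * theta_product \<tau> z"
    using jtheta_eq_product[OF assms] by blast
  obtain t where t: "t \<noteq> 0" "(theta_product \<tau> has_field_derivative t) (at 0)"
    using theta_product_deriv_0[OF assms] by blast
  have "((\<lambda>z. jtheta z \<tau>) has_field_derivative C * t) (at 0)"
    unfolding C(2) using t(2) by (rule DERIV_cmult)
  moreover have "((\<lambda>z. jtheta z \<tau>) has_field_derivative theta_d 1 0 \<tau>) (at 0)"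
    using theta_d_has_derivative[OF assms, of 0] by (simp add: theta_d_0)
  ultimately show ?thesis using C t DERIV_unique by fastforce
qed

section \<open>The action of SL_2(Z) on the half-plane and on theta\<close>

abbreviation mobius :: "int \<Rightarrow> int \<Rightarrow> int \<Rightarrow> int \<Rightarrow> complex \<Rightarrow> complex" where
  "mobius a b c d \<tau> \<equiv> (of_int a * \<tau> + of_int b) / (of_int c * \<tau> + of_int d)"

lemma mobius_denom_nonzero:
  fixes a b c d :: int
  assumes "a * d - b * c = 1" "\<tau> \<in> uhp"
  shows "of_int c * \<tau> + of_int d \<noteq> 0"
proof
  assume h: "of_int c * \<tau> + of_int d = 0"
  then have "Im (of_int c * \<tau> + of_int d) = 0" by (simp only: zero_complex.sel)
  then have "c = 0" using assms(2) by (simp add: uhp_def)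
  then show False using h assms(1) by auto
qed

lemma Im_mobius:
  fixes a b c d :: int
  assumes "a * d - b * c = 1"
  shows "Im (mobius a b c d \<tau>) =
    Im \<tau> / (cmod (of_int c * \<tau> + of_int d))\<^sup>2"
proof -
  have "Im ((of_int a * \<tau> + of_int b) * cnj (of_int c * \<tau> + of_int d)) = Im \<tau> * of_int (a * d - b * c)"
    by (simp add: algebra_simps)
  then show ?thesis
    unfolding complex_div_cnj[of "of_int a * \<tau> + of_int b"] assms by (simp add: Im_divide_of_real flip: of_real_power)
qed

lemma mobius_in_uhp:
  fixes a b c d :: int
  assumes "a * d - b * c = 1" "\<tau> \<in> uhp"
  shows "mobius a b c d \<tau> \<in> uhp"
  using mobius_denom_nonzero[OF assms] assms(2) unfolding uhp_def mem_Collect_eq Im_mobius[OF assms(1)] by simp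

lemma exp_pi_odd: "odd n \<Longrightarrow> exp (pi * \<i> * of_int n) = - 1"
proof -
  assume "odd n"
  then obtain k where "n = 2 * k + 1" by (rule oddE)
  then have "pi * \<i> * of_int n = pi * \<i> + 2 * pi * \<i> * of_int k" by (simp add: algebra_simps)
  then show ?thesis by (simp only: exp_2pi_int exp_pi_i)
qed

text \<open>Since 1/j = a - c t and \<tau>/j = d t - b for t = \<gamma>\<tau>, the map z |-> z/j
  carries the periods 1 and \<tau> into the lattice of t. The Gaussian factor corrects the
  multipliers found there to those of \<theta>(z;\<tau>). Leaving \<open>C\<close> unspecified
  avoids roots of unity and a square root of j.\<close>

lemma jtheta_modular:
  fixes a b c d :: int
  assumes det: "a * d - b * c = 1" and \<tau>: "\<tau> \<in> uhp"
  obtains C where "C \<noteq> 0"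
    "\<And>z. jtheta (z / (of_int c * \<tau> + of_int d)) (mobius a b c d \<tau>) =
       C * exp (pi * \<i> * of_int c * z\<^sup>2 / (of_int c * \<tau> + of_int d)) * jtheta z \<tau>"
proof -
  define j where "j = of_int c * \<tau> + of_int d"
  define t where "t = (of_int a * \<tau> + of_int b) / j"
  define F where "F = (\<lambda>z. exp (- (pi * \<i> * of_int c * z\<^sup>2 / j)) * jtheta (z / j) t)"
  have j0: "j \<noteq> 0" using mobius_denom_nonzero[OF assms] by (simp add: j_def)
  have t: "t \<in> uhp" using mobius_in_uhp[OF assms] by (simp add: t_def j_def)
  have tj: "t * j = of_int a * \<tau> + of_int b" using j0 by (simp add: t_def)
  have det': "of_int a * of_int d = (1 + of_int b * of_int c :: complex)"
    using det by (metis add.commute diff_add_cancel of_int_1 of_int_add of_int_mult)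
  have inv_j: "1 / j = of_int a - of_int c * t"
  proof -
    have "(of_int a - of_int c * t) * j = of_int a * j - of_int c * (t * j)" by (simp add: algebra_simps)
    also have "\<dots> = 1" using det' unfolding tj by (simp add: j_def algebra_simps)
    finally show ?thesis using j0 by (simp add: field_simps)
  qed
  have tau_j: "\<tau> / j = of_int d * t - of_int b"
  proof -
    have "(of_int d * t - of_int b) * j = of_int d * (t * j) - of_int b * j" by (simp add: algebra_simps)
    also have "\<dots> = (of_int a * of_int d) * \<tau> - of_int b * of_int c * \<tau>" unfolding tj by (simp add: j_def algebra_simps)
    also have "\<dots> = \<tau>" unfolding det' by (simp add: algebra_simps)
    finally show ?thesis using j0 by (simp add: field_simps)
  qed
  \<comment> \<open>Modulo 2 these numbers are (1+a)(1+c) - 1 and (1+b)(1+d) - 1; determinant 1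
    forbids that both entries of a column are even. Their oddness gives the sign -1 in both
    multipliers.\<close>
  have odd1: "odd (a - c - a * c)" and odd2: "odd (d - b - b * d)"
    using det by (metis even_add even_diff even_mult_iff odd_one)+
  have F1: "F (z + 1) = - F z" for z
  proof -
    have arg: "(z + 1) / j = z / j + of_int (- c) * t + of_int a"
      using inv_j by (simp add: add_divide_distrib)
    have "F (z + 1) = exp (- (pi * \<i> * of_int c * (z + 1)\<^sup>2 / j)
        + (pi * \<i> * (of_int (- c) + of_int a) - pi * \<i> * (of_int (- c))\<^sup>2 * t - 2 * pi * \<i> * of_int (- c) * (z / j))) * jtheta (z / j) t"
      unfolding F_def arg jtheta_quasi_periodic by (simp only: exp_add mult.assoc)
    also have "- (pi * \<i> * of_int c * (z + 1)\<^sup>2 / j)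
        + (pi * \<i> * (of_int (- c) + of_int a) - pi * \<i> * (of_int (- c))\<^sup>2 * t - 2 * pi * \<i> * of_int (- c) * (z / j))
      = - (pi * \<i> * of_int c * z\<^sup>2 / j) + pi * \<i> * (of_int a - of_int c - of_int c * (1 / j) - (of_int c)\<^sup>2 * t)"
      using j0 by (simp add: field_simps power2_eq_square)
    also have "\<dots> = pi * \<i> * of_int (a - c - a * c) + - (pi * \<i> * of_int c * z\<^sup>2 / j)"
      unfolding inv_j by (simp add: algebra_simps power2_eq_square)
    finally show ?thesis unfolding exp_add exp_pi_odd[OF odd1] by (simp add: F_def)
  qed
  have F2: "F (z + \<tau>) = - exp (- 2 * pi * \<i> * z - pi * \<i> * \<tau>) * F z" for z
  proof -
    have arg: "(z + \<tau>) / j = z / j + of_int d * t + of_int (- b)"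
      using tau_j by (simp add: add_divide_distrib)
    have "F (z + \<tau>) = exp (- (pi * \<i> * of_int c * (z + \<tau>)\<^sup>2 / j)
        + (pi * \<i> * (of_int d + of_int (- b)) - pi * \<i> * (of_int d)\<^sup>2 * t - 2 * pi * \<i> * of_int d * (z / j))) * jtheta (z / j) t"
      unfolding F_def arg jtheta_quasi_periodic by (simp only: exp_add mult.assoc)
    also have "- (pi * \<i> * of_int c * (z + \<tau>)\<^sup>2 / j)
        + (pi * \<i> * (of_int d + of_int (- b)) - pi * \<i> * (of_int d)\<^sup>2 * t - 2 * pi * \<i> * of_int d * (z / j))
      = - (pi * \<i> * of_int c * z\<^sup>2 / j) - 2 * pi * \<i> * z * ((of_int c * \<tau> + of_int d) / j)
        + pi * \<i> * (of_int d - of_int b - of_int c * \<tau> * (\<tau> / j) - of_int d * (of_int d * t))"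
      using j0 by (simp add: field_simps power2_eq_square)
    also have "(of_int c * \<tau> + of_int d) / j = 1" using j0 by (simp add: j_def)
    also have "of_int d * t = \<tau> / j + of_int b" unfolding tau_j by simp
    also have "of_int d - of_int b - of_int c * \<tau> * (\<tau> / j) - of_int d * (\<tau> / j + of_int b)
       = of_int d - of_int b - of_int b * of_int d - \<tau> * ((of_int c * \<tau> + of_int d) / j)"
      using j0 by (simp add: field_simps)
    also have "(of_int c * \<tau> + of_int d) / j = 1" using j0 by (simp add: j_def)
    also have "- (pi * \<i> * of_int c * z\<^sup>2 / j) - 2 * pi * \<i> * z * 1
        + pi * \<i> * (of_int d - of_int b - of_int b * of_int d - \<tau> * 1)
      = pi * \<i> * of_int (d - b - b * d) + ((- 2 * pi * \<i> * z - pi * \<i> * \<tau>) + - (pi * \<i> * of_int c * z\<^sup>2 / j))"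
      by (simp add: algebra_simps)
    finally show ?thesis unfolding exp_add exp_pi_odd[OF odd2] by (simp add: F_def)
  qed
  have "(\<lambda>w. jtheta w t) \<circ> (\<lambda>z. z / j) holomorphic_on UNIV"
    using j0 by (intro holomorphic_on_compose_gen[where t = UNIV] jtheta_holomorphic t holomorphic_intros) auto
  then have Fh: "F holomorphic_on UNIV"
    unfolding F_def o_def using j0 by (intro holomorphic_intros) auto
  have F0: "F 0 = 0" by (simp add: F_def jtheta_0)
  obtain K where K: "\<And>z. F z = K * theta_product \<tau> z"
    using theta_quasi_periodic_unique[OF \<tau> Fh F0 F1 F2] by blast
  obtain C where C: "C \<noteq> 0" "\<And>z. jtheta z \<tau> = C * theta_product \<tau> z"
    using jtheta_eq_product[OF \<tau>] by blast
  have main: "jtheta (z / j) t = K / C * exp (pi * \<i> * of_int c * z\<^sup>2 / j) * jtheta z \<tau>" for z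
  proof -
    have "jtheta (z / j) t = exp (pi * \<i> * of_int c * z\<^sup>2 / j) * F z"
      by (simp add: F_def mult.assoc[symmetric] exp_minus_inverse)
    then show ?thesis using C by (simp add: K)
  qed
  obtain w where "jtheta w t \<noteq> 0" using jtheta_nonzero[OF t] .
  then have "K / C \<noteq> 0" using main[of "w * j"] j0 by auto
  with main show ?thesis using that unfolding j_def t_def by blast
qed

section \<open>The logarithmic derivative of theta\<close>

definition theta_log :: "complex \<Rightarrow> complex \<Rightarrow> complex" where
  "theta_log \<tau> z = theta_d 1 z \<tau> / jtheta z \<tau>"

lemma jtheta_has_derivative:
  "\<tau> \<in> uhp \<Longrightarrow> ((\<lambda>z. jtheta z \<tau>) has_field_derivative theta_d 1 z \<tau>) (at z)"
  using theta_d_has_derivative[of \<tau> 0] by (simp add: theta_d_0)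

lemma theta_log_eqI:
  assumes "\<tau> \<in> uhp" "((\<lambda>z. jtheta z \<tau>) has_field_derivative y) (at z)"
  shows "theta_log \<tau> z = y / jtheta z \<tau>"
  using DERIV_unique[OF jtheta_has_derivative[OF assms(1)] assms(2)] by (simp add: theta_log_def)

lemma open_lattice_complement: "\<tau> \<in> uhp \<Longrightarrow> open (- period_lattice \<tau>)"
proof -
  assume \<tau>: "\<tau> \<in> uhp"
  have "- period_lattice \<tau> = (\<lambda>z. jtheta z \<tau>) -` (- {0})"
    using jtheta_eq_0_iff[OF \<tau>] by auto
  moreover have "continuous_on UNIV (\<lambda>z. jtheta z \<tau>)"
    using jtheta_holomorphic[OF \<tau>] holomorphic_on_imp_continuous_on by blast
  ultimately show ?thesis by (metis open_vimage open_Compl closed_singleton)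
qed

lemma theta_d_holomorphic_z: "\<tau> \<in> uhp \<Longrightarrow> (\<lambda>z. theta_d k z \<tau>) holomorphic_on A"
  by (rule holomorphic_on_subset[OF theta_d_holomorphic[of "\<lambda>z. z" UNIV "\<lambda>_. \<tau>"]]) auto

lemma theta_log_holomorphic: "\<tau> \<in> uhp \<Longrightarrow> theta_log \<tau> holomorphic_on - period_lattice \<tau>"
  unfolding theta_log_def
  by (intro holomorphic_on_divide jtheta_holomorphic theta_d_holomorphic_z) (auto simp: jtheta_eq_0_iff)

text \<open>Logarithmic differentiation removes the unknown constant and turns the Gaussian into a
  term linear in z, whose derivative is the anomaly of weight 2.\<close>

lemma theta_log_modular:
  fixes a b c d :: int
  assumes "a * d - b * c = 1" "\<tau> \<in> uhp" "z \<notin> period_lattice \<tau>"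
  defines "j \<equiv> of_int c * \<tau> + of_int d"
  shows "theta_log ((of_int a * \<tau> + of_int b) / j) (z / j) / j = theta_log \<tau> z + 2 * pi * \<i> * of_int c * z / j"
proof -
  define t where "t = (of_int a * \<tau> + of_int b) / j"
  have j0: "j \<noteq> 0" using mobius_denom_nonzero[OF assms(1,2)] by (simp add: j_def)
  have t: "t \<in> uhp" using mobius_in_uhp[OF assms(1,2)] by (simp add: t_def j_def)
  obtain C where C: "C \<noteq> 0" "\<And>z. jtheta (z / j) t = C * exp (pi * \<i> * of_int c * z\<^sup>2 / j) * jtheta z \<tau>"
    using jtheta_modular[OF assms(1,2)] unfolding t_def j_def by metis
  have nz: "jtheta z \<tau> \<noteq> 0" using assms(3) jtheta_eq_0_iff[OF assms(2)] by simp
  have "((\<lambda>z. jtheta (z / j) t) has_field_derivative theta_d 1 (z / j) t * (1 / j)) (at z)"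
    using j0 by (intro DERIV_chain2[OF jtheta_has_derivative[OF t]]) (auto intro!: derivative_eq_intros)
  moreover have "((\<lambda>z. jtheta (z / j) t) has_field_derivative
      C * exp (pi * \<i> * of_int c * z\<^sup>2 / j) * (2 * pi * \<i> * of_int c * z / j * jtheta z \<tau> + theta_d 1 z \<tau>)) (at z)"
    unfolding C(2) using j0 by (auto intro!: derivative_eq_intros jtheta_has_derivative[OF assms(2)] simp: field_simps)
  ultimately have eq: "theta_d 1 (z / j) t / j =
      C * exp (pi * \<i> * of_int c * z\<^sup>2 / j) * (2 * pi * \<i> * of_int c * z / j * jtheta z \<tau> + theta_d 1 z \<tau>)"
    using DERIV_unique by fastforce
  have "theta_log t (z / j) / j = (theta_d 1 (z / j) t / j) / jtheta (z / j) t"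
    by (simp add: theta_log_def)
  also have "\<dots> = (2 * pi * \<i> * of_int c * z / j * jtheta z \<tau> + theta_d 1 z \<tau>) / jtheta z \<tau>"
    unfolding eq C(2) using C(1) by simp
  also have "\<dots> = theta_log \<tau> z + 2 * pi * \<i> * of_int c * z / j"
    using nz by (simp add: theta_log_def add_divide_distrib)
  finally show ?thesis by (simp add: t_def)
qed

text \<open>The additive constant is what keeps G_1 from being a class function; every further
  derivative is elliptic.\<close>

lemma theta_log_quasi_periodic:
  assumes "\<tau> \<in> uhp" "z \<notin> period_lattice \<tau>"
  shows "theta_log \<tau> (z + of_int l * \<tau> + of_int \<mu>) = theta_log \<tau> z - 2 * pi * \<i> * of_int l"
proof -
  let ?w = "of_int l * \<tau> + of_int \<mu>"
  let ?e = "\<lambda>z. pi * \<i> * (of_int l + of_int \<mu>) - pi * \<i> * (of_int l)\<^sup>2 * \<tau> - 2 * pi * \<i> * of_int l * z"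
  have nz: "jtheta z \<tau> \<noteq> 0" using assms jtheta_eq_0_iff by simp
  have q: "jtheta (z + ?w) \<tau> = exp (?e z) * jtheta z \<tau>" for z
    using jtheta_quasi_periodic[of z l \<tau> \<mu>] by (simp add: add.assoc)
  have "((\<lambda>z. jtheta (z + ?w) \<tau>) has_field_derivative theta_d 1 (z + ?w) \<tau> * 1) (at z)"
    by (intro DERIV_chain2[OF jtheta_has_derivative[OF assms(1)]]) (auto intro!: derivative_eq_intros)
  moreover have "((\<lambda>z. jtheta (z + ?w) \<tau>) has_field_derivative
      exp (?e z) * (theta_d 1 z \<tau> - 2 * pi * \<i> * of_int l * jtheta z \<tau>)) (at z)"
    unfolding q by (auto intro!: derivative_eq_intros jtheta_has_derivative[OF assms(1)] simp: algebra_simps)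
  ultimately have "theta_d 1 (z + ?w) \<tau> = exp (?e z) * (theta_d 1 z \<tau> - 2 * pi * \<i> * of_int l * jtheta z \<tau>)"
    using DERIV_unique by fastforce
  then show ?thesis using nz
    by (simp add: theta_log_def add.assoc q diff_divide_distrib)
qed

lemma theta_log_minus:
  assumes "\<tau> \<in> uhp"
  shows "theta_log \<tau> (- z) = - theta_log \<tau> z"
proof -
  have "((\<lambda>z. jtheta (- z) \<tau>) has_field_derivative theta_d 1 (- z) \<tau> * (- 1)) (at z)"
    by (intro DERIV_chain2[OF jtheta_has_derivative[OF assms]]) (auto intro!: derivative_eq_intros)
  moreover have "((\<lambda>z. jtheta (- z) \<tau>) has_field_derivative - theta_d 1 z \<tau>) (at z)"
    unfolding jtheta_minus by (auto intro!: derivative_eq_intros jtheta_has_derivative[OF assms])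
  ultimately have "theta_d 1 (- z) \<tau> = theta_d 1 z \<tau>"
    using DERIV_unique by fastforce
  then show ?thesis by (simp add: theta_log_def jtheta_minus)
qed

section \<open>Eisenstein series at nonzero torsion points\<close>

lemma of_rat_complex: "(of_rat r :: complex) = of_real (of_rat r)"
  by (induct r) (simp add: of_rat_rat)

lemma torsion_point_diff: "torsion_point (p - p') \<tau> = torsion_point p \<tau> - torsion_point p' \<tau>"
  by (simp add: torsion_point_def of_rat_diff algebra_simps)

lemma torsion_point_integral: "torsion_point (of_int l, of_int \<mu>) \<tau> = of_int l * \<tau> + of_int \<mu>"
  by (simp add: torsion_point_def)

lemma torsion_point_in_lattice_iff:
  assumes "\<tau> \<in> uhp"
  shows "torsion_point p \<tau> \<in> period_lattice \<tau> \<longleftrightarrow> p \<in> integral_pairs"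
proof
  assume "torsion_point p \<tau> \<in> period_lattice \<tau>"
  then obtain a b where eq: "torsion_point p \<tau> = of_int a + of_int b * \<tau>" by (auto simp: period_lattice_def)
  have "of_rat (fst p) * Im \<tau> = of_int b * Im \<tau>"
    using arg_cong[OF eq, of Im] by (simp add: torsion_point_def of_rat_complex)
  then have 1: "(of_rat (fst p) :: real) = of_rat (of_int b)" using assms by (simp add: uhp_def)
  then have "fst p = of_int b" unfolding of_rat_eq_iff .
  moreover from this have "(of_rat (snd p) :: real) = of_rat (of_int a)"
    using arg_cong[OF eq, of Re] by (simp add: torsion_point_def of_rat_complex)
  then have "snd p = of_int a" unfolding of_rat_eq_iff .
  ultimately show "p \<in> integral_pairs" by (simp add: mem_Times_iff)
next
  assume "p \<in> integral_pairs"
  then obtain l \<mu> where "p = (of_int l, of_int \<mu>)" by (auto elim!: Ints_cases)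
  then have "torsion_point p \<tau> = of_int \<mu> + of_int l * \<tau>" by (simp add: torsion_point_integral)
  then show "torsion_point p \<tau> \<in> period_lattice \<tau>" by (metis period_latticeI)
qed

text \<open>The row vector (\<alpha>, \<beta>) times the matrix. On this side the action matches the
  substitution \<tau> |-> \<gamma>\<tau> in \<alpha>\<tau> + \<beta>, up to division by c\<tau> +
  d.\<close>

definition act_pair :: "int \<Rightarrow> int \<Rightarrow> int \<Rightarrow> int \<Rightarrow> rat \<times> rat \<Rightarrow> rat \<times> rat" where
  "act_pair a b c d p = (fst p * of_int a + snd p * of_int c, fst p * of_int b + snd p * of_int d)"

lemma torsion_point_mobius:
  fixes a b c d :: int
  assumes "a * d - b * c = 1" "\<tau> \<in> uhp"
  shows "torsion_point p (mobius a b c d \<tau>) =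
    torsion_point (act_pair a b c d p) \<tau> / (of_int c * \<tau> + of_int d)"
  using mobius_denom_nonzero[OF assms]
  by (simp add: torsion_point_def act_pair_def of_rat_add of_rat_mult field_simps)

lemma act_pair_integral:
  assumes "a * d - b * c = 1"
  shows "act_pair a b c d p \<in> integral_pairs \<longleftrightarrow> p \<in> integral_pairs"
proof
  assume h: "act_pair a b c d p \<in> integral_pairs"
  have det: "of_int a * of_int d - of_int b * of_int c = (1::rat)"
    using assms by (metis of_int_1 of_int_diff of_int_mult)
  have 1: "fst (act_pair a b c d p) * of_int d - snd (act_pair a b c d p) * of_int c = fst p * (of_int a * of_int d - of_int b * of_int c)"
    and 2: "snd (act_pair a b c d p) * of_int a - fst (act_pair a b c d p) * of_int b = snd p * (of_int a * of_int d - of_int b * of_int c)"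
    by (simp_all add: act_pair_def algebra_simps)
  have "fst p \<in> \<int>" using h 1 unfolding det mult_1_right
    by (metis Ints_diff Ints_mult Ints_of_int mem_Times_iff)
  moreover have "snd p \<in> \<int>" using h 2 unfolding det mult_1_right
    by (metis Ints_diff Ints_mult Ints_of_int mem_Times_iff)
  ultimately show "p \<in> integral_pairs" by (simp add: mem_Times_iff)
next
  assume "p \<in> integral_pairs"
  then show "act_pair a b c d p \<in> integral_pairs"
    by (auto simp: act_pair_def mem_Times_iff)
qed

text \<open>A ring closed under \<open>\<partial>/\<partial>z\<close> that contains the logarithmic derivative of theta: it transports
  holomorphy in \<open>\<tau>\<close> from the theta series to all the \<open>G\<^sub>k\<^sub>,\<^sub>w\<close>.\<close>

inductive theta_ring :: "(complex \<Rightarrow> complex \<Rightarrow> complex) \<Rightarrow> bool" where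
  theta_ring_base: "theta_ring (\<lambda>\<tau> z. theta_d k z \<tau> / jtheta z \<tau>)"
| theta_ring_diff: "theta_ring F \<Longrightarrow> theta_ring G \<Longrightarrow> theta_ring (\<lambda>\<tau> z. F \<tau> z - G \<tau> z)"
| theta_ring_mult: "theta_ring F \<Longrightarrow> theta_ring G \<Longrightarrow> theta_ring (\<lambda>\<tau> z. F \<tau> z * G \<tau> z)"
| theta_ring_uminus: "theta_ring F \<Longrightarrow> theta_ring (\<lambda>\<tau> z. - F \<tau> z)"

lemma theta_ring_deriv:
  assumes "theta_ring F"
  shows "\<exists>F'. theta_ring F' \<and>
    (\<forall>\<tau>\<in>uhp. \<forall>z. z \<notin> period_lattice \<tau> \<longrightarrow> (F \<tau> has_field_derivative F' \<tau> z) (at z))"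
  (is "\<exists>F'. _ \<and> ?D F F'")
  using assms
proof (induction rule: theta_ring.induct)
  case (theta_ring_base k)
  let ?F' = "\<lambda>\<tau> z. theta_d (Suc k) z \<tau> / jtheta z \<tau> - theta_d k z \<tau> / jtheta z \<tau> * (theta_d 1 z \<tau> / jtheta z \<tau>)"
  have "theta_ring ?F'" by (intro theta_ring.intros)
  moreover have "((\<lambda>z. theta_d k z \<tau> / jtheta z \<tau>) has_field_derivative ?F' \<tau> z) (at z)"
    if "\<tau> \<in> uhp" "z \<notin> period_lattice \<tau>" for \<tau> z
    using that jtheta_eq_0_iff[of \<tau> z]
    by (auto intro!: derivative_eq_intros theta_d_has_derivative jtheta_has_derivative simp: field_simps)
  ultimately show ?case by blast
next
  case (theta_ring_diff F G)
  then obtain F' G' where "theta_ring F'" "theta_ring G'"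
    "?D F F'"
    "?D G G'" by blast
  then show ?case
    by (intro exI[of _ "\<lambda>\<tau> z. F' \<tau> z - G' \<tau> z"]) (auto intro!: theta_ring.intros DERIV_diff)
next
  case (theta_ring_uminus F)
  then obtain F' where "theta_ring F'"
    "?D F F'" by blast
  then show ?case
    by (intro exI[of _ "\<lambda>\<tau> z. - F' \<tau> z"]) (auto intro!: theta_ring.intros DERIV_minus)
next
  case (theta_ring_mult F G)
  then obtain F' G' where *: "theta_ring F'" "theta_ring G'"
    "?D F F'"
    "?D G G'" by blast
  \<comment> \<open>The ring has no constructor for sums, so the product rule is written with a
    difference and a negation.\<close>
  let ?H = "\<lambda>\<tau> z. F' \<tau> z * G \<tau> z - (- (G' \<tau> z * F \<tau> z))"
  have "theta_ring ?H" using * theta_ring_mult by (intro theta_ring.intros)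
  moreover have "((\<lambda>z. F \<tau> z * G \<tau> z) has_field_derivative ?H \<tau> z) (at z)"
    if "\<tau> \<in> uhp" "z \<notin> period_lattice \<tau>" for \<tau> z
    using DERIV_mult[of "F \<tau>" "F' \<tau> z" z UNIV "G \<tau>" "G' \<tau> z"] * that by simp
  ultimately show ?case by blast
qed

lemma theta_ring_torsion_holomorphic:
  assumes "theta_ring F" "p \<notin> integral_pairs"
  shows "(\<lambda>\<tau>. F \<tau> (torsion_point p \<tau>)) holomorphic_on uhp"
  using assms(1)
proof induction
  case (theta_ring_base k)
  have "open uhp" unfolding uhp_def by (rule open_halfspace_Im_gt)
  then have hol: "(\<lambda>\<tau>. theta_d k (torsion_point p \<tau>) \<tau>) holomorphic_on uhp" for k
    unfolding torsion_point_def by (intro theta_d_holomorphic holomorphic_intros) auto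
  then show ?case
    using assms(2)
    by (intro holomorphic_on_divide hol hol[of 0, unfolded theta_d_0]) (auto simp: jtheta_eq_0_iff torsion_point_in_lattice_iff)
qed (auto intro!: holomorphic_intros)

text \<open>One \<open>F\<close> serves all \<tau>: the derivatives are formed in z with \<tau>
  fixed, but the result is later studied as a function of \<tau>.\<close>

lemma higher_deriv_theta_log_in_ring:
  "\<exists>F. theta_ring F \<and> (\<forall>\<tau>\<in>uhp. \<forall>z. z \<notin> period_lattice \<tau> \<longrightarrow> (deriv ^^ k) (theta_log \<tau>) z = F \<tau> z)"
proof (induction k)
  case 0
  show ?case by (intro exI[of _ theta_log]) (auto simp: theta_log_def[abs_def] intro: theta_ring_base)
next
  case (Suc k)
  then obtain F where F: "theta_ring F" "\<forall>\<tau>\<in>uhp. \<forall>z. z \<notin> period_lattice \<tau> \<longrightarrow> (deriv ^^ k) (theta_log \<tau>) z = F \<tau> z"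
    by blast
  obtain F' where F': "theta_ring F'"
    "\<forall>\<tau>\<in>uhp. \<forall>z. z \<notin> period_lattice \<tau> \<longrightarrow> (F \<tau> has_field_derivative F' \<tau> z) (at z)"
    using theta_ring_deriv[OF F(1)] by blast
  have "(deriv ^^ Suc k) (theta_log \<tau>) z = F' \<tau> z" if "\<tau> \<in> uhp" "z \<notin> period_lattice \<tau>" for \<tau> z
  proof -
    have "eventually (\<lambda>w. w \<in> - period_lattice \<tau>) (nhds z)"
      using that open_lattice_complement by (intro eventually_nhds_in_open) auto
    then have "eventually (\<lambda>w. (deriv ^^ k) (theta_log \<tau>) w = F \<tau> w) (nhds z)"
      by eventually_elim (use F(2) that in auto)
    then have "deriv ((deriv ^^ k) (theta_log \<tau>)) z = deriv (F \<tau>) z"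
      by (intro deriv_cong_ev) auto
    also have "\<dots> = F' \<tau> z" using F'(2) that by (auto intro!: DERIV_imp_deriv)
    finally show ?thesis by simp
  qed
  with F'(1) show ?case by blast
qed

section \<open>Iterated Wirtinger derivatives of log |theta|^2\<close>

lemma wirtinger_eqI:
  assumes "(f has_derivative (\<lambda>h. g' h)) (at z)"
  shows "wirtinger f z = (g' 1 - \<i> * g' \<i>) / 2"
  unfolding wirtinger_def frechet_derivative_at[OF assms, symmetric] ..

lemma wirtinger_holomorphic:
  assumes "eventually (\<lambda>w. f w = g w) (nhds z)" "(g has_field_derivative g') (at z)"
  shows "wirtinger f z = g'"
proof -
  have "(g has_derivative (\<lambda>h. g' * h)) (at z)" using assms(2) by (simp add: has_field_derivative_def)
  moreover have "eventually (\<lambda>w. g w = f w) (at z)" "g z = f z"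
    using assms(1) by (auto simp: eventually_at_filter eq_commute elim: eventually_mono dest: eventually_nhds_x_imp_x)
  ultimately have "(f has_derivative (\<lambda>h. g' * h)) (at z)"
    using has_derivative_transform_eventually by blast
  from wirtinger_eqI[OF this] show ?thesis by (simp add: algebra_simps)
qed

text \<open>The conjugate of f is antiholomorphic, so only log f contributes. Writing |f|^2 as a
  real inner product avoids a branch of the logarithm.\<close>

lemma wirtinger_ln_norm_square:
  assumes "(f has_field_derivative f') (at z)" "f z \<noteq> 0"
  shows "wirtinger (\<lambda>z. of_real (ln ((cmod (f z))\<^sup>2))) z = f' / f z"
proof -
  have "(f has_derivative (\<lambda>h. f' * h)) (at z)" using assms(1) by (simp add: has_field_derivative_def)
  then have "((\<lambda>z. f z \<bullet> f z) has_derivative (\<lambda>h. f z \<bullet> (f' * h) + (f' * h) \<bullet> f z)) (at z)"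
    by (rule has_derivative_inner[OF _ _]) fact
  then have "((\<lambda>z. ln (f z \<bullet> f z)) has_derivative (\<lambda>h. (f z \<bullet> (f' * h) + (f' * h) \<bullet> f z) * inverse (f z \<bullet> f z))) (at z)"
    using assms(2) by (intro has_derivative_ln) auto
  then have "((\<lambda>z. complex_of_real (ln ((cmod (f z))\<^sup>2))) has_derivative
      (\<lambda>h. of_real ((f z \<bullet> (f' * h) + (f' * h) \<bullet> f z) * inverse (f z \<bullet> f z)))) (at z)"
    unfolding power2_norm_eq_inner by (rule has_derivative_of_real)
  then have "wirtinger (\<lambda>z. of_real (ln ((cmod (f z))\<^sup>2))) z =
      (of_real ((f z \<bullet> (f' * 1) + (f' * 1) \<bullet> f z) * inverse (f z \<bullet> f z)) -
       \<i> * of_real ((f z \<bullet> (f' * \<i>) + (f' * \<i>) \<bullet> f z) * inverse (f z \<bullet> f z))) / 2"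
    by (rule wirtinger_eqI)
  also have "\<dots> = (f' * cnj (f z)) / of_real (f z \<bullet> f z)"
  proof -
    define N where "N = f z \<bullet> f z"
    have eq: "f z \<bullet> (f' * h) + (f' * h) \<bullet> f z = 2 * Re (f' * cnj (f z) * h)" for h
      by (simp add: inner_complex_def algebra_simps)
    show ?thesis unfolding eq N_def[symmetric]
      by (cases "N = 0") (simp_all add: complex_eq_iff field_simps)
  qed
  also have "of_real (f z \<bullet> f z) = f z * cnj (f z)"
    by (simp add: complex_mult_cnj inner_complex_def power2_eq_square)
  finally show ?thesis using assms(2) by simp
qed

lemma theta_log_higher_deriv_has_derivative:
  assumes "\<tau> \<in> uhp" "z \<notin> period_lattice \<tau>"
  shows "((deriv ^^ k) (theta_log \<tau>) has_field_derivative (deriv ^^ Suc k) (theta_log \<tau>) z) (at z)"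
  using assms theta_log_holomorphic[OF assms(1)] open_lattice_complement[OF assms(1)]
    holomorphic_derivI[OF holomorphic_higher_deriv[of "theta_log \<tau>" "- period_lattice \<tau>" k], of z]
  by auto

text \<open>The first Wirtinger derivative already makes the function holomorphic off the lattice;
  from then on it is the complex derivative. Hence one derivative fewer on the right-hand
  side.\<close>

lemma wirtinger_power_log_norm_jtheta:
  assumes "\<tau> \<in> uhp" "z \<notin> period_lattice \<tau>"
  shows "((\<lambda>f z. wirtinger f z / (2 * pi * \<i>)) ^^ Suc k) (\<lambda>z. of_real (ln ((cmod (jtheta z \<tau>))\<^sup>2))) z =
    (deriv ^^ k) (theta_log \<tau>) z / (2 * pi * \<i>) ^ Suc k"
  using assms(2)
proof (induction k arbitrary: z)
  case 0
  then show ?case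
    using wirtinger_ln_norm_square[OF jtheta_has_derivative[OF assms(1)], of z] jtheta_eq_0_iff[OF assms(1)]
    by (simp add: theta_log_def)
next
  case (Suc k)
  let ?W = "(\<lambda>f z. wirtinger f z / (2 * pi * \<i>)) :: (complex \<Rightarrow> complex) \<Rightarrow> complex \<Rightarrow> complex"
  let ?f = "\<lambda>z. of_real (ln ((cmod (jtheta z \<tau>))\<^sup>2)) :: complex"
  have "eventually (\<lambda>w. w \<in> - period_lattice \<tau>) (nhds z)"
    using Suc.prems open_lattice_complement[OF assms(1)] by (intro eventually_nhds_in_open) auto
  then have "eventually (\<lambda>w. (?W ^^ Suc k) ?f w = (deriv ^^ k) (theta_log \<tau>) w / (2 * pi * \<i>) ^ Suc k) (nhds z)"
    by eventually_elim (use Suc.IH in blast)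
  then have "wirtinger ((?W ^^ Suc k) ?f) z = (deriv ^^ Suc k) (theta_log \<tau>) z / (2 * pi * \<i>) ^ Suc k"
    by (rule wirtinger_holomorphic) (intro DERIV_cdivide theta_log_higher_deriv_has_derivative assms Suc.prems)
  then show ?case by simp
qed

lemma eisenstein_point_nonintegral:
  assumes "\<tau> \<in> uhp" "p \<notin> integral_pairs"
  shows "eisenstein_point (Suc k) p \<tau> = - ((deriv ^^ k) (theta_log \<tau>) (torsion_point p \<tau>) / (2 * pi * \<i>) ^ Suc k)"
proof -
  have "torsion_point p \<tau> \<notin> period_lattice \<tau>" using assms by (simp add: torsion_point_in_lattice_iff)
  from wirtinger_power_log_norm_jtheta[OF assms(1) this, of k] show ?thesis
    unfolding eisenstein_point_def using assms(2) by (simp only: if_False)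
qed

lemma eisenstein_point_nonintegral_holomorphic:
  assumes "p \<notin> integral_pairs"
  shows "eisenstein_point (Suc k) p holomorphic_on uhp"
proof -
  obtain F where F: "theta_ring F" "\<forall>\<tau>\<in>uhp. \<forall>z. z \<notin> period_lattice \<tau> \<longrightarrow> (deriv ^^ k) (theta_log \<tau>) z = F \<tau> z"
    using higher_deriv_theta_log_in_ring by blast
  have "(\<lambda>\<tau>. - (F \<tau> (torsion_point p \<tau>) / (2 * pi * \<i>) ^ Suc k)) holomorphic_on uhp"
    by (intro holomorphic_intros theta_ring_torsion_holomorphic F assms) auto
  then show ?thesis
  proof (rule holomorphic_transform)
    fix \<tau> assume "\<tau> \<in> uhp"
    then show "- (F \<tau> (torsion_point p \<tau>) / (2 * pi * \<i>) ^ Suc k) = eisenstein_point (Suc k) p \<tau>"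
      unfolding eisenstein_point_nonintegral[OF \<open>\<tau> \<in> uhp\<close> assms]
      using F(2) assms by (simp add: torsion_point_in_lattice_iff)
  qed
qed

text \<open>Used twice: at nonzero torsion points f and g are \<theta>'/\<theta> at \<gamma>\<tau>
  and at \<tau>, at the origin their regular parts. The linear term \<kappa>z survives only the
  first derivative, which confines the anomaly to weight 2.\<close>

lemma higher_deriv_scaling:
  assumes f: "f holomorphic_on T" and g: "g holomorphic_on S" and opn: "open T" "open S"
    and w: "w \<in> S" and j0: "j \<noteq> 0" and sub: "\<And>z. z \<in> S \<Longrightarrow> 1 / j * z \<in> T"
    and eq: "\<And>z. z \<in> S \<Longrightarrow> f (1 / j * z) = j * g z + \<kappa> * z"
  shows "(deriv ^^ Suc l) f (1 / j * w) =
    j ^ Suc (Suc l) * (deriv ^^ Suc l) g w + (if l = 0 then \<kappa> * j else 0)"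
proof -
  have "(\<lambda>z. 1 / j * z) holomorphic_on S" by (intro holomorphic_intros)
  from holomorphic_on_compose_gen[OF this f image_subsetI[OF sub]]
  have fh: "(\<lambda>z. f (1 / j * z)) holomorphic_on S" unfolding o_def .
  have gh: "(\<lambda>z. j * g z) holomorphic_on S" and kh: "(\<lambda>z. \<kappa> * z) holomorphic_on S"
    by (intro holomorphic_intros g)+
  have "(1 / j) ^ Suc l * (deriv ^^ Suc l) f (1 / j * w) = (deriv ^^ Suc l) (\<lambda>z. f (1 / j * z)) w"
    by (rule higher_deriv_compose_linear[OF f opn(2) opn(1) w sub, symmetric])
  also have "\<dots> = (deriv ^^ Suc l) (\<lambda>z. j * g z + \<kappa> * z) w"
    by (rule higher_deriv_transform_within_open[OF fh holomorphic_on_add[OF gh kh] opn(2) w eq])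
  also have "\<dots> = (deriv ^^ Suc l) (\<lambda>z. j * g z) w + (deriv ^^ Suc l) (\<lambda>z. \<kappa> * z) w"
    by (rule higher_deriv_add[OF gh kh opn(2) w])
  also have "(deriv ^^ Suc l) (\<lambda>z. j * g z) w = j * (deriv ^^ Suc l) g w"
    by (rule higher_deriv_cmult[OF g w opn(2)])
  also have "(deriv ^^ Suc l) (\<lambda>z. \<kappa> * z) w = (if l = 0 then \<kappa> else 0)"
    by (simp only: higher_deriv_linear) simp
  finally show ?thesis using j0 by (cases "l = 0") (simp_all add: field_simps)
qed

lemma eisenstein_point_nonintegral_modular:
  fixes a b c d :: int
  assumes "a * d - b * c = 1" "\<tau> \<in> uhp" "p \<notin> integral_pairs" "k \<ge> 2"
  shows "eisenstein_point k p (mobius a b c d \<tau>) =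
    (of_int c * \<tau> + of_int d) ^ k * eisenstein_point k (act_pair a b c d p) \<tau>
      + (if k = 2 then \<i> / (2 * pi) * of_int c * (of_int c * \<tau> + of_int d) else 0)"
proof -
  define j where "j = of_int c * \<tau> + of_int d"
  define t where "t = (of_int a * \<tau> + of_int b) / j"
  define w where "w = torsion_point (act_pair a b c d p) \<tau>"
  obtain l where k: "k = Suc (Suc l)" using assms(4) by (metis Suc_le_D numeral_2_eq_2 Suc_le_mono)
  have j0: "j \<noteq> 0" using mobius_denom_nonzero[OF assms(1,2)] by (simp add: j_def)
  have t: "t \<in> uhp" using mobius_in_uhp[OF assms(1,2)] by (simp add: t_def j_def)
  have p': "act_pair a b c d p \<notin> integral_pairs" using assms(1,3) by (simp add: act_pair_integral)
  then have w: "w \<in> - period_lattice \<tau>" using assms(2) by (simp add: w_def torsion_point_in_lattice_iff)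
  have tp: "torsion_point p t = w / j"
    using torsion_point_mobius[OF assms(1,2)] by (simp add: t_def j_def w_def)
  have eq: "theta_log t (1 / j * z) = j * theta_log \<tau> z + 2 * pi * \<i> * of_int c * z" if "z \<notin> period_lattice \<tau>" for z
    using theta_log_modular[OF assms(1,2) that] j0 unfolding j_def[symmetric] t_def[symmetric] by (simp add: field_simps)
  have inl: "1 / j * z \<in> - period_lattice t" if z: "z \<in> - period_lattice \<tau>" for z
  proof -
    obtain C where "\<And>z. jtheta (z / j) t = C * exp (pi * \<i> * of_int c * z\<^sup>2 / j) * jtheta z \<tau>" "C \<noteq> 0"
      using jtheta_modular[OF assms(1,2)] unfolding t_def j_def by metis
    then have "jtheta (z / j) t \<noteq> 0" using z jtheta_eq_0_iff[OF assms(2)] by simp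
    then show ?thesis using jtheta_eq_0_iff[OF t] by simp
  qed
  have main: "(deriv ^^ Suc l) (theta_log t) (torsion_point p t) =
      j ^ k * (deriv ^^ Suc l) (theta_log \<tau>) w + (if l = 0 then 2 * pi * \<i> * of_int c * j else 0)"
    using higher_deriv_scaling[OF theta_log_holomorphic[OF t] theta_log_holomorphic[OF assms(2)]
        open_lattice_complement[OF t] open_lattice_complement[OF assms(2)] w j0 inl, of "2 * pi * \<i> * of_int c"] eq
    unfolding tp k by simp
  \<comment> \<open>The constant of the anomaly: - 2\<pi>i c j / (2\<pi>i)^2 = (i / 2\<pi>) c
    j.\<close>
  have "eisenstein_point k p t = j ^ k * eisenstein_point k (act_pair a b c d p) \<tau>
      + (if l = 0 then - (2 * pi * \<i> * of_int c * j / (2 * pi * \<i>) ^ 2) else 0)"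
    unfolding k eisenstein_point_nonintegral[OF t assms(3)] eisenstein_point_nonintegral[OF assms(2) p'] main w_def[symmetric]
    by (cases "l = 0") (simp_all add: add_divide_distrib k power2_eq_square)
  then show ?thesis unfolding t_def j_def by (auto simp: k power2_eq_square field_simps)
qed

section \<open>The logarithmic derivative of theta at the origin\<close>

lemma fps_exp_1_minus_1:
  "subdegree (fps_exp 1 - 1 :: 'a::field_char_0 fps) = 1" "fps_exp 1 - 1 \<noteq> (0 :: 'a fps)"
proof -
  show *: "subdegree (fps_exp 1 - 1 :: 'a fps) = 1" by (rule subdegreeI) auto
  show "fps_exp 1 - 1 \<noteq> (0 :: 'a fps)"
  proof
    assume "fps_exp 1 - 1 = (0 :: 'a fps)"
    from this * show False by simp
  qed
qed

lemma bernoulli_fps_mult: "(fps_X / (fps_exp 1 - 1)) * (fps_exp 1 - 1) = (fps_X :: 'a::field_char_0 fps)"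
  using fps_exp_1_minus_1[where 'a = 'a] by (intro dvd_div_mult_self) (subst fps_dvd_iff, auto)

text \<open>The Bernoulli numbers are defined over the reals. The coefficientwise image of the real
  series solves the same equation over the complex numbers, and its solution is unique.\<close>

lemma bernoulli_fps_of_real:
  "fps_nth (fps_X / (fps_exp 1 - 1) :: complex fps) n = of_real (bernoulli_number n / fact n)"
proof -
  let ?R = "fps_X / (fps_exp 1 - 1) :: real fps"
  define M where "M = Abs_fps (\<lambda>n. complex_of_real (fps_nth ?R n))"
  have "M * (fps_exp 1 - 1) = fps_X"
  proof (rule fps_ext)
    fix n
    have "fps_nth (M * (fps_exp 1 - 1)) n = of_real (fps_nth (?R * (fps_exp 1 - 1)) n)"
      unfolding fps_mult_nth of_real_sum by (intro sum.cong) (auto simp: M_def)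
    then show "fps_nth (M * (fps_exp 1 - 1)) n = fps_nth fps_X n"
      unfolding bernoulli_fps_mult by simp
  qed
  then have "M * (fps_exp 1 - 1) = (fps_X / (fps_exp 1 - 1)) * (fps_exp 1 - 1)"
    unfolding bernoulli_fps_mult .
  then have "M = fps_X / (fps_exp 1 - 1)" using fps_exp_1_minus_1(2) by (metis mult_right_cancel)
  then show ?thesis by (metis M_def bernoulli_number_def fps_nth_Abs_fps nonzero_mult_div_cancel_left fact_nonzero)
qed

text \<open>\<open>h\<close> is the regular part of 1/(e^x - 1) at 0. It arises from x/(e^x - 1) by
  subtracting the constant term 1 and dividing by x, which explains the index shift in B_(n+1) /
  (n+1).\<close>

lemma inverse_exp_minus_1_expansion:
  obtains h r where "r > 0" "h holomorphic_on ball 0 r"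
    "\<And>x. x \<noteq> 0 \<Longrightarrow> exp x \<noteq> 1 \<Longrightarrow> h x = 1 / (exp x - 1) - 1 / x"
    "\<And>n. (deriv ^^ n) h 0 = of_real (bernoulli_number (Suc n)) / of_nat (Suc n)"
proof -
  let ?G = "fps_exp 1 - 1 :: complex fps"
  let ?B = "fps_X / ?G"
  have "(\<lambda>x. if x = 0 then 1 else x / (exp x - 1)) has_fps_expansion ?B"
    by (intro has_fps_expansion_divide has_fps_expansion_diff has_fps_expansion_fps_X has_fps_expansion_exp1
        has_fps_expansion_1) (use fps_exp_1_minus_1[where 'a = complex] in auto)
  then have 1: "(\<lambda>x. (if x = 0 then 1 else x / (exp x - 1)) - 1) has_fps_expansion ?B - 1"
    by (intro has_fps_expansion_diff has_fps_expansion_1)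
  have ne: "?B - 1 \<noteq> 0"
  proof
    assume "?B - 1 = 0"
    then have "?G = fps_X" using bernoulli_fps_mult[where 'a = complex] by simp
    then have "fps_nth ?G 2 = fps_nth fps_X 2" by (rule arg_cong)
    then show False by simp
  qed
  have "fps_nth (?B - 1) 0 = 0"
    using has_fps_expansion_imp_0_eq_fps_nth_0[OF 1] by simp
  then have "1 \<le> subdegree (?B - 1)" using ne by (intro subdegree_geI) auto
  define h where "h = (\<lambda>x. if x = 0 then fps_nth (?B - 1) 1 else ((if x = 0 then 1 else x / (exp x - 1)) - 1) / x ^ 1)"
  have exp: "h has_fps_expansion fps_shift 1 (?B - 1)"
    unfolding h_def by (rule has_fps_expansion_shift[OF 1]) (fact, rule refl)
  obtain s where s: "open s" "0 \<in> s" "h holomorphic_on s"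
    using has_fps_expansion_imp_holomorphic[OF exp] by metis
  then obtain r where r: "r > 0" "ball 0 r \<subseteq> s" using open_contains_ball by blast
  have "(deriv ^^ n) h 0 = of_real (bernoulli_number (Suc n)) / of_nat (Suc n)" for n
  proof -
    have "(deriv ^^ n) h 0 / fact n = of_real (bernoulli_number (Suc n) / fact (Suc n))"
      using fps_nth_fps_expansion[OF exp, of n] by (simp add: bernoulli_fps_of_real)
    then have "(deriv ^^ n) h 0 = of_real (bernoulli_number (Suc n) / fact (Suc n)) * fact n"
      by (metis fact_nonzero nonzero_divide_eq_eq)
    then show ?thesis by simp
  qed
  moreover have "h x = 1 / (exp x - 1) - 1 / x" if "x \<noteq> 0" "exp x \<noteq> 1" for x
    using that by (simp add: h_def field_simps)
  ultimately show ?thesis using r s(3) holomorphic_on_subset by (intro that[of r h]) blast+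
qed

section \<open>Lambert series and divisor sums\<close>

lemma has_sum_from_1_imp_sums:
  assumes "(f has_sum S) {1::nat..}"
  shows "(\<lambda>n. f (Suc n)) sums S"
proof -
  have "bij_betw Suc UNIV {1..}"
    by (rule bij_betwI[of _ _ _ "\<lambda>n. n - 1"]) auto
  from has_sum_reindex_bij_betw[OF this, of f S] assms show ?thesis
    by (intro has_sum_imp_sums) simp
qed

text \<open>The double series of (q^n w)^d over n, d >= 1, summed in two ways: over d first it is
  geometric, grouped by N = nd it yields divisor sums. Only qw has to lie in the unit disc, so w may
  be \<zeta> or 1/\<zeta>; the real case serves as a majorant.\<close>

lemma lambert_has_sum:
  fixes q w :: "'a :: {real_normed_field, banach}"
  assumes "norm q < 1" "norm (q * w) < 1"
  obtains S where "((\<lambda>n. q ^ n * w / (1 - q ^ n * w)) has_sum S) {1..}"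
    "((\<lambda>N. q ^ N * (\<Sum>d | d dvd N. w ^ d)) has_sum S) {1..}"
proof -
  let ?F = "\<lambda>(n::nat, d::nat). (q ^ n * w) ^ d"
  define \<rho> where "\<rho> = norm q"
  define r where "r = norm (q * w)"
  have bounds: "0 \<le> \<rho>" "\<rho> < 1" "0 \<le> r" "r < 1" using assms by (auto simp: \<rho>_def r_def)
  have nw: "norm (q ^ n * w) \<le> \<rho> ^ (n - 1) * r" if "n \<ge> 1" for n
  proof -
    have "q ^ n * w = q ^ (n - 1) * (q * w)" using that by (cases n) auto
    then have "norm (q ^ n * w) = norm (q ^ (n - 1) * (q * w))" by (rule arg_cong)
    then show ?thesis unfolding norm_mult[of "q ^ (n - 1)"] norm_power by (simp add: \<rho>_def r_def)
  qed
  have nw1: "norm (q ^ n * w) < 1" if "n \<ge> 1" for n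
  proof -
    have "\<rho> ^ (n - 1) * r \<le> 1 * r" using bounds by (intro mult_right_mono power_le_one) auto
    then show ?thesis using nw[OF that] bounds by simp
  qed
  have "?F abs_summable_on {1..} \<times> {1..}"
  proof (rule Infinite_Sum.abs_summable_on_comparison_test')
    show "(\<lambda>(n, d). \<rho> ^ (n - 1) * r ^ d) summable_on {1..} \<times> {1::nat..}"
    proof (rule summable_on_SigmaI)
      show "((\<lambda>d. case (n, d) of (n, d) \<Rightarrow> \<rho> ^ (n - 1) * r ^ d) has_sum \<rho> ^ (n - 1) * (r / (1 - r))) {1..}" for n :: nat
        unfolding case_prod_conv using bounds by (intro has_sum_cmult_right has_sum_geometric_from_1) auto
      have "bij_betw Suc UNIV {1..}" by (rule bij_betwI[of _ _ _ "\<lambda>n. n - 1"]) auto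
      moreover have "(\<lambda>n. \<rho> ^ n) summable_on UNIV"
        using bounds by (intro norm_summable_imp_summable_on) (auto intro: summable_geometric)
      ultimately have "(\<lambda>n. \<rho> ^ (n - 1)) summable_on {1..}"
        using summable_on_reindex_bij_betw[of Suc UNIV "{1..}" "\<lambda>n. \<rho> ^ (n - 1)"] by simp
      then show "(\<lambda>n::nat. \<rho> ^ (n - 1) * (r / (1 - r))) summable_on {1..}"
        by (rule summable_on_cmult_left)
    qed (use bounds in auto)
    fix x :: "nat \<times> nat" assume x: "x \<in> {1..} \<times> {1..}"
    obtain n d where nd: "x = (n, d)" "n \<ge> 1" "d \<ge> 1" using x by auto
    have "norm (q ^ n * w) ^ d \<le> (\<rho> ^ (n - 1) * r) ^ d"
      using nw[OF nd(2)] by (intro power_mono) auto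
    also have "\<dots> = (\<rho> ^ (n - 1)) ^ d * r ^ d" by (simp add: power_mult_distrib)
    \<comment> \<open>Lowering the exponent d >= 1 of a number at most 1 decouples n from d and
      leaves a product of geometric series.\<close>
    also have "\<dots> \<le> (\<rho> ^ (n - 1)) ^ 1 * r ^ d"
      using bounds nd(3) by (intro mult_right_mono power_decreasing) (auto intro: power_le_one)
    finally show "norm (?F x) \<le> (case x of (n, d) \<Rightarrow> \<rho> ^ (n - 1) * r ^ d)"
      by (simp add: nd(1) norm_power)
  qed
  then have "?F summable_on {1..} \<times> {1..}" by (rule Infinite_Sum.abs_summable_summable)
  then obtain S where S: "(?F has_sum S) ({1..} \<times> {1..})" by (auto simp: summable_on_def)
  have 1: "((\<lambda>n. q ^ n * w / (1 - q ^ n * w)) has_sum S) {1..}"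
  proof (rule has_sum_SigmaD[OF S])
    show "((\<lambda>d. ?F (n, d)) has_sum q ^ n * w / (1 - q ^ n * w)) {1..}" if "n \<in> {1..}" for n
      unfolding case_prod_conv using nw1 that by (intro has_sum_geometric_from_1) auto
  qed
  have "((\<lambda>(N, d). q ^ N * w ^ d) has_sum S) (Sigma {1..} (\<lambda>N. {d. d dvd N}))
      \<longleftrightarrow> (?F has_sum S) ({1..} \<times> {1..})"
  proof (rule has_sum_reindex_bij_witness[where i = "\<lambda>(n, d). (n * d, d)" and j = "\<lambda>(N, d). (N div d, d)"], goal_cases)
    case (2 x)
    then obtain N d where x: "x = (N, d)" "N \<ge> 1" "d dvd N" by auto
    then have "N div d * d = N" by simp
    with x have "N div d \<noteq> 0" "d \<noteq> 0" by (metis mult_0 not_one_le_zero, metis mult_0_right not_one_le_zero)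
    with x show ?case by simp
  next
    case (5 x)
    then obtain N d where x: "x = (N, d)" "d dvd N" by auto
    then have "q ^ N = (q ^ (N div d)) ^ d" by (simp add: power_mult[symmetric])
    then show ?case by (simp add: x power_mult_distrib)
  qed auto
  with S have "((\<lambda>(N, d). q ^ N * w ^ d) has_sum S) (Sigma {1..} (\<lambda>N. {d. d dvd N}))" by simp
  then have 2: "((\<lambda>N. q ^ N * (\<Sum>d | d dvd N. w ^ d)) has_sum S) {1..}"
  proof (rule has_sum_SigmaD)
    fix N :: nat assume "N \<in> {1..}"
    then have "finite {d. d dvd N}" by auto
    from has_sum_finite[OF this, of "\<lambda>d. q ^ N * w ^ d"]
    show "((\<lambda>d. case (N, d) of (N, d) \<Rightarrow> q ^ N * w ^ d) has_sum q ^ N * (\<Sum>d | d dvd N. w ^ d)) {d. d dvd N}"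
      by (simp add: sum_distrib_left)
  qed
  from 1 2 show ?thesis by (rule that)
qed

text \<open>Up to the factor -2\<pi>i, the q^N term of the logarithmic derivative of
  \<open>theta_tail\<close>.\<close>

definition divisor_wave :: "complex \<Rightarrow> nat \<Rightarrow> complex \<Rightarrow> complex" where
  "divisor_wave \<tau> N z = nome \<tau> ^ N * (\<Sum>d | d dvd N. exp (2 * pi * \<i> * of_nat d * z) - exp (- (2 * pi * \<i> * of_nat d) * z))"

abbreviation divisor_wave_sum :: "complex \<Rightarrow> complex \<Rightarrow> complex" where
  "divisor_wave_sum \<tau> \<equiv> \<lambda>z. \<Sum>N. divisor_wave \<tau> (Suc N) z"

lemma norm_nome_eq: "norm (nome \<tau>) = exp (- (2 * pi * Im \<tau>))"
  by (simp add: nome_def)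

lemma norm_nome_exp_less:
  assumes "y < Im \<tau>"
  shows "norm (nome \<tau>) * exp (2 * pi * y) < 1"
  using assms by (simp add: norm_nome_eq exp_add[symmetric])

text \<open>The bound on \<delta> says |q| exp(2\<pi>\<delta>) < 1, so the real Lambert series with
  |q| and w = exp(2\<pi>\<delta>) converges and dominates on the ball.\<close>

lemma divisor_wave_uniform_limit:
  assumes "\<tau> \<in> uhp" "\<delta> < Im \<tau>"
  shows "uniform_limit (ball 0 \<delta>) (\<lambda>n z. \<Sum>N<n. divisor_wave \<tau> (Suc N) z) (divisor_wave_sum \<tau>) sequentially"
proof (rule Weierstrass_m_test)
  define W where "W = exp (2 * pi * \<delta>)"
  let ?M = "\<lambda>N. norm (nome \<tau>) ^ N * (\<Sum>d | d dvd N. W ^ d)"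
  obtain S where "(?M has_sum S) {1..}"
    using lambert_has_sum[of "norm (nome \<tau>)" W] norm_nome[OF assms(1)] norm_nome_exp_less[OF assms(2)]
    by (auto simp: W_def)
  then have "summable (\<lambda>N. ?M (Suc N))" using has_sum_from_1_imp_sums sums_summable by blast
  then show "summable (\<lambda>N. 2 * ?M (Suc N))" by (rule summable_mult)
  fix N :: nat and z :: complex assume z: "z \<in> ball 0 \<delta>"
  then have "\<bar>Im z\<bar> \<le> \<delta>" using abs_Im_le_cmod[of z] by simp
  then have e: "norm (exp (2 * pi * \<i> * of_nat d * z)) \<le> W ^ d" "norm (exp (- (2 * pi * \<i> * of_nat d) * z)) \<le> W ^ d" for d
    using mult_left_mono[of "- Im z" \<delta> "real d * pi"] mult_left_mono[of "Im z" \<delta> "real d * pi"]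
    by (auto simp: W_def exp_of_nat_mult[symmetric] abs_le_iff mult_ac)
  have "norm (\<Sum>d | d dvd Suc N. exp (2 * pi * \<i> * of_nat d * z) - exp (- (2 * pi * \<i> * of_nat d) * z))
      \<le> (\<Sum>d | d dvd Suc N. W ^ d + W ^ d)"
    by (intro sum_norm_le order_trans[OF norm_triangle_ineq4] add_mono e)
  then have "norm (divisor_wave \<tau> (Suc N) z) \<le> norm (nome \<tau>) ^ Suc N * (\<Sum>d | d dvd Suc N. W ^ d + W ^ d)"
    unfolding divisor_wave_def norm_mult norm_power by (intro mult_left_mono) auto
  moreover have "(\<Sum>d | d dvd Suc N. W ^ d + W ^ d) = 2 * (\<Sum>d | d dvd Suc N. W ^ d)"
    by (simp add: sum_distrib_left)
  ultimately show "norm (divisor_wave \<tau> (Suc N) z) \<le> 2 * ?M (Suc N)"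
    by (simp only: mult.left_commute)
qed

lemma divisor_wave_holomorphic: "divisor_wave \<tau> N holomorphic_on A"
  unfolding divisor_wave_def by (intro holomorphic_intros)

lemma divisor_wave_sum_holomorphic:
  assumes "\<tau> \<in> uhp" "\<delta> < Im \<tau>"
  shows "(divisor_wave_sum \<tau>) holomorphic_on ball 0 \<delta>"
proof (rule holomorphic_uniform_sequence)
  show "(\<lambda>z. \<Sum>N<n. divisor_wave \<tau> (Suc N) z) holomorphic_on ball 0 \<delta>" for n
    by (intro holomorphic_intros divisor_wave_holomorphic)
  fix x :: complex assume "x \<in> ball 0 \<delta>"
  then obtain d where "d > 0" "cball x d \<subseteq> ball 0 \<delta>" using open_contains_cball open_ball by blast
  then show "\<exists>d>0. cball x d \<subseteq> ball 0 \<delta> \<and> uniform_limit (cball x d) (\<lambda>n z. \<Sum>N<n. divisor_wave \<tau> (Suc N) z)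
      (divisor_wave_sum \<tau>) sequentially"
    using uniform_limit_on_subset[OF divisor_wave_uniform_limit[OF assms]] by blast
qed auto

lemma higher_deriv_exp_linear: "(deriv ^^ k) (\<lambda>z. exp (c * z)) = (\<lambda>z. c ^ k * exp (c * z))" for c :: complex
proof (induction k)
  case (Suc k)
  have "deriv (\<lambda>z. c ^ k * exp (c * z)) z = c ^ Suc k * exp (c * z)" for z
    by (rule DERIV_imp_deriv) (auto intro!: derivative_eq_intros)
  then show ?case by (simp add: Suc.IH fun_eq_iff)
qed simp

lemma higher_deriv_sum_UNIV:
  assumes "\<And>i. i \<in> I \<Longrightarrow> f i holomorphic_on UNIV"
  shows "(deriv ^^ k) (\<lambda>z. \<Sum>i\<in>I. f i z) z = (\<Sum>i\<in>I. (deriv ^^ k) (f i) z)"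
  using assms
proof (induction I rule: infinite_finite_induct)
  case (insert i I)
  have "(deriv ^^ k) (\<lambda>z. f i z + (\<Sum>i\<in>I. f i z)) z = (deriv ^^ k) (f i) z + (deriv ^^ k) (\<lambda>z. \<Sum>i\<in>I. f i z) z"
    using insert.prems by (intro higher_deriv_add[where S = UNIV] holomorphic_intros) auto
  then show ?case using insert by simp
qed auto

text \<open>For odd k the two exponentials reinforce each other at 0; this is the factor 2 in front
  of the q-series of G_2k.\<close>

lemma divisor_wave_higher_deriv:
  assumes "odd k"
  shows "(deriv ^^ k) (divisor_wave \<tau> (Suc N)) 0 =
    2 * (2 * pi * \<i>) ^ k * (of_nat (divisor_sum k (Suc N)) * nome \<tau> ^ Suc N)"
proof -
  let ?e = "\<lambda>(d::nat) z. exp (2 * pi * \<i> * of_nat d * z) - exp (- (2 * pi * \<i> * of_nat d) * z)"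
  have "(deriv ^^ k) (divisor_wave \<tau> (Suc N)) 0 = nome \<tau> ^ Suc N *
     (deriv ^^ k) (\<lambda>z. \<Sum>d | d dvd Suc N. ?e d z) 0"
    unfolding divisor_wave_def by (rule higher_deriv_cmult[where A = UNIV]) (auto intro!: holomorphic_intros)
  also have "(deriv ^^ k) (\<lambda>z. \<Sum>d | d dvd Suc N. ?e d z) 0
      = (\<Sum>d | d dvd Suc N. (deriv ^^ k) (?e d) 0)"
    by (rule higher_deriv_sum_UNIV) (auto intro!: holomorphic_intros)
  also have "\<dots> = (\<Sum>d | d dvd Suc N. 2 * (2 * pi * \<i>) ^ k * of_nat (d ^ k))"
  proof (intro sum.cong refl)
    fix d
    have "(deriv ^^ k) (?e d) 0
      = (deriv ^^ k) (\<lambda>z. exp (2 * pi * \<i> * of_nat d * z)) 0 - (deriv ^^ k) (\<lambda>z. exp (- (2 * pi * \<i> * of_nat d) * z)) 0"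
      by (rule higher_deriv_diff[where S = UNIV]) (auto intro!: holomorphic_intros)
    also have "\<dots> = (2 * pi * \<i> * of_nat d) ^ k - (- (2 * pi * \<i> * of_nat d)) ^ k"
      unfolding higher_deriv_exp_linear by simp
    finally have "(deriv ^^ k) (?e d) 0
      = (2 * pi * \<i> * of_nat d) ^ k - (- (2 * pi * \<i> * of_nat d)) ^ k" .
    then show "(deriv ^^ k) (?e d) 0
      = 2 * (2 * pi * \<i>) ^ k * of_nat (d ^ k)"
      using assms by (simp add: power_mult_distrib)
  qed
  also have "\<dots> = 2 * (2 * pi * \<i>) ^ k * of_nat (divisor_sum k (Suc N))"
    by (simp add: divisor_sum_def sum_distrib_left)
  finally show ?thesis by (simp add: mult_ac)
qed

lemma divisor_wave_sum_higher_deriv: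
  assumes "\<tau> \<in> uhp" "odd k"
  shows "(\<lambda>N. 2 * (2 * pi * \<i>) ^ k * (of_nat (divisor_sum k (Suc N)) * nome \<tau> ^ Suc N)) sums
    (deriv ^^ k) (divisor_wave_sum \<tau>) 0"
proof -
  have v: "Im \<tau> > 0" using assms(1) by (simp add: uhp_def)
  have "(\<lambda>n. (deriv ^^ k) (\<lambda>z. \<Sum>N<n. divisor_wave \<tau> (Suc N) z) 0) \<longlonglongrightarrow> (deriv ^^ k) (divisor_wave_sum \<tau>) 0"
    by (rule higher_deriv_complex_uniform_limit[OF divisor_wave_uniform_limit[OF assms(1), of "Im \<tau> / 2"]])
      (use v in \<open>auto intro!: always_eventually holomorphic_intros divisor_wave_holomorphic\<close>)
  moreover have "(deriv ^^ k) (\<lambda>z. \<Sum>N<n. divisor_wave \<tau> (Suc N) z) 0 =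
      (\<Sum>N<n. 2 * (2 * pi * \<i>) ^ k * (of_nat (divisor_sum k (Suc N)) * nome \<tau> ^ Suc N))" for n
    unfolding divisor_wave_higher_deriv[OF assms(2), symmetric]
    by (rule higher_deriv_sum_UNIV) (auto intro!: divisor_wave_holomorphic)
  ultimately show ?thesis by (simp add: sums_def)
qed

lemma eisenstein_summable:
  assumes "\<tau> \<in> uhp" "odd k"
  shows "summable (\<lambda>N. of_nat (divisor_sum k (Suc N)) * nome \<tau> ^ Suc N)"
  using sums_summable[OF divisor_wave_sum_higher_deriv[OF assms]]
  by (subst (asm) summable_cmult_iff) auto

text \<open>Each factor contributes the difference of the Lambert terms for w = \<zeta> and w =
  1/\<zeta>. The strip |Im z| < Im \<tau> is where both q\<zeta> and q/\<zeta> lie in the unit disc,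
  so that the sums may be regrouped by powers of q.\<close>

lemma theta_tail_log_deriv:
  assumes "\<tau> \<in> uhp" "\<bar>Im z\<bar> < Im \<tau>" "theta_tail \<tau> z \<noteq> 0"
  shows "deriv (theta_tail \<tau>) z / theta_tail \<tau> z = - (2 * pi * \<i>) * divisor_wave_sum \<tau> z"
proof -
  define q where "q = nome \<tau>"
  define x where "x = exp (2 * pi * \<i> * z)"
  define y where "y = exp (- (2 * pi * \<i>) * z)"
  have nz: "theta_factor \<tau> n z \<noteq> 0" for n using assms(3) theta_tail_eq_0_iff[OF assms(1)] by blast
  have n1: "norm (q * x) < 1" and n2: "norm (q * y) < 1"
    using norm_nome_exp_less[of "- Im z" \<tau>] norm_nome_exp_less[of "Im z" \<tau>] assms(2)
    by (simp_all add: q_def x_def y_def norm_mult mult.assoc)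
  have nq: "norm q < 1" using norm_nome[OF assms(1)] by (simp add: q_def)
  obtain S where
    S: "((\<lambda>n. q ^ n * x / (1 - q ^ n * x)) has_sum S) {1..}" "((\<lambda>N. q ^ N * (\<Sum>d | d dvd N. x ^ d)) has_sum S) {1..}"
    by (rule lambert_has_sum[OF nq n1])
  obtain T where
    T: "((\<lambda>n. q ^ n * y / (1 - q ^ n * y)) has_sum T) {1..}" "((\<lambda>N. q ^ N * (\<Sum>d | d dvd N. y ^ d)) has_sum T) {1..}"
    by (rule lambert_has_sum[OF nq n2])
  have "x ^ d = exp (2 * pi * \<i> * of_nat d * z)" "y ^ d = exp (- (2 * pi * \<i> * of_nat d) * z)" for d
    by (simp_all add: x_def y_def exp_of_nat_mult[symmetric] mult_ac)
  then have "divisor_wave \<tau> N z = q ^ N * (\<Sum>d | d dvd N. x ^ d) - q ^ N * (\<Sum>d | d dvd N. y ^ d)" for N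
    by (simp add: divisor_wave_def q_def sum_subtractf right_diff_distrib)
  then have wave: "(\<lambda>N. divisor_wave \<tau> (Suc N) z) sums (S - T)"
    using sums_diff[OF has_sum_from_1_imp_sums[OF S(2)] has_sum_from_1_imp_sums[OF T(2)]] by simp
  let ?l = "\<lambda>n. - (2 * pi * \<i>) * (q ^ Suc n * x / (1 - q ^ Suc n * x) - q ^ Suc n * y / (1 - q ^ Suc n * y))"
  have "deriv (theta_factor \<tau> n) z / theta_factor \<tau> n z =
     ?l n" for n
  proof -
    have f: "theta_factor \<tau> n = (\<lambda>z. (1 - q ^ Suc n * exp (2 * pi * \<i> * z)) * (1 - q ^ Suc n * exp (- (2 * pi * \<i>) * z)))"
      by (simp add: fun_eq_iff theta_factor_def q_def)
    have ne: "1 - q ^ Suc n * x \<noteq> 0" "1 - q ^ Suc n * y \<noteq> 0"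
      using nz[of n] unfolding f x_def y_def by auto
    have d: "deriv (theta_factor \<tau> n) z = - (2 * pi * \<i>) * (q ^ Suc n * x) * (1 - q ^ Suc n * y)
       + (2 * pi * \<i>) * (q ^ Suc n * y) * (1 - q ^ Suc n * x)"
      unfolding f x_def y_def by (rule DERIV_imp_deriv) (auto intro!: derivative_eq_intros simp: algebra_simps)
    have e: "theta_factor \<tau> n z = (1 - q ^ Suc n * x) * (1 - q ^ Suc n * y)"
      unfolding f x_def y_def ..
    have "(- c * A * (1 - B) + c * B * (1 - A)) / ((1 - A) * (1 - B)) = - c * (A / (1 - A) - B / (1 - B))"
      if "1 - A \<noteq> 0" "1 - B \<noteq> 0" for A B c :: complex
    proof -
      have "- c * (A / (1 - A) - B / (1 - B)) = - c * ((A * (1 - B) - B * (1 - A)) / ((1 - A) * (1 - B)))"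
        using diff_frac_eq[OF that] by simp
      then show ?thesis by (simp add: algebra_simps)
    qed
    from this[OF ne] show ?thesis unfolding d e .
  qed
  then have "?l
      sums (deriv (theta_tail \<tau>) z / theta_tail \<tau> z)"
    using logderiv_prodinf_complex_uniform_limit[OF uniform_limit_on_subset[OF
        theta_tail_uniform_limit[OF assms(1) compact_cball[of z 1]] ball_subset_cball] theta_factor_holomorphic assms(3)]
    by simp
  moreover have "?l
      sums (- (2 * pi * \<i>) * (S - T))"
    by (intro sums_mult sums_diff has_sum_from_1_imp_sums[OF S(1)] has_sum_from_1_imp_sums[OF T(1)])
  ultimately have "deriv (theta_tail \<tau>) z / theta_tail \<tau> z = - (2 * pi * \<i>) * (S - T)"
    by (rule sums_unique2)
  then show ?thesis unfolding sums_unique[OF wave, symmetric] .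
qed

lemma small_not_in_lattice:
  assumes "\<tau> \<in> uhp" "z \<noteq> 0" "norm z < 1" "norm z < Im \<tau>"
  shows "z \<notin> period_lattice \<tau>"
proof
  assume "z \<in> period_lattice \<tau>"
  then obtain a b where z: "z = of_int a + of_int b * \<tau>" by (auto simp: period_lattice_def)
  have v: "Im \<tau> > 0" using assms(1) by (simp add: uhp_def)
  have "\<bar>of_int b\<bar> * Im \<tau> < 1 * Im \<tau>"
    using le_less_trans[OF abs_Im_le_cmod[of z] assms(4)] v unfolding z by (simp add: abs_mult)
  then have "\<bar>of_int b :: real\<bar> < 1" by (rule mult_right_less_imp_less) (use v in simp)
  then have "b = 0" by linarith
  then have "\<bar>of_int a :: real\<bar> < 1" using assms(3) by (simp add: z)
  then have "a = 0" by linarith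
  with \<open>b = 0\<close> assms(2) show False by (simp add: z)
qed

text \<open>The prefactor of the product contributes \<pi>i + 2\<pi>i/(\<zeta> - 1), that is the
  pole 1/z and the Bernoulli constants; the tail contributes the divisor sums. Thus G_2k obeys at
  the origin the formula valid at other torsion points, with \<theta>'/\<theta> replaced by its
  regular part.\<close>

lemma theta_log_laurent:
  assumes "\<tau> \<in> uhp"
  obtains R \<delta> where "\<delta> > 0" "R holomorphic_on ball 0 \<delta>"
    "\<And>z. z \<in> ball 0 \<delta> \<Longrightarrow> z \<noteq> 0 \<Longrightarrow> z \<notin> period_lattice \<tau> \<and> theta_log \<tau> z = 1 / z + R z"
    "\<And>k. k \<ge> 1 \<Longrightarrow> (deriv ^^ (2 * k - 1)) R 0 = - ((2 * pi * \<i>) ^ (2 * k) * eisenstein k \<tau>)"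
proof -
  have v: "Im \<tau> > 0" using assms by (simp add: uhp_def)
  obtain h r where h: "r > 0" "h holomorphic_on ball 0 r"
    "\<And>x. x \<noteq> 0 \<Longrightarrow> exp x \<noteq> 1 \<Longrightarrow> h x = 1 / (exp x - 1) - 1 / x"
    "\<And>n. (deriv ^^ n) h 0 = of_real (bernoulli_number (Suc n)) / of_nat (Suc n)"
    by (rule inverse_exp_minus_1_expansion) (rule that)
  let ?c = "2 * pi * \<i>"
  \<comment> \<open>The three bounds ensure in turn: convergence of the wave sum, absence of nonzero
    lattice points (together with the first), and 2\<pi>iz in the domain of
    \<open>h\<close>.\<close>
  define \<delta> where "\<delta> = min (min (Im \<tau> / 2) 1) (r / (2 * pi))"
  define S where "S = (divisor_wave_sum \<tau>)"
  define R where "R = (\<lambda>z. (pi * \<i> + ?c * h (?c * z)) - ?c * S z)"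
  have "\<delta> \<le> Im \<tau> / 2" "\<delta> \<le> 1" "\<delta> \<le> r / (2 * pi)" unfolding \<delta>_def by linarith+
  moreover have "\<delta> > 0" using v h(1) by (simp add: \<delta>_def)
  ultimately have \<delta>: "\<delta> > 0" "\<delta> < Im \<tau>" "\<delta> \<le> 1" "2 * pi * \<delta> \<le> r"
    using v by (simp_all add: pos_le_divide_eq mult_ac)
  have sub: "?c * z \<in> ball 0 r" if "z \<in> ball 0 \<delta>" for z
  proof -
    have "2 * pi * norm z < 2 * pi * \<delta>" using that by simp
    from less_le_trans[OF this \<delta>(4)] show ?thesis by (simp add: norm_mult)
  qed
  have "(\<lambda>z. ?c * z) holomorphic_on ball 0 \<delta>" by (intro holomorphic_intros)
  from holomorphic_on_compose_gen[OF this h(2) image_subsetI[OF sub]]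
  have hc: "(\<lambda>z. h (?c * z)) holomorphic_on ball 0 \<delta>" unfolding o_def .
  have Sh: "S holomorphic_on ball 0 \<delta>"
    unfolding S_def by (rule divisor_wave_sum_holomorphic[OF assms \<delta>(2)])
  have R1: "(\<lambda>z. pi * \<i> + ?c * h (?c * z)) holomorphic_on ball 0 \<delta>" and R2: "(\<lambda>z. ?c * S z) holomorphic_on ball 0 \<delta>"
    by (intro holomorphic_intros hc Sh)+
  then have Rh: "R holomorphic_on ball 0 \<delta>" unfolding R_def by (rule holomorphic_on_diff)
  have laurent: "z \<notin> period_lattice \<tau> \<and> theta_log \<tau> z = 1 / z + R z" if z: "z \<in> ball 0 \<delta>" "z \<noteq> 0" for z
  proof -
    have notin: "z \<notin> period_lattice \<tau>" using z \<delta> by (intro small_not_in_lattice assms) auto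
    obtain C where C: "C \<noteq> 0" "\<And>z. jtheta z \<tau> = C * theta_product \<tau> z"
      using jtheta_eq_product[OF assms] by blast
    define P where "P = theta_tail \<tau>"
    define s where "s = exp (pi * \<i> * z) - exp (- pi * \<i> * z)"
    define s' where "s' = pi * \<i> * (exp (pi * \<i> * z) + exp (- pi * \<i> * z))"
    have "theta_product \<tau> z \<noteq> 0" using notin C jtheta_eq_0_iff[OF assms, of z] by simp
    then have nz: "s \<noteq> 0" "P z \<noteq> 0" by (auto simp: theta_product_def s_def P_def)
    have Pd: "(P has_field_derivative deriv P z) (at z)"
      using theta_tail_holomorphic[OF assms, of UNIV] unfolding P_def by (auto intro: holomorphic_derivI)
    have "((\<lambda>z. jtheta z \<tau>) has_field_derivative C * (s' * P z + s * deriv P z)) (at z)"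
      unfolding C(2) theta_product_def P_def[symmetric]
      by (auto intro!: derivative_eq_intros Pd simp: s_def s'_def algebra_simps)
    then have "theta_log \<tau> z = C * (s' * P z + s * deriv P z) / (C * (s * P z))"
      using theta_log_eqI[OF assms] by (simp add: C(2) theta_product_def s_def P_def)
    also have "\<dots> = s' / s + deriv P z / P z" using nz C(1) by (simp add: field_simps)
    also have "deriv P z / P z = - ?c * S z"
      unfolding P_def S_def using z \<delta> abs_Im_le_cmod[of z] nz
      by (intro theta_tail_log_deriv assms) (auto simp: P_def)
    also have "s' / s = 1 / z + (pi * \<i> + ?c * h (?c * z))"
    proof -
      define E where "E = exp (pi * \<i> * z)"
      have E0: "E \<noteq> 0" by (simp add: E_def)
      have Ec: "exp (?c * z) = E\<^sup>2" unfolding E_def power2_eq_square exp_add[symmetric] by (rule arg_cong[where f = exp]) simp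
      have Em: "exp (- pi * \<i> * z) = 1 / E" by (simp add: E_def exp_minus field_simps)
      have sE: "s = E - 1 / E" "s' = pi * \<i> * (E + 1 / E)" unfolding s_def s'_def Em by (simp_all add: E_def)
      have E1: "E\<^sup>2 - 1 \<noteq> 0" using nz(1) E0 unfolding sE by (auto simp: field_simps power2_eq_square)
      have "s' / s = pi * \<i> + ?c * (1 / (E\<^sup>2 - 1))"
      proof -
        have "s' / s = pi * \<i> * (E\<^sup>2 + 1) / (E\<^sup>2 - 1)"
        proof -
          have "s = (E\<^sup>2 - 1) / E" "s' = pi * \<i> * (E\<^sup>2 + 1) / E"
            unfolding sE using E0 by (simp_all add: field_simps power2_eq_square)
          then show ?thesis using E0 by simp
        qed
        then show ?thesis using E1 by (simp add: field_simps)
      qed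
      also have "1 / (E\<^sup>2 - 1) = h (?c * z) + 1 / (?c * z)"
        using h(3)[of "?c * z"] z(2) E1 unfolding Ec by simp
      finally have "s' / s = pi * \<i> + (?c * h (?c * z) + ?c * (1 / (?c * z)))"
        unfolding distrib_left .
      moreover have "?c * (1 / (?c * z)) = 1 / z" by simp
      ultimately show ?thesis by (simp only: add_ac)
    qed
    finally show ?thesis using notin by (simp add: R_def)
  qed
  have "(deriv ^^ (2 * k - 1)) R 0 = - (?c ^ (2 * k) * eisenstein k \<tau>)" if k: "k \<ge> 1" for k
  proof -
    obtain l where l: "2 * k - 1 = Suc (2 * l)" "k = Suc l" using k by (cases k) auto
    let ?d = "deriv ^^ Suc (2 * l) :: (complex \<Rightarrow> complex) \<Rightarrow> complex \<Rightarrow> complex"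
    have "?d S 0 = (\<Sum>N. 2 * ?c ^ Suc (2 * l) * (of_nat (divisor_sum (Suc (2 * l)) (Suc N)) * nome \<tau> ^ Suc N))"
      using divisor_wave_sum_higher_deriv[OF assms, of "Suc (2 * l)"] unfolding S_def by (simp add: sums_iff)
    also have "\<dots> = 2 * ?c ^ Suc (2 * l) * (\<Sum>N. of_nat (divisor_sum (Suc (2 * l)) (Suc N)) * nome \<tau> ^ Suc N)"
      by (rule suminf_mult) (rule eisenstein_summable[OF assms], simp)
    finally have dS: "?d S 0 = \<dots>" .
    have dh: "?d (\<lambda>z. h (?c * z)) 0 = ?c ^ Suc (2 * l) * (of_real (bernoulli_number (2 * k)) / of_nat (2 * k))"
      using higher_deriv_compose_linear[OF h(2), of "ball 0 \<delta>" 0 ?c "Suc (2 * l)"] sub \<delta>(1) h(4)[of "Suc (2 * l)"] l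
      by simp
    have z0: "0 \<in> ball 0 \<delta>" using \<delta>(1) by simp
    have "?d R 0 = ?d (\<lambda>z. pi * \<i> + ?c * h (?c * z)) 0 - ?d (\<lambda>z. ?c * S z) 0"
      unfolding R_def by (rule higher_deriv_diff[OF R1 R2 open_ball z0])
    also have "?d (\<lambda>z. ?c * S z) 0 = ?c * ?d S 0"
      by (rule higher_deriv_cmult[OF Sh z0 open_ball])
    also have "?d (\<lambda>z. pi * \<i> + ?c * h (?c * z)) 0
       = ?d (\<lambda>z. pi * \<i>) 0 + ?d (\<lambda>z. ?c * h (?c * z)) 0"
      by (rule higher_deriv_add[OF _ _ open_ball z0]) (intro holomorphic_intros hc)+
    also have "?d (\<lambda>z. ?c * h (?c * z)) 0 = ?c * ?d (\<lambda>z. h (?c * z)) 0"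
      by (rule higher_deriv_cmult[OF hc z0 open_ball])
    also have "?d (\<lambda>z. pi * \<i>) 0 = (0 :: complex)" by (simp del: funpow.simps)
    finally have "?d R 0 =
       ?c * (?c ^ Suc (2 * l) * (of_real (bernoulli_number (2 * k)) / of_nat (2 * k)))
       - ?c * (2 * ?c ^ Suc (2 * l) * (\<Sum>N. of_nat (divisor_sum (Suc (2 * l)) (Suc N)) * nome \<tau> ^ Suc N))"
      unfolding dh dS by simp
    also have "\<dots> = - (?c ^ (2 * k) * eisenstein k \<tau>)"
      unfolding eisenstein_def l(1) nome_def l(2) by (simp add: algebra_simps)
    finally show ?thesis unfolding l(1) .
  qed
  with \<delta>(1) Rh laurent show ?thesis by (rule that)
qed

section \<open>Eisenstein series of a divisor\<close>

text \<open>Under z |-> z/j the pole 1/z, divided by j, is preserved, so the regular parts satisfy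
  the transformation law of \<theta>'/\<theta>. The anomaly of G_2 thus comes from the Gaussian in
  the law of \<theta>, without conditionally convergent lattice sums.\<close>

lemma eisenstein_modular:
  fixes a b c d :: int
  assumes "a * d - b * c = 1" "\<tau> \<in> uhp" "k \<ge> 1"
  shows "eisenstein k (mobius a b c d \<tau>) =
    (of_int c * \<tau> + of_int d) ^ (2 * k) * eisenstein k \<tau>
      + (if k = 1 then \<i> / (2 * pi) * of_int c * (of_int c * \<tau> + of_int d) else 0)"
proof -
  define j where "j = of_int c * \<tau> + of_int d"
  define t where "t = (of_int a * \<tau> + of_int b) / j"
  have j0: "j \<noteq> 0" using mobius_denom_nonzero[OF assms(1,2)] by (simp add: j_def)
  have t: "t \<in> uhp" using mobius_in_uhp[OF assms(1,2)] by (simp add: t_def j_def)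
  obtain R1 \<delta>1 where R1: "\<delta>1 > 0" "R1 holomorphic_on ball 0 \<delta>1"
    "\<And>z. z \<in> ball 0 \<delta>1 \<Longrightarrow> z \<noteq> 0 \<Longrightarrow> z \<notin> period_lattice \<tau> \<and> theta_log \<tau> z = 1 / z + R1 z"
    "\<And>k. k \<ge> 1 \<Longrightarrow> (deriv ^^ (2 * k - 1)) R1 0 = - ((2 * pi * \<i>) ^ (2 * k) * eisenstein k \<tau>)"
    by (rule theta_log_laurent[OF assms(2)]) (rule that)
  obtain R2 \<delta>2 where R2: "\<delta>2 > 0" "R2 holomorphic_on ball 0 \<delta>2"
    "\<And>z. z \<in> ball 0 \<delta>2 \<Longrightarrow> z \<noteq> 0 \<Longrightarrow> z \<notin> period_lattice t \<and> theta_log t z = 1 / z + R2 z"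
    "\<And>k. k \<ge> 1 \<Longrightarrow> (deriv ^^ (2 * k - 1)) R2 0 = - ((2 * pi * \<i>) ^ (2 * k) * eisenstein k t)"
    by (rule theta_log_laurent[OF t]) (rule that)
  define \<delta> where "\<delta> = min \<delta>1 (norm j * \<delta>2)"
  have \<delta>: "\<delta> > 0" "\<delta> \<le> \<delta>1" "\<delta> \<le> norm j * \<delta>2" using R1(1) R2(1) j0 by (auto simp: \<delta>_def)
  have sub: "1 / j * z \<in> ball 0 \<delta>2" if "z \<in> ball 0 \<delta>" for z
  proof -
    have "norm z < norm j * \<delta>2" using that \<delta>(3) by simp
    then show ?thesis using j0 by (simp add: norm_divide divide_less_eq mult.commute)
  qed
  have R1h: "R1 holomorphic_on ball 0 \<delta>"
    using R1(2) \<delta>(2) holomorphic_on_subset subset_ball by blast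
  have "(\<lambda>z. 1 / j * z) holomorphic_on ball 0 \<delta>" by (intro holomorphic_intros)
  from holomorphic_on_compose_gen[OF this R2(2) image_subsetI[OF sub]]
  have R2h: "(\<lambda>z. R2 (1 / j * z)) holomorphic_on ball 0 \<delta>" unfolding o_def .
  have rhs: "(\<lambda>z. j * R1 z + 2 * pi * \<i> * of_int c * z) holomorphic_on ball 0 \<delta>"
    by (intro holomorphic_intros R1h)
  have z0: "0 \<in> ball 0 \<delta>" using \<delta>(1) by simp
  have eq': "R2 (1 / j * z) = j * R1 z + 2 * pi * \<i> * of_int c * z" if "z \<in> ball 0 \<delta>" "z \<noteq> 0" for z
  proof -
    have z1: "z \<in> ball 0 \<delta>1" using that(1) \<delta>(2) by simp
    have "theta_log t (z / j) / j = theta_log \<tau> z + 2 * pi * \<i> * of_int c * z / j"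
      using theta_log_modular[OF assms(1,2)] R1(3)[OF z1 that(2)] unfolding t_def j_def by blast
    moreover have "theta_log t (z / j) = j / z + R2 (z / j)"
      using R2(3)[of "z / j"] sub[OF that(1)] that(2) j0 by simp
    moreover have "theta_log \<tau> z = 1 / z + R1 z" using R1(3)[OF z1 that(2)] by blast
    ultimately have "(j / z + R2 (z / j)) / j = (1 / z + R1 z) + 2 * pi * \<i> * of_int c * z / j" by simp
    then have "j / z + R2 (z / j) = ((1 / z + R1 z) + 2 * pi * \<i> * of_int c * z / j) * j"
      using j0 by (simp add: divide_eq_eq)
    also have "\<dots> = j / z + (j * R1 z + 2 * pi * \<i> * of_int c * z)" using j0 by (simp add: distrib_right)
    finally show ?thesis by simp
  qed
  \<comment> \<open>The law of \<theta>'/\<theta> gives the relation only for z distinct from 0.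
    Continuity of the regular parts adds the centre, so that both sides can be differentiated
    there.\<close>
  have "R2 (1 / j * 0) = j * R1 0 + 2 * pi * \<i> * of_int c * 0"
  proof (rule LIM_unique)
    show "(\<lambda>z. R2 (1 / j * z)) \<midarrow>0\<rightarrow> R2 (1 / j * 0)"
      using R2h z0 holomorphic_on_imp_continuous_on continuous_on_eq_continuous_at isCont_def open_ball by blast
    have "(\<lambda>z. j * R1 z + 2 * pi * \<i> * of_int c * z) \<midarrow>0\<rightarrow> j * R1 0 + 2 * pi * \<i> * of_int c * 0"
      using rhs z0 holomorphic_on_imp_continuous_on continuous_on_eq_continuous_at isCont_def open_ball by blast
    moreover have "eventually (\<lambda>z. j * R1 z + 2 * pi * \<i> * of_int c * z = R2 (1 / j * z)) (at 0)"
      using eventually_at_in_open[OF open_ball z0] by eventually_elim (use eq' in auto)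
    ultimately show "(\<lambda>z. R2 (1 / j * z)) \<midarrow>0\<rightarrow> j * R1 0 + 2 * pi * \<i> * of_int c * 0"
      by (rule Lim_transform_eventually)
  qed
  with eq' have eq: "R2 (1 / j * z) = j * R1 z + 2 * pi * \<i> * of_int c * z" if "z \<in> ball 0 \<delta>" for z
    using that by (cases "z = 0") auto
  obtain l where l: "2 * k - 1 = Suc (2 * l)" "k = Suc l" using assms(3) by (cases k) auto
  have main: "- ((2 * pi * \<i>) ^ (2 * k) * eisenstein k t) =
      j ^ Suc (Suc (2 * l)) * - ((2 * pi * \<i>) ^ (2 * k) * eisenstein k \<tau>) + (if 2 * l = 0 then 2 * pi * \<i> * of_int c * j else 0)"
    using higher_deriv_scaling[OF R2(2) R1h open_ball open_ball z0 j0 sub eq, of "2 * l"]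
      R1(4)[OF assms(3)] R2(4)[OF assms(3)] unfolding l(1) by simp
  define x where "x = (2 * pi * \<i>) ^ (2 * k)"
  have x0: "x \<noteq> 0" by (simp add: x_def)
  have "x * eisenstein k t = x * (j ^ (2 * k) * eisenstein k \<tau>) - (if l = 0 then 2 * pi * \<i> * of_int c * j else 0)"
    using main unfolding x_def[symmetric] by (auto simp: l(2) algebra_simps)
  then have "eisenstein k t = j ^ (2 * k) * eisenstein k \<tau> - (if l = 0 then 2 * pi * \<i> * of_int c * j else 0) / x"
    using x0 by (simp add: field_simps)
  moreover have "(if l = 0 then 2 * pi * \<i> * of_int c * j else 0) / x = - (if k = 1 then \<i> / (2 * pi) * of_int c * j else 0)"
    by (auto simp: x_def l(2) power2_eq_square field_simps)
  ultimately show ?thesis unfolding j_def[symmetric] t_def[symmetric] by simp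
qed

lemma eisenstein_holomorphic:
  assumes "k \<ge> 1"
  shows "eisenstein k holomorphic_on uhp"
proof -
  define F where "F = Abs_fps (\<lambda>n. if n = 0 then 0 else complex_of_nat (divisor_sum (2 * k - 1) n))"
  have odd: "odd (2 * k - 1)" using assms by simp
  have summ: "summable (\<lambda>n. fps_nth F n * nome \<tau> ^ n)" if "\<tau> \<in> uhp" for \<tau>
    using eisenstein_summable[OF that odd] unfolding summable_Suc_iff[of "\<lambda>n. fps_nth F n * nome \<tau> ^ n", symmetric]
    by (simp add: F_def)
  have "conv_radius (fps_nth F) \<ge> 1"
  proof (rule conv_radius_geI_ex)
    fix r :: real assume r: "0 < r" "ereal r < 1"
    \<comment> \<open>The point of the imaginary axis whose nome has modulus r; convergence for all
      such r gives radius at least 1.\<close>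
    define \<tau> where "\<tau> = \<i> * of_real (- ln r / (2 * pi))"
    have "ln r < 0" using r by simp
    then have "\<tau> \<in> uhp" by (simp add: \<tau>_def uhp_def divide_less_0_iff)
    moreover have "norm (nome \<tau>) = r" using r(1) by (simp add: norm_nome_eq \<tau>_def)
    ultimately show "\<exists>z. norm z = r \<and> summable (\<lambda>n. fps_nth F n * z ^ n)" using summ by blast
  qed
  then have rad: "fps_conv_radius F \<ge> 1" by (simp add: fps_conv_radius_def)
  have "nome ` uhp \<subseteq> eball 0 (fps_conv_radius F)"
  proof
    fix q assume "q \<in> nome ` uhp"
    then have "q \<in> ball 0 1" using norm_nome by auto
    then show "q \<in> eball 0 (fps_conv_radius F)" using rad ball_eball_mono[of 1] unfolding one_ereal_def by blast
  qed
  moreover have "nome holomorphic_on uhp" unfolding nome_def by (intro holomorphic_intros)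
  ultimately have "eval_fps F \<circ> nome holomorphic_on uhp"
    by (intro holomorphic_on_compose_gen[where t = "eball 0 (fps_conv_radius F)"] holomorphic_on_eval_fps) auto
  then have "(\<lambda>\<tau>. - of_real (bernoulli_number (2 * k)) / (2 * of_nat k) + 2 * eval_fps F (nome \<tau>)) holomorphic_on uhp"
    unfolding o_def by (intro holomorphic_intros)
  then show ?thesis
  proof (rule holomorphic_transform)
    fix \<tau> assume "\<tau> \<in> uhp"
    from suminf_split_head[OF summ[OF this]]
    have "(\<Sum>n. fps_nth F (Suc n) * nome \<tau> ^ Suc n) = eval_fps F (nome \<tau>)"
      by (simp add: eval_fps_def F_def)
    then show "- of_real (bernoulli_number (2 * k)) / (2 * of_nat k) + 2 * eval_fps F (nome \<tau>) = eisenstein k \<tau>"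
      by (simp add: eisenstein_def F_def nome_def)
  qed
qed

lemma eisenstein_div_holomorphic:
  assumes "k \<ge> 1"
  shows "eisenstein_div k D holomorphic_on uhp"
proof -
  have "eisenstein_point k p holomorphic_on uhp" for p
  proof (cases "p \<in> integral_pairs")
    case True
    then have "eisenstein_point k p = (if even k then eisenstein (k div 2) else (\<lambda>_. 0))"
      by (auto simp: eisenstein_point_def fun_eq_iff)
    moreover have "k div 2 \<ge> 1" if "even k" using that assms by (auto elim!: evenE)
    ultimately show ?thesis using eisenstein_holomorphic by (cases "even k") (simp_all only: if_True if_False holomorphic_on_const)
  next
    case False
    then show ?thesis using eisenstein_point_nonintegral_holomorphic[of p "k - 1"] assms by simp
  qed
  then show ?thesis unfolding eisenstein_div_def[abs_def] by (intro holomorphic_intros)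
qed

lemma eisenstein_point_modular:
  fixes a b c d :: int
  assumes "a * d - b * c = 1" "\<tau> \<in> uhp" "k \<ge> 2"
  shows "eisenstein_point k p (mobius a b c d \<tau>) =
    (of_int c * \<tau> + of_int d) ^ k * eisenstein_point k (act_pair a b c d p) \<tau>
      + (if k = 2 then \<i> / (2 * pi) * of_int c * (of_int c * \<tau> + of_int d) else 0)"
proof (cases "p \<in> integral_pairs")
  case False
  then show ?thesis by (rule eisenstein_point_nonintegral_modular[OF assms(1,2) _ assms(3)])
next
  case True
  then have p': "act_pair a b c d p \<in> integral_pairs" using assms(1) by (simp add: act_pair_integral)
  show ?thesis
  proof (cases "even k")
    case True': True
    then obtain l where l: "k = 2 * l" by (rule evenE)
    then have "l \<ge> 1" using assms(3) by simp
    from eisenstein_modular[OF assms(1,2) this] show ?thesis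
      using True p' by (simp add: eisenstein_point_def l)
  next
    case False
    then have "k \<noteq> 2" by auto
    then show ?thesis using True p' False by (simp add: eisenstein_point_def)
  qed
qed

section \<open>Divisors modulo the lattice\<close>

lemma integral_pairs_diff: "p \<in> integral_pairs \<Longrightarrow> q \<in> integral_pairs \<Longrightarrow> p - q \<in> integral_pairs"
  by (auto simp: mem_Times_iff)

lemma integral_pairs_uminus: "- p \<in> integral_pairs \<longleftrightarrow> p \<in> integral_pairs"
  by (auto simp: mem_Times_iff)

lemma integral_pairs_diff_iff: "p - q \<in> integral_pairs \<Longrightarrow> p \<in> integral_pairs \<longleftrightarrow> q \<in> integral_pairs"
  using integral_pairs_diff[of p "p - q"] integral_pairs_diff[of "p - q" "- q"] integral_pairs_uminus[of q] by auto

text \<open>Weight k involves k - 1 >= 1 derivatives of \<theta>'/\<theta>, and these annihilate the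
  constant by which it changes under lattice translations.\<close>

lemma eisenstein_point_lattice_shift:
  assumes "\<tau> \<in> uhp" "k \<ge> 2" "p - p' \<in> integral_pairs"
  shows "eisenstein_point k p \<tau> = eisenstein_point k p' \<tau>"
proof (cases "p \<in> integral_pairs")
  case True
  then have "p' \<in> integral_pairs" using integral_pairs_diff_iff[OF assms(3)] by (simp only:)
  with True show ?thesis by (simp add: eisenstein_point_def)
next
  case False
  then have p': "p' \<notin> integral_pairs" using integral_pairs_diff_iff[OF assms(3)] by (simp only: not_False_eq_True)
  obtain l where k: "k = Suc (Suc l)" using assms(2) by (metis Suc_le_D numeral_2_eq_2 Suc_le_mono)
  obtain x y where xy: "p - p' = (of_int x, of_int y)" using assms(3) by (cases "p - p'") (auto elim!: Ints_cases)
  define c where "c = of_int x * \<tau> + of_int y"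
  have tp: "torsion_point p \<tau> = 1 * torsion_point p' \<tau> + c"
    using torsion_point_diff[of p p' \<tau>] unfolding xy torsion_point_integral c_def by simp
  let ?U = "- period_lattice \<tau>"
  let ?w = "torsion_point p' \<tau>"
  have opn: "open ?U" by (rule open_lattice_complement[OF assms(1)])
  have w: "?w \<in> ?U" using p' assms(1) by (simp add: torsion_point_in_lattice_iff)
  have sub: "1 * z + c \<in> ?U" if "z \<in> ?U" for z
  proof -
    have "(z + (of_int y + of_int x * \<tau>) \<in> period_lattice \<tau>) = (z \<in> period_lattice \<tau>)"
    proof (rule periodic_lattice)
      show "(z + 1 \<in> period_lattice \<tau>) = (z \<in> period_lattice \<tau>)" for z
        using jtheta_eq_0_iff[OF assms(1)] jtheta_plus_1[of z \<tau>] by (metis neg_equal_0_iff_equal)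
      show "(z + \<tau> \<in> period_lattice \<tau>) = (z \<in> period_lattice \<tau>)" for z
        unfolding jtheta_eq_0_iff[OF assms(1), symmetric] jtheta_plus_tau by simp
    qed
    then show ?thesis using that by (simp add: c_def add_ac)
  qed
  have hol: "theta_log \<tau> holomorphic_on ?U" by (rule theta_log_holomorphic[OF assms(1)])
  have "(deriv ^^ Suc l) (theta_log \<tau>) (torsion_point p \<tau>) = 1 ^ Suc l * (deriv ^^ Suc l) (theta_log \<tau>) (1 * ?w + c)"
    by (simp add: tp)
  also have "\<dots> = (deriv ^^ Suc l) (\<lambda>z. theta_log \<tau> (1 * z + c)) ?w"
    by (rule higher_deriv_compose_linear'[OF hol opn opn w sub, symmetric])
  also have "\<dots> = (deriv ^^ Suc l) (\<lambda>z. theta_log \<tau> z - 2 * pi * \<i> * of_int x) ?w"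
  proof (rule higher_deriv_transform_within_open[OF _ _ opn w])
    have "(\<lambda>z. 1 * z + c) holomorphic_on ?U" by (intro holomorphic_intros)
    from holomorphic_on_compose_gen[OF this hol image_subsetI[OF sub]]
    show "(\<lambda>z. theta_log \<tau> (1 * z + c)) holomorphic_on ?U" unfolding o_def .
    show "(\<lambda>z. theta_log \<tau> z - 2 * pi * \<i> * of_int x) holomorphic_on ?U" by (intro holomorphic_intros hol)
    show "theta_log \<tau> (1 * z + c) = theta_log \<tau> z - 2 * pi * \<i> * of_int x" if "z \<in> ?U" for z
      using theta_log_quasi_periodic[OF assms(1), of z x y] that by (simp add: c_def add.assoc)
  qed
  also have "\<dots> = (deriv ^^ Suc l) (theta_log \<tau>) ?w - (deriv ^^ Suc l) (\<lambda>z. 2 * pi * \<i> * of_int x) ?w"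
    by (rule higher_deriv_diff[OF hol _ opn w]) (intro holomorphic_intros)
  also have "(deriv ^^ Suc l) (\<lambda>z. 2 * pi * \<i> * of_int x) ?w = (0::complex)"
    by (simp del: funpow.simps)
  finally show ?thesis
    unfolding k eisenstein_point_nonintegral[OF assms(1) False] eisenstein_point_nonintegral[OF assms(1) p'] by simp
qed

text \<open>The coefficient of the class of p in the divisor group of the torus. This, and not
  \<open>D\<close> with its chosen representatives, is what \<phi> determines.\<close>

definition class_mult :: "(rat \<times> rat \<Rightarrow> int) \<Rightarrow> rat \<times> rat \<Rightarrow> int" where
  "class_mult D p = (\<Sum>q | D q \<noteq> 0 \<and> p - q \<in> integral_pairs. D q)"

text \<open>The summands are grouped by coset, \<open>g p\<close> being the coset of p as a set. On
  each coset \<open>H\<close> is constant and both divisors have the same total coefficient.\<close>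

lemma class_function_sum_cong:
  fixes H :: "rat \<times> rat \<Rightarrow> complex"
  assumes "finite {p. D p \<noteq> 0}" "finite {p. D' p \<noteq> 0}" "\<And>p. class_mult D p = class_mult D' p"
    and H: "\<And>p q. p - q \<in> integral_pairs \<Longrightarrow> H p = H q"
  shows "(\<Sum>p | D p \<noteq> 0. of_int (D p) * H p) = (\<Sum>p | D' p \<noteq> 0. of_int (D' p) * H p)"
proof -
  define S where "S = {p. D p \<noteq> 0} \<union> {p. D' p \<noteq> 0}"
  define g where "g = (\<lambda>p::rat \<times> rat. {q. p - q \<in> integral_pairs})"
  have fin: "finite S" using assms by (simp add: S_def)
  have g_eq: "g x = g p \<longleftrightarrow> p - x \<in> integral_pairs" for x p
  proof
    assume "g x = g p"
    moreover have "x \<in> g x" by (simp add: g_def mem_Times_iff)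
    ultimately show "p - x \<in> integral_pairs" by (simp add: g_def)
  next
    assume h: "p - x \<in> integral_pairs"
    have "x - q \<in> integral_pairs \<longleftrightarrow> p - q \<in> integral_pairs" for q
      using integral_pairs_diff_iff[of "p - q" "x - q"] h by simp
    then show "g x = g p" by (simp add: g_def)
  qed
  have "(\<Sum>p\<in>S. of_int (D p - D' p) * H p) = (\<Sum>y\<in>g ` S. \<Sum>x\<in>{x \<in> S. g x = y}. of_int (D x - D' x) * H x)"
    by (rule sum.image_gen[OF fin])
  also have "\<dots> = 0"
  proof (rule sum.neutral, rule ballI)
    fix y assume "y \<in> g ` S"
    then obtain p where p: "y = g p" by blast
    let ?C = "{x \<in> S. g x = y}"
    have "class_mult E p = (\<Sum>x\<in>?C. E x)" if "{p. E p \<noteq> 0} \<subseteq> S" for E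
      unfolding class_mult_def p g_eq using that fin by (intro sum.mono_neutral_left) auto
    then have "(\<Sum>x\<in>?C. D x) = (\<Sum>x\<in>?C. D' x)"
      using assms(3)[of p] by (auto simp: S_def)
    then have 0: "(\<Sum>x\<in>?C. D x - D' x) = 0" by (simp add: sum_subtractf)
    have "(\<Sum>x\<in>?C. of_int (D x - D' x) * H x) = (\<Sum>x\<in>?C. of_int (D x - D' x) * H p)"
      using H unfolding p g_eq by (intro sum.cong refl) (metis (mono_tags, lifting) mem_Collect_eq)
    also have "\<dots> = of_int (\<Sum>x\<in>?C. D x - D' x) * H p"
      unfolding of_int_sum sum_distrib_right ..
    finally show "(\<Sum>x\<in>?C. of_int (D x - D' x) * H x) = 0" unfolding 0 by simp
  qed
  finally have "(\<Sum>p\<in>S. of_int (D p) * H p) = (\<Sum>p\<in>S. of_int (D' p) * H p)"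
    by (simp add: left_diff_distrib sum_subtractf)
  moreover have "(\<Sum>p\<in>S. of_int (D p) * H p) = (\<Sum>p | D p \<noteq> 0. of_int (D p) * H p)"
    using fin by (intro sum.mono_neutral_right) (auto simp: S_def)
  moreover have "(\<Sum>p\<in>S. of_int (D' p) * H p) = (\<Sum>p | D' p \<noteq> 0. of_int (D' p) * H p)"
    using fin by (intro sum.mono_neutral_right) (auto simp: S_def)
  ultimately show ?thesis by simp
qed

lemma act_pair_diff: "act_pair a b c d (p - q) = act_pair a b c d p - act_pair a b c d q"
  by (simp add: act_pair_def prod_eq_iff algebra_simps)

lemma act_pair_inverse:
  assumes "a * d - b * c = 1"
  shows "act_pair d (- b) (- c) a (act_pair a b c d p) = p"
proof -
  have det: "of_int a * of_int d - of_int b * of_int c = (1::rat)"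
    using assms by (metis of_int_1 of_int_diff of_int_mult)
  have "act_pair d (- b) (- c) a (act_pair a b c d p) =
      (fst p * (of_int a * of_int d - of_int b * of_int c), snd p * (of_int a * of_int d - of_int b * of_int c))"
    by (simp add: act_pair_def algebra_simps)
  then show ?thesis unfolding det by simp
qed

text \<open>The transported divisor \<open>D'\<close> need not equal \<open>D\<close>, as the matrix
  may replace representatives by others, but its class multiplicities agree with those of
  \<open>D\<close>.\<close>

lemma class_function_sum_act:
  fixes H :: "rat \<times> rat \<Rightarrow> complex"
  assumes "finite {p. D p \<noteq> 0}" "a * d - b * c = 1"
    and inv: "\<And>p. class_mult D (act_pair a b c d p) = class_mult D p"
    and H: "\<And>p q. p - q \<in> integral_pairs \<Longrightarrow> H p = H q"
  shows "(\<Sum>p | D p \<noteq> 0. of_int (D p) * H (act_pair a b c d p)) = (\<Sum>p | D p \<noteq> 0. of_int (D p) * H p)"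
proof -
  let ?f = "act_pair a b c d" and ?g = "act_pair d (- b) (- c) a"
  have gf: "?g (?f p) = p" for p using act_pair_inverse[OF assms(2)] .
  have fg: "?f (?g p) = p" for p using act_pair_inverse[of d a "- b" "- c" p] assms(2) by (simp add: mult.commute)
  define D' where "D' = D \<circ> ?g"
  have "{p. D' p \<noteq> 0} \<subseteq> ?f ` {p. D p \<noteq> 0}"
  proof
    fix p assume "p \<in> {p. D' p \<noteq> 0}"
    then have "?g p \<in> {p. D p \<noteq> 0}" by (simp add: D'_def)
    then have "?f (?g p) \<in> ?f ` {p. D p \<noteq> 0}" by (rule imageI)
    then show "p \<in> ?f ` {p. D p \<noteq> 0}" unfolding fg .
  qed
  then have fin': "finite {p. D' p \<noteq> 0}" using assms(1) by (meson finite_imageI finite_subset)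
  have cls: "class_mult D' p = class_mult D p" for p
  proof -
    have "class_mult D' p = (\<Sum>q | D q \<noteq> 0 \<and> ?g p - q \<in> integral_pairs. D q)"
      unfolding class_mult_def
    proof (rule sum.reindex_bij_witness[where i = ?f and j = ?g], goal_cases)
      case (2 q)
      have "?f (?g p - ?g q) \<in> integral_pairs" unfolding act_pair_diff fg using 2 by simp
      then have "?g p - ?g q \<in> integral_pairs" unfolding act_pair_integral[OF assms(2)] .
      then show ?case using 2 by (simp add: D'_def)
    next
      case (4 q)
      have "?f (?g p - q) \<in> integral_pairs" unfolding act_pair_integral[OF assms(2)] using 4 by simp
      then have "p - ?f q \<in> integral_pairs" unfolding act_pair_diff fg .
      then show ?case using 4 by (simp add: D'_def gf)
    qed (simp_all add: gf fg D'_def)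
    also have "\<dots> = class_mult D (?g p)" by (simp add: class_mult_def)
    also have "\<dots> = class_mult D p" using inv[of "?g p"] by (simp add: fg)
    finally show ?thesis .
  qed
  have "(\<Sum>p | D p \<noteq> 0. of_int (D p) * H (?f p)) = (\<Sum>p | D' p \<noteq> 0. of_int (D' p) * H p)"
    by (rule sum.reindex_bij_witness[where i = ?g and j = ?f]) (auto simp: D'_def gf fg)
  also have "\<dots> = (\<Sum>p | D p \<noteq> 0. of_int (D p) * H p)"
    by (rule class_function_sum_cong[OF fin' assms(1) cls H])
  finally show ?thesis .
qed

lemma eisenstein_div_modular:
  fixes a b c d :: int
  assumes "finite {p. D p \<noteq> 0}" "a * d - b * c = 1" "\<tau> \<in> uhp" "k \<ge> 2"
    and inv: "\<And>p. class_mult D (act_pair a b c d p) = class_mult D p"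
  shows "eisenstein_div k D (mobius a b c d \<tau>) =
    (of_int c * \<tau> + of_int d) ^ k * eisenstein_div k D \<tau>
      + (if k = 2 then of_int (\<Sum>p | D p \<noteq> 0. D p) * (\<i> / (2 * pi) * of_int c * (of_int c * \<tau> + of_int d)) else 0)"
proof -
  define j where "j = of_int c * \<tau> + of_int d"
  define e where "e = (if k = 2 then \<i> / (2 * pi) * of_int c * j else 0)"
  have "eisenstein_div k D ((of_int a * \<tau> + of_int b) / j) =
      (\<Sum>p | D p \<noteq> 0. of_int (D p) * (j ^ k * eisenstein_point k (act_pair a b c d p) \<tau> + e))"
    unfolding eisenstein_div_def e_def j_def eisenstein_point_modular[OF assms(2-4)] ..
  also have "\<dots> = j ^ k * (\<Sum>p | D p \<noteq> 0. of_int (D p) * eisenstein_point k (act_pair a b c d p) \<tau>)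
      + of_int (\<Sum>p | D p \<noteq> 0. D p) * e"
    by (simp add: distrib_left sum.distrib sum_distrib_left sum_distrib_right mult.left_commute)
  also have "(\<Sum>p | D p \<noteq> 0. of_int (D p) * eisenstein_point k (act_pair a b c d p) \<tau>) = eisenstein_div k D \<tau>"
    unfolding eisenstein_div_def
    by (rule class_function_sum_act[OF assms(1,2) inv eisenstein_point_lattice_shift[OF assms(3,4)]])
  finally show ?thesis by (simp add: j_def e_def)
qed

lemma eisenstein_div_1:
  assumes "finite {p. D p \<noteq> 0}" "balanced D" "\<tau> \<in> uhp"
    and inv: "\<And>p. class_mult D (- p) = class_mult D p"
  shows "eisenstein_div 1 D \<tau> = 0"
proof -
  \<comment> \<open>subtracting \<open>\<alpha>\<close> makes \<open>G\<^sub>1\<close> elliptic, and it stays odd\<close>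
  define H where "H = (\<lambda>p. if p \<in> integral_pairs then 0 else eisenstein_point 1 p \<tau> - of_rat (fst p))"
  have e1: "eisenstein_point 1 p \<tau> = - (theta_log \<tau> (torsion_point p \<tau>) / (2 * pi * \<i>))" if "p \<notin> integral_pairs" for p
    using eisenstein_point_nonintegral[OF assms(3) that, of 0] by simp
  have Hc: "H p = H q" if pq: "p - q \<in> integral_pairs" for p q
  proof (cases "p \<in> integral_pairs")
    case True
    then show ?thesis using integral_pairs_diff_iff[OF pq] by (simp add: H_def)
  next
    case False
    then have q: "q \<notin> integral_pairs" using integral_pairs_diff_iff[OF pq] by simp
    obtain x y where xy: "p - q = (of_int x, of_int y)" using pq by (cases "p - q") (auto elim!: Ints_cases)
    have tp: "torsion_point p \<tau> = torsion_point q \<tau> + of_int x * \<tau> + of_int y"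
      using torsion_point_diff[of p q \<tau>] unfolding xy torsion_point_integral by (simp add: algebra_simps)
    have "fst p = fst q + of_int x" using arg_cong[OF xy, of fst] by (simp add: algebra_simps)
    then have fp: "(of_rat (fst p) :: complex) = of_rat (fst q) + of_int x" by (simp add: of_rat_add)
    have "theta_log \<tau> (torsion_point p \<tau>) = theta_log \<tau> (torsion_point q \<tau>) - 2 * pi * \<i> * of_int x"
      unfolding tp using q assms(3) by (intro theta_log_quasi_periodic) (auto simp: torsion_point_in_lattice_iff)
    then have "eisenstein_point 1 p \<tau> = eisenstein_point 1 q \<tau> + of_int x"
      unfolding e1[OF False] e1[OF q] by (simp add: diff_divide_distrib)
    then show ?thesis using False q fp by (simp add: H_def)
  qed
  have act: "act_pair (- 1) 0 0 (- 1) p = - p" for p by (simp add: act_pair_def prod_eq_iff)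
  have Hm: "H (- p) = - H p" for p
  proof (cases "p \<in> integral_pairs")
    case True
    then show ?thesis using integral_pairs_uminus[of p] by (simp add: H_def)
  next
    case False
    then have p': "- p \<notin> integral_pairs" using integral_pairs_uminus[of p] by simp
    have "torsion_point (- p) \<tau> = - torsion_point p \<tau>" by (simp add: torsion_point_def of_rat_minus)
    then have "eisenstein_point 1 (- p) \<tau> = - eisenstein_point 1 p \<tau>"
      unfolding e1[OF False] e1[OF p'] by (simp add: theta_log_minus[OF assms(3)])
    then show ?thesis using False p' by (simp add: H_def of_rat_minus)
  qed
  \<comment> \<open>The matrix -1 acts as p |-> -p, so an odd class function sums to its own
    negative over a symmetric divisor.\<close>
  have "(\<Sum>p | D p \<noteq> 0. of_int (D p) * H (act_pair (- 1) 0 0 (- 1) p)) = (\<Sum>p | D p \<noteq> 0. of_int (D p) * H p)"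
    by (rule class_function_sum_act[OF assms(1)]) (use inv Hc in \<open>auto simp: act\<close>)
  then have "- (\<Sum>p | D p \<noteq> 0. of_int (D p) * H p) = (\<Sum>p | D p \<noteq> 0. of_int (D p) * H p)"
    unfolding act Hm by (simp add: sum_negf)
  then have sum0: "(\<Sum>p | D p \<noteq> 0. of_int (D p) * H p) = 0" by (simp add: neg_eq_iff_add_eq_0)
  \<comment> \<open>What separates \<open>H\<close> from G_1 is \<alpha>, and only off the class of
    0, where both vanish; this is why \<open>balanced\<close> omits that class.\<close>
  let ?r = "\<lambda>p. if p \<in> integral_pairs then 0 else of_int (D p) * fst p"
  have "of_int (D p) * eisenstein_point 1 p \<tau> = of_int (D p) * H p + of_rat (?r p)" for p
    by (auto simp: H_def eisenstein_point_def of_rat_mult algebra_simps)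
  then have "eisenstein_div 1 D \<tau> = of_rat (\<Sum>p | D p \<noteq> 0. ?r p)"
    unfolding eisenstein_div_def by (simp add: sum.distrib sum0 of_rat_sum)
  also have "(\<Sum>p | D p \<noteq> 0. ?r p) = (\<Sum>p | D p \<noteq> 0 \<and> p \<notin> integral_pairs. of_int (D p) * fst p)"
    using assms(1) by (intro sum.mono_neutral_cong_right) auto
  also have "\<dots> = 0" using assms(2) by (simp add: balanced_def)
  finally show ?thesis by simp
qed

section \<open>The divisor of a Jacobi form\<close>

text \<open>The denominator may vanish identically on the slice. The quotient is then 0 on the whole
  ball, so the representation remains valid.\<close>

lemma meromorphic2_on_slice:
  assumes "meromorphic2_on (\<lambda>(z, \<tau>). \<phi> z \<tau>) (UNIV \<times> uhp)" "\<tau> \<in> uhp"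
  obtains r f g where "r > 0" "f holomorphic_on ball z r" "g holomorphic_on ball z r"
    "\<And>w. w \<in> ball z r \<Longrightarrow> \<phi> w \<tau> = f w / g w"
proof -
  have "(z, \<tau>) \<in> UNIV \<times> uhp" using assms(2) by simp
  then obtain U F G where U: "(z, \<tau>) \<in> U" "holomorphic2_on F U" "holomorphic2_on G U"
    "\<forall>y\<in>U. (case y of (z, \<tau>) \<Rightarrow> \<phi> z \<tau>) = F y / G y"
    using assms(1) unfolding meromorphic2_on_def by blast
  have "open ((\<lambda>w. (w, \<tau>)) -` U)"
    using U(2) by (intro open_vimage continuous_intros) (auto simp: holomorphic2_on_def)
  moreover have "z \<in> (\<lambda>w. (w, \<tau>)) -` U" using U(1) by simp
  ultimately obtain r where r: "r > 0" "ball z r \<subseteq> (\<lambda>w. (w, \<tau>)) -` U" using open_contains_ball by blast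
  have slice: "(\<lambda>w. K (w, \<tau>)) holomorphic_on ball z r" if K: "holomorphic2_on K U" for K
  proof (rule holomorphic_onI)
    fix w assume "w \<in> ball z r"
    then have "(w, \<tau>) \<in> U" using r by blast
    then obtain A B where "(K has_derivative (\<lambda>h. A * fst h + B * snd h)) (at (w, \<tau>))"
      using K unfolding holomorphic2_on_def by blast
    moreover have "((\<lambda>w. (w, \<tau>)) has_derivative (\<lambda>h. (h, 0))) (at w)"
      by (auto intro!: derivative_eq_intros)
    ultimately have "((\<lambda>w. K (w, \<tau>)) has_derivative (\<lambda>h. A * fst (h, 0::complex) + B * snd (h, 0::complex))) (at w)"
      using has_derivative_compose[of "\<lambda>w. (w, \<tau>)" "\<lambda>h. (h, 0)" w UNIV K] by blast
    then have "((\<lambda>w. K (w, \<tau>)) has_field_derivative A) (at w)"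
      by (simp add: has_field_derivative_def)
    then show "(\<lambda>w. K (w, \<tau>)) field_differentiable at w within ball z r"
      using field_differentiable_at_within field_differentiable_def by blast
  qed
  have "\<phi> w \<tau> = F (w, \<tau>) / G (w, \<tau>)" if "w \<in> ball z r" for w
    using U(4) r(2) that by fastforce
  with r(1) slice[OF U(2)] slice[OF U(3)] show ?thesis by (rule that)
qed

text \<open>One nonzero value gives nonvanishing in a neighbourhood; the alternative for meromorphic
  functions, zero or nonzero off a sparse set, carries this to every point.\<close>

lemma meromorphic_slice:
  assumes "meromorphic2_on (\<lambda>(z, \<tau>). \<phi> z \<tau>) (UNIV \<times> uhp)" "regular_at \<phi> \<tau>"
  shows "(\<lambda>z. \<phi> z \<tau>) meromorphic_on UNIV" "eventually (\<lambda>w. \<phi> w \<tau> \<noteq> 0) (at z)"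
proof -
  have \<tau>: "\<tau> \<in> uhp" using assms(2) by (simp add: regular_at_def)
  have "(\<lambda>z. \<phi> z \<tau>) meromorphic_on {z}" for z
  proof -
    obtain r f g where r: "r > 0" "f holomorphic_on ball z r" "g holomorphic_on ball z r"
      "\<And>w. w \<in> ball z r \<Longrightarrow> \<phi> w \<tau> = f w / g w"
      by (rule meromorphic2_on_slice[OF assms(1) \<tau>]) (rule that)
    have "f analytic_on {z}" "g analytic_on {z}"
      using r(1) holomorphic_on_imp_analytic_at[OF r(2)] holomorphic_on_imp_analytic_at[OF r(3)] by auto
    then have "(\<lambda>w. f w / g w) meromorphic_on {z}"
      by (intro meromorphic_intros analytic_on_imp_meromorphic_on)
    moreover have "eventually (\<lambda>w. f w / g w = \<phi> w \<tau>) (at z)"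
      using eventually_at_ball[OF r(1), of z UNIV] by eventually_elim (use r(4) in simp)
    ultimately show ?thesis using meromorphic_on_cong[of "{z}" "\<lambda>w. f w / g w" "\<lambda>w. \<phi> w \<tau>" "{z}"] by simp
  qed
  then show mero: "(\<lambda>z. \<phi> z \<tau>) meromorphic_on UNIV" using meromorphic_on_meromorphic_at by blast
  obtain w where w: "\<phi> w \<tau> \<noteq> 0" using assms(2) by (auto simp: regular_at_def)
  obtain r f g where r: "r > 0" "f holomorphic_on ball w r" "g holomorphic_on ball w r"
    "\<And>x. x \<in> ball w r \<Longrightarrow> \<phi> x \<tau> = f x / g x"
    by (rule meromorphic2_on_slice[OF assms(1) \<tau>]) (rule that)
  \<comment> \<open>As division by 0 gives 0, a nonzero value also shows that the denominator does
    not vanish at w, whence continuity there.\<close>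
  have fg: "f w / g w \<noteq> 0" using w r(1) r(4)[of w] by simp
  have wb: "w \<in> ball w r" using r(1) by simp
  have "isCont f w" "isCont g w"
    using wb holomorphic_on_imp_continuous_on[OF r(2)] holomorphic_on_imp_continuous_on[OF r(3)]
      continuous_on_eq_continuous_at[OF open_ball] by blast+
  then have "isCont (\<lambda>x. f x / g x) w" using fg by (intro continuous_intros) auto
  then have "eventually (\<lambda>x. f x / g x \<noteq> 0) (at w)"
    using fg tendsto_imp_eventually_ne unfolding isCont_def by blast
  moreover have "eventually (\<lambda>x. x \<in> ball w r) (at w)" using eventually_at_in_open'[OF open_ball wb] .
  ultimately have nz: "eventually (\<lambda>x. \<phi> x \<tau> \<noteq> 0) (at w)" by eventually_elim (simp add: r(4))
  have "eventually (\<lambda>z. \<phi> z \<tau> = 0) (cosparse UNIV) \<or> eventually (\<lambda>z. \<phi> z \<tau> \<noteq> 0) (cosparse UNIV)"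
    by (rule meromorphic_imp_constant_or_avoid[OF mero]) auto
  then show "eventually (\<lambda>w. \<phi> w \<tau> \<noteq> 0) (at z)"
  proof
    assume "eventually (\<lambda>z. \<phi> z \<tau> = 0) (cosparse UNIV)"
    then have "eventually (\<lambda>x. \<phi> x \<tau> = 0) (at w)" by (rule eventually_cosparse_imp_eventually_at) simp
    with nz have "eventually (\<lambda>x. False) (at w)" by eventually_elim simp
    then show ?thesis by simp
  next
    assume "eventually (\<lambda>z. \<phi> z \<tau> \<noteq> 0) (cosparse UNIV)"
    then show ?thesis by (rule eventually_cosparse_imp_eventually_at) simp
  qed
qed

lemma zorder_mult_nonzero_analytic:
  assumes "f meromorphic_on {w}" "eventually (\<lambda>z. f z \<noteq> 0) (at w)" "u analytic_on {w}" "u w \<noteq> 0"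
  shows "zorder (\<lambda>z. u z * f z) w = zorder f w"
proof -
  have "isCont u w" using assms(3) analytic_at_imp_isCont by blast
  then have "eventually (\<lambda>z. u z \<noteq> 0) (at w)"
    using assms(4) tendsto_imp_eventually_ne unfolding isCont_def by blast
  then have fr: "frequently (\<lambda>z. u z \<noteq> 0) (at w)" by (rule eventually_frequently[OF at_neq_bot])
  have "zorder u w = 0" using zorder_eq_0_iff[OF assms(3) fr] assms(4) by blast
  moreover have "zorder (\<lambda>z. u z * f z) w = zorder u w + zorder f w"
    by (intro zorder_mult analytic_on_imp_meromorphic_on assms fr eventually_frequently[OF at_neq_bot])
  ultimately show ?thesis by simp
qed

lemma class_mult_eq_divisor:
  assumes "has_torsion_divisor \<phi> D" "regular_at \<phi> \<tau>"
  shows "class_mult D p = divisor_at \<phi> \<tau> (torsion_point p \<tau>)"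
proof -
  have \<tau>: "\<tau> \<in> uhp" using assms(2) by (simp add: regular_at_def)
  have "divisor_at \<phi> \<tau> (torsion_point p \<tau>) =
     (\<Sum>q | D q \<noteq> 0 \<and> torsion_point p \<tau> - torsion_point q \<tau> \<in> period_lattice \<tau>. D q)"
    using assms unfolding has_torsion_divisor_def by blast
  then show ?thesis
    unfolding torsion_point_diff[symmetric] torsion_point_in_lattice_iff[OF \<tau>] class_mult_def by simp
qed

text \<open>The same coefficients describe the divisor at \<tau> and at \<gamma>\<tau>. The
  automorphy factor has neither zeros nor poles in z, so the order at p for \<gamma>\<tau> equals
  the order at the transformed pair for \<tau>.\<close>

lemma class_mult_act:
  fixes a b c d :: int
  assumes "meromorphic_jacobi_form k m \<phi>" "has_torsion_divisor \<phi> D" and det: "a * d - b * c = 1"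
  shows "class_mult D (act_pair a b c d p) = class_mult D p"
proof -
  obtain \<tau> where reg: "regular_at \<phi> \<tau>" using assms(2) by (auto simp: has_torsion_divisor_def)
  then have \<tau>: "\<tau> \<in> uhp" by (simp add: regular_at_def)
  have mero: "meromorphic2_on (\<lambda>(z, \<tau>). \<phi> z \<tau>) (UNIV \<times> uhp)"
    using assms(1) by (simp add: meromorphic_jacobi_form_def)
  define j where "j = of_int c * \<tau> + of_int d"
  define t where "t = (of_int a * \<tau> + of_int b) / j"
  define u where "u = (\<lambda>z. j powi k * exp (2 * pi * \<i> * m * of_int c * z\<^sup>2 / j))"
  have j0: "j \<noteq> 0" using mobius_denom_nonzero[OF det \<tau>] by (simp add: j_def)
  have t: "t \<in> uhp" using mobius_in_uhp[OF det \<tau>] by (simp add: t_def j_def)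
  have trans: "\<phi> (z / j) t = u z * \<phi> z \<tau>" for z
    using assms(1) det \<tau> unfolding meromorphic_jacobi_form_def u_def t_def j_def by blast
  have u0: "u z \<noteq> 0" for z using j0 by (simp add: u_def)
  have reg': "regular_at \<phi> t"
  proof -
    obtain z where "\<phi> z \<tau> \<noteq> 0" using reg by (auto simp: regular_at_def)
    then have "\<phi> (z / j) t \<noteq> 0" using u0 by (simp add: trans)
    then show ?thesis using t by (auto simp: regular_at_def)
  qed
  let ?w = "torsion_point (act_pair a b c d p) \<tau>"
  have ua: "u analytic_on {?w}"
    unfolding u_def by (intro holomorphic_on_imp_analytic_at[of _ UNIV] holomorphic_intros) (use j0 in auto)
  have "class_mult D p = zorder (\<lambda>z. \<phi> z t) (1 / j * ?w)"
    unfolding class_mult_eq_divisor[OF assms(2) reg'] divisor_at_def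
    using torsion_point_mobius[OF det \<tau>, of p] by (simp add: t_def j_def)
  also have "\<dots> = zorder (\<lambda>z. \<phi> (1 / j * z) t) ?w"
    by (rule zorder_scale[symmetric])
      (use j0 in \<open>auto intro: meromorphic_on_subset[OF meromorphic_slice(1)[OF mero reg']]\<close>)
  also have "\<dots> = zorder (\<lambda>z. u z * \<phi> z \<tau>) ?w" by (simp add: trans)
  also have "\<dots> = zorder (\<lambda>z. \<phi> z \<tau>) ?w"
    by (rule zorder_mult_nonzero_analytic[OF _ meromorphic_slice(2)[OF mero reg] ua u0])
      (rule meromorphic_on_subset[OF meromorphic_slice(1)[OF mero reg]], simp)
  also have "\<dots> = class_mult D (act_pair a b c d p)"
    unfolding class_mult_eq_divisor[OF assms(2) reg] divisor_at_def ..
  finally show ?thesis ..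
qed

section \<open>The degree of the divisor\<close>

text \<open>Replaces a contour integral around the period parallelogram. The logarithmic derivative
  H has period 1 and grows by B under \<tau>, so H' is elliptic and entire, hence constant, and H is
  affine. Period 1 makes its slope 0, and then B = 0.\<close>

lemma entire_quasi_periodic_multiplier:
  assumes "\<tau> \<in> uhp" "G holomorphic_on UNIV" "\<And>z. G z \<noteq> 0"
    "s \<noteq> 0" "\<And>z. G (z + 1) = s * G z" "\<And>z. G (z + \<tau>) = exp (B * z + C) * G z"
  shows "B = 0"
proof -
  define H where "H = (\<lambda>z. deriv G z / G z)"
  have G': "(G has_field_derivative deriv G z) (at z)" for z
    using assms(2) by (auto intro: holomorphic_derivI)
  have H: "H holomorphic_on UNIV"
    unfolding H_def using assms(2,3) by (intro holomorphic_intros) auto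
  have shift: "((\<lambda>z. G (z + w)) has_field_derivative deriv G (z + w)) (at z)" for z w
    using DERIV_shift[of G "deriv G (z + w)" z w] G'[of "z + w"] by simp
  have H1: "H (z + 1) = H z" for z
  proof -
    have "((\<lambda>z. s * G z) has_field_derivative deriv G (z + 1)) (at z)"
      using shift[of 1 z] unfolding assms(5) .
    moreover have "((\<lambda>z. s * G z) has_field_derivative s * deriv G z) (at z)" by (intro DERIV_cmult G')
    ultimately have "deriv G (z + 1) = s * deriv G z" by (rule DERIV_unique)
    then show ?thesis using assms(4) by (simp add: H_def assms(5))
  qed
  have H2: "H (z + \<tau>) = H z + B" for z
  proof -
    have "((\<lambda>z. exp (B * z + C) * G z) has_field_derivative deriv G (z + \<tau>)) (at z)"
      using shift[of \<tau> z] unfolding assms(6) .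
    moreover have "((\<lambda>z. exp (B * z + C) * G z) has_field_derivative exp (B * z + C) * (B * G z + deriv G z)) (at z)"
      by (auto intro!: derivative_eq_intros G' simp: algebra_simps)
    ultimately have "deriv G (z + \<tau>) = exp (B * z + C) * (B * G z + deriv G z)" by (rule DERIV_unique)
    then have "H (z + \<tau>) = (B * G z + deriv G z) / G z" unfolding H_def assms(6) by simp
    then show ?thesis using assms(3)[of z] by (simp add: H_def add_divide_distrib)
  qed
  have H': "(H has_field_derivative deriv H z) (at z)" for z
    using H by (auto intro: holomorphic_derivI)
  have shiftH: "((\<lambda>z. H (z + w)) has_field_derivative deriv H (z + w)) (at z)" for z w
    using DERIV_shift[of H "deriv H (z + w)" z w] H'[of "z + w"] by simp
  have d1: "deriv H (z + 1) = deriv H z" for z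
    using shiftH[of 1 z] H'[of z] unfolding H1 by (intro DERIV_unique)
  have d2: "deriv H (z + \<tau>) = deriv H z" for z
  proof -
    have "((\<lambda>z. H z + B) has_field_derivative deriv H (z + \<tau>)) (at z)"
      using shiftH[of \<tau> z] unfolding H2 .
    moreover have "((\<lambda>z. H z + B) has_field_derivative deriv H z) (at z)"
      by (auto intro!: derivative_eq_intros H')
    ultimately show ?thesis by (rule DERIV_unique)
  qed
  have "deriv H holomorphic_on UNIV" using H by (intro holomorphic_deriv) auto
  then obtain A where A: "\<And>z. deriv H z = A"
    using elliptic_entire_imp_constant[OF assms(1) _ d1 d2] by blast
  have "((\<lambda>z. H z - A * z) has_field_derivative 0) (at z)" for z
    using H'[of z] unfolding A by (auto intro!: derivative_eq_intros)
  then have "\<exists>K. \<forall>z\<in>UNIV. H z - A * z = K"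
    by (intro has_field_derivative_zero_constant) auto
  then obtain K where K: "\<And>z. H z = A * z + K" by (auto simp: algebra_simps)
  have "A = 0" using H1[of 0] unfolding K by simp
  then show ?thesis using H2[of 0] unfolding K by simp
qed

lemma zorder_jtheta_shift:
  assumes "\<tau> \<in> uhp"
  shows "zorder (\<lambda>z. jtheta (z - p) \<tau>) w = (if w - p \<in> period_lattice \<tau> then 1 else 0)"
    and "(\<lambda>z. jtheta (z - p) \<tau>) meromorphic_on {w}"
    and "eventually (\<lambda>z. jtheta (z - p) \<tau> \<noteq> 0) (at w)"
proof -
  let ?f = "\<lambda>z. jtheta (z - p) \<tau>"
  have "(?f has_field_derivative theta_d 1 (z - p) \<tau> * 1) (at z)" for z
    by (intro DERIV_chain2[OF jtheta_has_derivative[OF assms]]) (auto intro!: derivative_eq_intros)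
  then have d: "(?f has_field_derivative theta_d 1 (z - p) \<tau>) (at z)" for z by simp
  then have hol: "?f holomorphic_on UNIV"
    by (auto simp: holomorphic_on_def field_differentiable_def intro: field_differentiable_at_within)
  then have ana: "?f analytic_on {w}" by (intro holomorphic_on_imp_analytic_at[of _ UNIV]) auto
  then show "?f meromorphic_on {w}" by (rule analytic_on_imp_meromorphic_on)
  obtain y where "jtheta y \<tau> \<noteq> 0" using jtheta_nonzero[OF assms] .
  then have "?f (y + p) \<noteq> 0" by simp
  then show ev: "eventually (\<lambda>z. ?f z \<noteq> 0) (at w)"
    using non_zero_neighbour_alt[OF hol, of w "y + p"] by (auto elim: eventually_mono)
  show "zorder ?f w = (if w - p \<in> period_lattice \<tau> then 1 else 0)"
  proof (cases "w - p \<in> period_lattice \<tau>")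
    case True
    then obtain a b where ab: "w - p = of_int a + of_int b * \<tau>" by (auto simp: period_lattice_def)
    have "theta_d 1 (w - p) \<tau> \<noteq> 0"
    proof
      assume z: "theta_d 1 (w - p) \<tau> = 0"
      let ?e = "\<lambda>z. exp (pi * \<i> * (of_int b + of_int a) - pi * \<i> * (of_int b)\<^sup>2 * \<tau> - 2 * pi * \<i> * of_int b * z)"
      have "((\<lambda>z. jtheta (z + of_int b * \<tau> + of_int a) \<tau>) has_field_derivative theta_d 1 (0 + of_int b * \<tau> + of_int a) \<tau> * 1) (at 0)"
        by (intro DERIV_chain2[OF jtheta_has_derivative[OF assms]]) (auto intro!: derivative_eq_intros)
      moreover have "((\<lambda>z. ?e z * jtheta z \<tau>) has_field_derivative ?e 0 * theta_d 1 0 \<tau>) (at 0)"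
        by (auto intro!: derivative_eq_intros jtheta_has_derivative[OF assms] simp: jtheta_0)
      ultimately have "theta_d 1 (0 + of_int b * \<tau> + of_int a) \<tau> * 1 = ?e 0 * theta_d 1 0 \<tau>"
        unfolding jtheta_quasi_periodic by (rule DERIV_unique)
      then show False using z theta_d_1_0_nonzero[OF assms] by (simp add: ab add.commute)
    qed
    then have "deriv ?f w \<noteq> 0" using DERIV_imp_deriv[OF d, of w] by simp
    moreover have "?f w = 0" using True jtheta_eq_0_iff[OF assms] by simp
    ultimately have "zorder ?f w = 1" by (intro zorder_zero_eqI'[OF ana]) auto
    with True show ?thesis by simp
  next
    case False
    then have "?f w \<noteq> 0" using jtheta_eq_0_iff[OF assms] by simp
    then have "zorder ?f w = 0"
      using zorder_eq_0_iff[OF ana eventually_frequently[OF at_neq_bot ev]] by blast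
    with False show ?thesis by simp
  qed
qed

lemma remove_sings_zorder_0:
  assumes "g meromorphic_on {z}" "eventually (\<lambda>w. g w \<noteq> 0) (at z)" "zorder g z = 0"
  shows "g \<midarrow>z\<rightarrow> remove_sings g z" "remove_sings g z \<noteq> 0" "remove_sings g analytic_on {z}"
proof -
  have iso: "isolated_singularity_at g z" "not_essential g z"
    using assms(1) by (auto simp: meromorphic_at_iff)
  have "\<exists>\<^sub>F w in at z. g w \<noteq> 0" using assms(2) eventually_frequently at_neq_bot by blast
  from zorder_exist[OF iso this] obtain r where r: "zor_poly g z z \<noteq> 0" "r > 0" "zor_poly g z holomorphic_on cball z r"
    "\<forall>w\<in>cball z r - {z}. g w = zor_poly g z w * (w - z) powi zorder g z \<and> zor_poly g z w \<noteq> 0" by blast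
  have "isCont (zor_poly g z) z"
    using r(2) continuous_on_interior[OF holomorphic_on_imp_continuous_on[OF r(3)], of z] by simp
  then have "zor_poly g z \<midarrow>z\<rightarrow> zor_poly g z z" by (simp add: isCont_def)
  moreover have "eventually (\<lambda>w. zor_poly g z w = g w) (at z)"
    using eventually_at_ball'[OF r(2), of z UNIV] by eventually_elim (use r(4) assms(3) in auto)
  ultimately have lim: "g \<midarrow>z\<rightarrow> zor_poly g z z" by (rule Lim_transform_eventually)
  then have "remove_sings g z = zor_poly g z z" by (rule remove_sings_eqI)
  with lim r(1) show "g \<midarrow>z\<rightarrow> remove_sings g z" "remove_sings g z \<noteq> 0" by simp_all
  show "remove_sings g analytic_on {z}" by (rule remove_sings_analytic_at[OF iso(1) lim])
qed

text \<open>Under z |-> z + \<tau> a factor \<theta>(z - w) to the power - D p contributes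
  exp(2\<pi>i (D p) z), and \<phi> contributes exp(- 4\<pi>i m z), up to factors independent of z.
  So the multiplier of the quotient has linear coefficient 2\<pi>i (N - 2m), which must
  vanish.\<close>

lemma torsion_divisor_degree:
  assumes "meromorphic_jacobi_form k m \<phi>" "has_torsion_divisor \<phi> D"
  shows "(of_int (\<Sum>p | D p \<noteq> 0. D p) :: complex) = 2 * of_real m"
proof -
  obtain \<tau> where reg: "regular_at \<phi> \<tau>" using assms(2) by (auto simp: has_torsion_divisor_def)
  then have \<tau>: "\<tau> \<in> uhp" by (simp add: regular_at_def)
  have mero: "meromorphic2_on (\<lambda>(z, \<tau>). \<phi> z \<tau>) (UNIV \<times> uhp)"
    using assms(1) by (simp add: meromorphic_jacobi_form_def)
  have fin: "finite {p. D p \<noteq> 0}" using assms(2) by (simp add: has_torsion_divisor_def)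
  obtain \<epsilon> :: int where quasi: "\<And>l \<mu> :: int. \<And>z. \<phi> (z + of_int l * \<tau> + of_int \<mu>) \<tau> =
        (-1) powi (\<lfloor>2 * m\<rfloor> * \<mu> + l * \<epsilon>)
          * exp (- 2 * pi * \<i> * m * ((of_int l)\<^sup>2 * \<tau> + 2 * of_int l * z)) * \<phi> z \<tau>"
    using assms(1) \<tau> unfolding meromorphic_jacobi_form_def by blast
  let ?S = "{p. D p \<noteq> 0}"
  let ?t = "\<lambda>p. torsion_point p \<tau>"
  define T where "T = (\<lambda>p z. jtheta (z - ?t p) \<tau> powi (- D p))"
  define g where "g = (\<lambda>z. \<phi> z \<tau> * (\<Prod>p\<in>?S. T p z))"
  have T_mero: "T p meromorphic_on {w}" for p w
    unfolding T_def by (intro meromorphic_intros zorder_jtheta_shift(2)[OF \<tau>])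
  have T_ord: "zorder (T p) w = (if w - ?t p \<in> period_lattice \<tau> then - D p else 0)" for p w
    unfolding T_def
    by (subst zorder_power_int[OF zorder_jtheta_shift(2)[OF \<tau>]
          eventually_frequently[OF at_neq_bot zorder_jtheta_shift(3)[OF \<tau>]]])
      (simp add: zorder_jtheta_shift(1)[OF \<tau>])
  have T_nz: "eventually (\<lambda>z. T p z \<noteq> 0) (at w)" for p w
    using zorder_jtheta_shift(3)[OF \<tau>, of "?t p" w] by eventually_elim (simp add: T_def)
  have P_nz: "eventually (\<lambda>z. (\<Prod>p\<in>?S. T p z) \<noteq> 0) (at w)" for w
  proof -
    have "eventually (\<lambda>z. \<forall>p\<in>?S. T p z \<noteq> 0) (at w)"
      using T_nz by (intro eventually_ball_finite[OF fin]) auto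
    then show ?thesis
    proof eventually_elim
      case (elim z)
      then show ?case unfolding prod_zero_iff[OF fin] by blast
    qed
  qed
  have P_mero: "(\<lambda>z. \<Prod>p\<in>?S. T p z) meromorphic_on {w}" for w
    by (intro meromorphic_intros T_mero)
  have f_mero: "(\<lambda>z. \<phi> z \<tau>) meromorphic_on {w}" for w
    by (rule meromorphic_on_subset[OF meromorphic_slice(1)[OF mero reg]]) simp
  have f_nz: "eventually (\<lambda>z. \<phi> z \<tau> \<noteq> 0) (at w)" for w
    by (rule meromorphic_slice(2)[OF mero reg])
  have g_mero: "g meromorphic_on {w}" for w
    unfolding g_def by (intro meromorphic_intros f_mero T_mero)
  have g_nz: "eventually (\<lambda>z. g z \<noteq> 0) (at w)" for w
    using f_nz[of w] P_nz[of w] by eventually_elim (simp add: g_def)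
  have g_ord: "zorder g w = 0" for w
  proof -
    have "zorder g w = zorder (\<lambda>z. \<phi> z \<tau>) w + zorder (\<lambda>z. \<Prod>p\<in>?S. T p z) w"
      unfolding g_def by (intro zorder_mult f_mero P_mero eventually_frequently[OF at_neq_bot] f_nz P_nz)
    also have "zorder (\<lambda>z. \<phi> z \<tau>) w = (\<Sum>p | D p \<noteq> 0 \<and> w - ?t p \<in> period_lattice \<tau>. D p)"
      using assms(2) reg unfolding has_torsion_divisor_def divisor_at_def by blast
    also have "\<dots> = (\<Sum>p\<in>?S. if w - ?t p \<in> period_lattice \<tau> then D p else 0)"
      using fin by (intro sum.mono_neutral_cong_left) auto
    also have "zorder (\<lambda>z. \<Prod>p\<in>?S. T p z) w = (\<Sum>p\<in>?S. zorder (T p) w)"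
      by (rule zorder_prod[OF T_mero P_nz])
    also have "\<dots> = (\<Sum>p\<in>?S. if w - ?t p \<in> period_lattice \<tau> then - D p else 0)"
      unfolding T_ord ..
    finally show ?thesis by (simp add: sum.distrib[symmetric] if_distrib cong: if_cong)
  qed
  define G where "G = remove_sings g"
  have G: "g \<midarrow>z\<rightarrow> G z" "G z \<noteq> 0" "G analytic_on {z}" for z
    unfolding G_def using remove_sings_zorder_0[OF g_mero g_nz g_ord] by blast+
  have G_hol: "G holomorphic_on UNIV" using G(3) analytic_on_analytic_at analytic_imp_holomorphic by blast
  \<comment> \<open>At zeros and poles of its factors the value of g is a convention. The extension
    inherits the quasi-periods through limits, for which continuity of the multiplier
    suffices.\<close>
  have G_quasi: "G (z + w) = u z * G z" if "\<And>z. g (z + w) = u z * g z" "isCont u z" for u w z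
  proof -
    have "(\<lambda>x. g (x + w)) \<midarrow>z + w - w\<rightarrow> G (z + w)" by (rule LIM_offset[OF G(1)])
    then have "(\<lambda>x. u x * g x) \<midarrow>z\<rightarrow> G (z + w)" unfolding that(1) by simp
    moreover have "(\<lambda>x. u x * g x) \<midarrow>z\<rightarrow> u z * G z"
      using that(2) G(1) unfolding isCont_def by (intro tendsto_mult)
    ultimately show ?thesis by (rule LIM_unique)
  qed
  define s where "s = ((-1) powi \<lfloor>2 * m\<rfloor> * (\<Prod>p\<in>?S. (- 1) powi (- D p)) :: complex)"
  have s0: "s \<noteq> 0" using fin by (simp add: s_def)
  have g1: "g (z + 1) = s * g z" for z
  proof -
    have "\<phi> (z + 1) \<tau> = (-1) powi \<lfloor>2 * m\<rfloor> * \<phi> z \<tau>" using quasi[of z 0 1] by simp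
    moreover have "T p (z + 1) = (- 1) powi (- D p) * T p z" for p
    proof -
      have "jtheta (z + 1 - ?t p) \<tau> = (- 1) * jtheta (z - ?t p) \<tau>"
        using jtheta_plus_1[of "z - ?t p" \<tau>] by (simp add: algebra_simps)
      then show ?thesis unfolding T_def by (simp only: power_int_mult_distrib)
    qed
    ultimately show ?thesis by (simp add: g_def s_def prod.distrib mult_ac)
  qed
  \<comment> \<open>The part of the exponent of the multiplier of \<theta>(z - w) that does not
    depend on z; \<pi>i encodes the sign -1.\<close>
  define c where "c = (\<lambda>p. pi * \<i> + 2 * pi * \<i> * ?t p - pi * \<i> * \<tau>)"
  define N where "N = (of_int (\<Sum>p\<in>?S. D p) :: complex)"
  let ?c = "\<Sum>p\<in>?S. of_int (D p) * c p"
  define C where "C = pi * \<i> * of_int \<epsilon> - 2 * pi * \<i> * m * \<tau> - ?c"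
  have g2: "g (z + \<tau>) = exp (2 * pi * \<i> * (N - 2 * m) * z + C) * g z" for z
  proof -
    let ?E = "exp (pi * \<i> * of_int \<epsilon> + - 2 * pi * \<i> * m * (\<tau> + 2 * z))"
    have "(-1) powi \<epsilon> = exp (pi * \<i> * of_int \<epsilon>)"
      by (metis exp_pi_i exp_power_int mult.commute)
    then have "\<phi> (z + \<tau>) \<tau> = ?E * \<phi> z \<tau>"
      using quasi[of z 1 0] unfolding exp_add by simp
    moreover have "T p (z + \<tau>) = exp (- of_int (D p) * (- 2 * pi * \<i> * z + c p)) * T p z" for p
    proof -
      have "jtheta (z - ?t p + \<tau>) \<tau> = exp (pi * \<i>) * exp (- 2 * pi * \<i> * (z - ?t p) - pi * \<i> * \<tau>) * jtheta (z - ?t p) \<tau>"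
        unfolding jtheta_plus_tau by simp
      also have "exp (pi * \<i>) * exp (- 2 * pi * \<i> * (z - ?t p) - pi * \<i> * \<tau>) = exp (- 2 * pi * \<i> * z + c p)"
        unfolding exp_add[symmetric] by (rule arg_cong[where f = exp]) (simp add: c_def algebra_simps)
      finally have "jtheta (z + \<tau> - ?t p) \<tau> = exp (- 2 * pi * \<i> * z + c p) * jtheta (z - ?t p) \<tau>"
        by (simp add: algebra_simps)
      then have "T p (z + \<tau>) = exp (- 2 * pi * \<i> * z + c p) powi (- D p) * T p z"
        unfolding T_def by (simp only: power_int_mult_distrib)
      also have "exp (- 2 * pi * \<i> * z + c p) powi (- D p) = exp (of_int (- D p) * (- 2 * pi * \<i> * z + c p))"
        by (rule exp_power_int)
      finally show ?thesis by simp
    qed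
    ultimately have "g (z + \<tau>) = ?E
        * exp (\<Sum>p\<in>?S. - of_int (D p) * (- 2 * pi * \<i> * z + c p)) * g z"
      unfolding exp_sum[OF fin] by (simp add: g_def prod.distrib mult_ac)
    also have "(\<Sum>p\<in>?S. - of_int (D p) * (- 2 * pi * \<i> * z + c p)) = (\<Sum>p\<in>?S. of_int (D p) * (2 * pi * \<i> * z) - of_int (D p) * c p)"
      by (intro sum.cong refl) (simp add: algebra_simps)
    also have "\<dots> = N * (2 * pi * \<i> * z) - ?c"
      unfolding N_def sum_subtractf of_int_sum sum_distrib_right ..
    also have "?E * exp (N * (2 * pi * \<i> * z) - ?c)
       = exp (2 * pi * \<i> * (N - 2 * m) * z + C)"
      unfolding exp_add[symmetric] by (rule arg_cong[where f = exp]) (simp add: C_def algebra_simps)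
    finally show ?thesis .
  qed
  have "2 * pi * \<i> * (N - 2 * m) = 0"
  proof (rule entire_quasi_periodic_multiplier[OF \<tau> G_hol G(2) s0])
    show "G (z + 1) = s * G z" for z using g1 by (rule G_quasi) simp
    show "G (z + \<tau>) = exp (2 * pi * \<i> * (N - 2 * m) * z + C) * G z" for z
      using g2 by (rule G_quasi) (intro continuous_intros)
  qed
  then show ?thesis by (simp add: N_def)
qed

section \<open>Almost holomorphic expansions\<close>

text \<open>By the identity theorem along the line \<open>Im s = v\<close>, the coefficient functions satisfy the relation
  for all \<open>v > 0\<close> independently of \<open>\<tau>\<close>; then let \<open>v\<close> tend to infinity.\<close>

lemma ah_expansion_constant_term_unique:
  assumes "ah_expansion f N c" "ah_expansion f N' c'" "\<tau> \<in> uhp"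
  shows "c 0 \<tau> = c' 0 \<tau>"
proof -
  define F where "F = (\<lambda>(v::real) s. (\<Sum>j\<le>N. c j s / of_real v ^ j) - (\<Sum>j\<le>N'. c' j s / of_real v ^ j))"
  have zero: "F v \<tau> = 0" if v: "v > 0" for v
  proof (rule analytic_continuation[of "F v" uhp "{s. Im s = v}" "\<i> * of_real v"])
    show "F v holomorphic_on uhp"
      unfolding F_def using assms(1,2) v by (intro holomorphic_intros) (auto simp: ah_expansion_def)
    show "open uhp" unfolding uhp_def by (rule open_halfspace_Im_gt)
    show "connected uhp" unfolding uhp_def by (intro convex_connected convex_halfspace_Im_gt)
    show "{s. Im s = v} \<subseteq> uhp" "\<i> * of_real v \<in> uhp" using v by (auto simp: uhp_def)
    show "\<i> * of_real v islimpt {s. Im s = v}"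
      unfolding islimpt_approachable
    proof (intro allI impI)
      fix e :: real assume e: "e > 0"
      show "\<exists>x'\<in>{s. Im s = v}. x' \<noteq> \<i> * of_real v \<and> dist x' (\<i> * of_real v) < e"
        using e by (intro bexI[of _ "of_real (e / 2) + \<i> * of_real v"]) (auto simp: dist_norm complex_eq_iff norm_divide)
    qed
    show "F v s = 0" if "s \<in> {s. Im s = v}" for s
    proof -
      have "s \<in> uhp" "Im s = v" using that v by (auto simp: uhp_def)
      then have "f s = (\<Sum>j\<le>N. c j s / of_real v ^ j)" "f s = (\<Sum>j\<le>N'. c' j s / of_real v ^ j)"
        using assms(1,2) unfolding ah_expansion_def by auto
      then show ?thesis by (simp add: F_def)
    qed
  qed (rule assms(3))
  have lim: "(\<lambda>n. \<Sum>j\<le>M. d j \<tau> / of_real (real (Suc n)) ^ j) \<longlonglongrightarrow> d 0 \<tau>" for M :: nat and d :: "nat \<Rightarrow> complex \<Rightarrow> complex"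
  proof -
    have inv: "(\<lambda>n. inverse (of_nat (Suc n)) :: complex) \<longlonglongrightarrow> 0"
      by (rule LIMSEQ_Suc[OF lim_inverse_n])
    have "(\<lambda>n. \<Sum>j\<le>M. d j \<tau> * inverse (of_nat (Suc n)) ^ j) \<longlonglongrightarrow> (\<Sum>j\<le>M. d j \<tau> * 0 ^ j)"
      by (intro tendsto_sum tendsto_mult tendsto_const tendsto_power inv)
    moreover have "(\<Sum>j\<le>M. d j \<tau> * 0 ^ j) = (\<Sum>j\<in>{0}. d j \<tau> * 0 ^ j)"
      by (intro sum.mono_neutral_right) auto
    ultimately show ?thesis by (simp add: divide_inverse power_inverse)
  qed
  have "(\<lambda>n. F (real (Suc n)) \<tau>) \<longlonglongrightarrow> c 0 \<tau> - c' 0 \<tau>"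
    unfolding F_def by (intro tendsto_diff lim)
  moreover have "F (real (Suc n)) \<tau> = 0" for n by (rule zero) simp
  ultimately have "(\<lambda>n::nat. 0) \<longlonglongrightarrow> c 0 \<tau> - c' 0 \<tau>" by simp
  then show ?thesis using LIMSEQ_unique[OF tendsto_const] by fastforce
qed

lemma ah_limit_eq:
  assumes "ah_expansion f N c" "\<tau> \<in> uhp"
  shows "ah_limit f \<tau> = c 0 \<tau>"
  unfolding ah_limit_def
proof (rule the_equality)
  show "\<exists>N c'. ah_expansion f N c' \<and> c' 0 \<tau> = c 0 \<tau>" using assms(1) by blast
  show "x = c 0 \<tau>" if "\<exists>N c'. ah_expansion f N c' \<and> c' 0 \<tau> = x" for x
    using that ah_expansion_constant_term_unique[OF _ assms] by blast
qed

text \<open>Holomorphic coefficients are annihilated, and v has derivative i/2 with respect to the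
  conjugate of \<tau>, so v^(-j) is lowered to - j v^(1-j). For j = 0 the truncated exponent
  \<open>j - 1\<close> is harmless, since the factor j vanishes.\<close>

lemma lowering_ah_expansion:
  assumes "ah_expansion f N c" "\<tau> \<in> uhp"
  shows "lowering f \<tau> = - (\<Sum>j\<le>N. of_nat j * c j \<tau> / of_real (Im \<tau>) ^ (j - 1))"
proof -
  define v where "v = Im \<tau>"
  have v: "v > 0" using assms(2) by (simp add: v_def uhp_def)
  have opn: "open uhp" unfolding uhp_def by (rule open_halfspace_Im_gt)
  let ?F = "\<lambda>j h. deriv (c j) \<tau> * h / of_real v ^ j - of_nat j * c j \<tau> * of_real (Im h) / of_real v ^ Suc j"
  have term_deriv: "((\<lambda>s. c j s / of_real (Im s) ^ j) has_derivative ?F j) (at \<tau>)" if "j \<le> N" for j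
  proof -
    have "(c j has_field_derivative deriv (c j) \<tau>) (at \<tau>)"
      using assms that opn by (auto simp: ah_expansion_def intro: holomorphic_derivI)
    then have 1: "(c j has_derivative (\<lambda>h. deriv (c j) \<tau> * h)) (at \<tau>)" by (simp add: has_field_derivative_def)
    have 2: "((\<lambda>s. complex_of_real (inverse (Im s) ^ j)) has_derivative
        (\<lambda>h. of_real (of_nat j * (- (inverse v * Im h * inverse v)) * inverse v ^ (j - 1)))) (at \<tau>)"
      using v by (auto intro!: derivative_eq_intros simp: v_def)
    have "((\<lambda>s. c j s * complex_of_real (inverse (Im s) ^ j)) has_derivative
       (\<lambda>h. c j \<tau> * of_real (of_nat j * (- (inverse v * Im h * inverse v)) * inverse v ^ (j - 1))
          + deriv (c j) \<tau> * h * of_real (inverse (Im \<tau>) ^ j))) (at \<tau>)"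
      by (rule has_derivative_mult[OF 1 2])
    moreover have "c j \<tau> * of_real (of_nat j * (- (inverse v * Im h * inverse v)) * inverse v ^ (j - 1))
          + deriv (c j) \<tau> * h * of_real (inverse (Im \<tau>) ^ j) = ?F j h" for h
      using v by (cases j) (simp_all add: v_def field_simps power_inverse)
    ultimately show ?thesis by (simp add: divide_inverse power_inverse)
  qed
  have D: "((\<lambda>s. \<Sum>j\<le>N. c j s / of_real (Im s) ^ j) has_derivative (\<lambda>h. \<Sum>j\<le>N. ?F j h)) (at \<tau>)"
    by (intro has_derivative_sum term_deriv) auto
  have "eventually (\<lambda>s. s \<in> uhp) (at \<tau>)" using eventually_at_in_open'[OF opn assms(2)] .
  then have ev: "eventually (\<lambda>s. (\<Sum>j\<le>N. c j s / of_real (Im s) ^ j) = f s) (at \<tau>)"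
    by eventually_elim (use assms(1) in \<open>auto simp: ah_expansion_def\<close>)
  have eq: "(\<Sum>j\<le>N. c j \<tau> / of_real (Im \<tau>) ^ j) = f \<tau>" using assms by (auto simp: ah_expansion_def)
  have "(f has_derivative (\<lambda>h. \<Sum>j\<le>N. ?F j h)) (at \<tau>)"
    by (rule has_derivative_transform_eventually[OF D ev eq]) simp
  then have wb: "wirtinger_bar f \<tau> = ((\<Sum>j\<le>N. ?F j 1) + \<i> * (\<Sum>j\<le>N. ?F j \<i>)) / 2"
    unfolding wirtinger_bar_def by (simp only: frechet_derivative_at[symmetric])
  have "lowering f \<tau> = - \<i> * of_real v ^ 2 * ((\<Sum>j\<le>N. ?F j 1) + \<i> * (\<Sum>j\<le>N. ?F j \<i>))"
    unfolding lowering_def wb v_def[symmetric] by simp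
  also have "\<dots> = (\<Sum>j\<le>N. - \<i> * of_real v ^ 2 * (?F j 1 + \<i> * ?F j \<i>))"
    by (simp only: sum_distrib_left sum.distrib distrib_left)
  also have "\<dots> = (\<Sum>j\<le>N. - (of_nat j * c j \<tau> / of_real v ^ (j - 1)))"
  proof (intro sum.cong refl)
    fix j
    show "- \<i> * of_real v ^ 2 * (?F j 1 + \<i> * ?F j \<i>) = - (of_nat j * c j \<tau> / of_real v ^ (j - 1))"
    proof (cases j)
      case (Suc l)
      have "?F j 1 + \<i> * ?F j \<i> = - (\<i> * (of_nat j * c j \<tau> / of_real v ^ Suc j))"
        by (simp add: algebra_simps)
      then show ?thesis using v by (simp add: Suc power2_eq_square)
    qed (simp add: algebra_simps)
  qed
  finally show ?thesis by (simp add: sum_negf v_def)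
qed

section \<open>Expansion and modularity of the completed trace\<close>

lemma partition_trace_holomorphic: "partition_trace n D \<psi> holomorphic_on uhp"
proof -
  have "(\<lambda>\<tau>. \<Sum>\<nu>\<in>partitions_of n. \<psi> n \<nu> * (\<Prod>j\<in>{1..n}. eisenstein_div j D \<tau> ^ \<nu> j)) holomorphic_on uhp"
    by (intro holomorphic_intros eisenstein_div_holomorphic) auto
  then show ?thesis by (simp add: partition_trace_def[abs_def] eisenstein_partition_def)
qed

definition trace_coeff :: "real \<Rightarrow> int \<Rightarrow> nat \<Rightarrow> (rat \<times> rat \<Rightarrow> int) \<Rightarrow> nat \<Rightarrow> complex \<Rightarrow> complex" where
  "trace_coeff m a n D j \<tau> = of_real (pi * m) ^ j / fact j * (2 * pi * \<i>) powi (int n - 2 * int j + a)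
     * partition_trace (n - 2 * j) D psi_J \<tau>"

lemma completed_trace_expansion:
  "ah_expansion (completed_trace m a n D psi_J) (n div 2) (trace_coeff m a n D)"
proof -
  have "trace_coeff m a n D j holomorphic_on uhp" for j
    unfolding trace_coeff_def[abs_def] by (intro holomorphic_intros partition_trace_holomorphic)
  moreover have "completed_trace m a n D psi_J \<tau> = (\<Sum>j\<le>n div 2. trace_coeff m a n D j \<tau> / of_real (Im \<tau>) ^ j)" for \<tau>
    unfolding completed_trace_def trace_coeff_def atLeast0AtMost
    by (intro sum.cong refl) (simp add: power_divide)
  ultimately show ?thesis by (simp add: ah_expansion_def)
qed

text \<open>The correction y = m/(2\<pi>v) of G_2 is the solution of (2\<pi>i)^2 (- y/2) = \<pi>m/v.
  The square of 2\<pi>i is what lowers its exponent by 2j in the j-th term.\<close>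

lemma completed_trace_eq_trace_poly:
  fixes D :: "rat \<times> rat \<Rightarrow> int" and m :: real and \<tau> :: complex
  defines "g \<equiv> \<lambda>j. eisenstein_div j D \<tau>"
  shows "completed_trace m a n D psi_J \<tau> =
    (2 * pi * \<i>) powi (int n + a) * trace_poly n (g(2 := g 2 + of_real (m / (2 * pi * Im \<tau>))))"
proof -
  define x where "x = 2 * pi * \<i>"
  define y where "y = complex_of_real (m / (2 * pi * Im \<tau>))"
  have x0: "x \<noteq> 0" by (simp add: x_def)
  have xy: "x\<^sup>2 * (- y / 2) = of_real (pi * m / Im \<tau>)"
    by (cases "Im \<tau> = 0") (simp_all add: x_def y_def power2_eq_square field_simps)
  have "x powi (int n + a) * ((- y / 2) ^ j / fact j * trace_poly (n - 2 * j) g) =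
      of_real (pi * m / Im \<tau>) ^ j / fact j * x powi (int n - 2 * int j + a) * trace_poly (n - 2 * j) g" for j
  proof -
    have "int n + a = (int n - 2 * int j + a) + int (2 * j)" by simp
    then have "x powi (int n + a) = x powi (int n - 2 * int j + a) * (x\<^sup>2) ^ j"
      by (simp only: power_int_add[OF disjI1[OF x0]] power_int_of_nat power_mult)
    then show ?thesis unfolding xy[symmetric] power_mult_distrib by simp
  qed
  note key = this
  have "completed_trace m a n D psi_J \<tau> = (\<Sum>j\<in>{0..n div 2}. of_real (pi * m / Im \<tau>) ^ j / fact j *
      x powi (int n - 2 * int j + a) * trace_poly (n - 2 * j) g)"
    by (simp add: completed_trace_def partition_trace_eq x_def g_def)
  also have "\<dots> = (\<Sum>j\<in>{0..n div 2}. x powi (int n + a) * ((- y / 2) ^ j / fact j * trace_poly (n - 2 * j) g))"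
    by (intro sum.cong refl key[symmetric])
  also have "\<dots> = x powi (int n + a) * trace_poly n (g(2 := g 2 + y))"
    unfolding trace_poly_shift sum_distrib_left ..
  finally show ?thesis unfolding x_def y_def .
qed

lemma completed_trace_modular:
  fixes a' b c d :: int
  assumes jacobi: "meromorphic_jacobi_form k m \<phi>" and divisor: "has_torsion_divisor \<phi> D" and balanced: "balanced D"
    and det: "a' * d - b * c = 1" and \<tau>: "\<tau> \<in> uhp"
  shows "completed_trace m a n D psi_J (mobius a' b c d \<tau>) =
    (of_int c * \<tau> + of_int d) powi (int n) * completed_trace m a n D psi_J \<tau>"
proof -
  define j where "j = of_int c * \<tau> + of_int d"
  define t where "t = (of_int a' * \<tau> + of_int b) / j"
  define h where "h = (\<lambda>s. (\<lambda>i. eisenstein_div i D s)(2 := eisenstein_div 2 D s + of_real (m / (2 * pi * Im s))))"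
  have j0: "j \<noteq> 0" using mobius_denom_nonzero[OF det \<tau>] by (simp add: j_def)
  have t: "t \<in> uhp" using mobius_in_uhp[OF det \<tau>] by (simp add: t_def j_def)
  have v: "Im \<tau> > 0" using \<tau> by (simp add: uhp_def)
  have fin: "finite {p. D p \<noteq> 0}" using divisor by (simp add: has_torsion_divisor_def)
  have inv: "class_mult D (act_pair a b c d p) = class_mult D p" if "a * d - b * c = 1" for a b c d p
    by (rule class_mult_act[OF jacobi divisor that])
  have "class_mult D (- p) = class_mult D p" for p
    using inv[of "-1" "-1" 0 0 p] by (simp add: act_pair_def uminus_prod_def)
  note G1 = eisenstein_div_1[OF fin balanced _ this]
  have mod: "h t i = j ^ i * h \<tau> i" if i: "i \<ge> 1" for i
  proof -
    consider "i = 1" | "i = 2" | "i \<ge> 3" using i by linarith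
    then show ?thesis
    proof cases
      case 1
      then show ?thesis using G1[OF \<tau>] G1[OF t] by (simp add: h_def)
    next
      case 3
      then show ?thesis
        using eisenstein_div_modular[OF fin det \<tau> _ inv[OF det], of i] by (simp add: h_def t_def j_def)
    next
      case 2
      have Im_t: "complex_of_real (m / (2 * pi * Im t)) = of_real m * (j * cnj j) / (2 * pi * of_real (Im \<tau>))"
        unfolding t_def j_def Im_mobius[OF det] complex_norm_square[symmetric] using v by simp
      \<comment> \<open>Here 1 / Im(\<gamma>\<tau>) = j cnj(j) / v, and replacing cnj(j) by j
        produces the term - 2i c j. Multiplied by m/(2\<pi>) it cancels the anomaly of G_2, which
        carries the degree 2m.\<close>
      have cj: "cnj j + 2 * \<i> * of_int c * of_real (Im \<tau>) = j" by (simp add: complex_eq_iff j_def)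
      have "h t i = j\<^sup>2 * eisenstein_div 2 D \<tau> + (2 * of_real m * (\<i> / (2 * pi) * of_int c * j)
          + of_real m * (j * cnj j) / (2 * pi * of_real (Im \<tau>)))"
        using eisenstein_div_modular[OF fin det \<tau> _ inv[OF det], of 2] torsion_divisor_degree[OF jacobi divisor]
        unfolding 2 h_def fun_upd_same Im_t by (simp add: t_def j_def)
      also have "2 * of_real m * (\<i> / (2 * pi) * of_int c * j) + of_real m * (j * cnj j) / (2 * pi * of_real (Im \<tau>))
          = of_real m * j * (cnj j + 2 * \<i> * of_int c * of_real (Im \<tau>)) / (2 * pi * of_real (Im \<tau>))"
        using v by (simp add: field_simps)
      also have "\<dots> = j\<^sup>2 * of_real (m / (2 * pi * Im \<tau>))" unfolding cj by (simp add: power2_eq_square)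
      finally show ?thesis unfolding 2 h_def fun_upd_same by (simp add: distrib_left)
    qed
  qed
  have "trace_poly n (h t) = trace_poly n (\<lambda>i. j ^ i * h \<tau> i)"
    by (rule trace_poly_cong) (use mod in simp)
  then have "trace_poly n (h t) = j ^ n * trace_poly n (h \<tau>)" by (simp only: trace_poly_scale)
  then show ?thesis
    unfolding t_def[symmetric] j_def[symmetric] completed_trace_eq_trace_poly h_def by simp
qed

theorem theorem1p3:
  fixes k :: int and m :: real and a :: int
    and \<phi> :: "complex \<Rightarrow> complex \<Rightarrow> complex" and D :: "rat \<times> rat \<Rightarrow> int"
  assumes jacobi: "meromorphic_jacobi_form k m \<phi>"
    and divisor: "has_torsion_divisor \<phi> D" and balanced: "balanced D"
    and order_0: "\<And>\<tau>. regular_at \<phi> \<tau> \<Longrightarrow> divisor_at \<phi> \<tau> 0 = a"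
  shows "(\<forall>n. almost_holomorphic_modular_form (int n) (completed_trace m a n D psi_J)
              \<and> ah_depth (completed_trace m a n D psi_J) \<le> n div 2
              \<and> (\<forall>\<tau>\<in>uhp. ah_limit (completed_trace m a n D psi_J) \<tau>
                           = (2 * pi * \<i>) powi (int n + a) * partition_trace n D psi_J \<tau>))
       \<and> (\<forall>\<tau>\<in>uhp. completed_trace m a 0 D psi_J \<tau> = (2 * pi * \<i>) powi a)
       \<and> (\<forall>\<tau>\<in>uhp. completed_trace m a 1 D psi_J \<tau>
                   = - ((2 * pi * \<i>) powi (1 + a)) * eisenstein_div 1 D \<tau>)
       \<and> (\<forall>n\<ge>2. \<forall>\<tau>\<in>uhp. lowering (completed_trace m a n D psi_J) \<tau>
                   = - pi * m * completed_trace m a (n - 2) D psi_J \<tau>)"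
proof (intro conjI allI impI ballI)
  note exp = completed_trace_expansion[of m a _ D]
  show "almost_holomorphic_modular_form (int n) (completed_trace m a n D psi_J)" for n
    unfolding almost_holomorphic_modular_form_def
    using completed_trace_modular[OF jacobi divisor balanced] exp by blast
  show "ah_depth (completed_trace m a n D psi_J) \<le> n div 2" for n
    unfolding ah_depth_def using exp by (intro Least_le) blast
  show "ah_limit (completed_trace m a n D psi_J) \<tau> = (2 * pi * \<i>) powi (int n + a) * partition_trace n D psi_J \<tau>"
    if "\<tau> \<in> uhp" for n \<tau>
    unfolding ah_limit_eq[OF exp that] by (simp add: trace_coeff_def)
  show "completed_trace m a 0 D psi_J \<tau> = (2 * pi * \<i>) powi a" for \<tau>
    by (simp add: completed_trace_def partition_trace_eq trace_poly_0)
  show "completed_trace m a 1 D psi_J \<tau> = - ((2 * pi * \<i>) powi (1 + a)) * eisenstein_div 1 D \<tau>" for \<tau>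
    using trace_poly_1 by (simp add: completed_trace_def partition_trace_eq)
  fix n :: nat and \<tau> assume n: "2 \<le> n" and \<tau>: "\<tau> \<in> uhp"
  have N: "n div 2 = Suc ((n - 2) div 2)" using n by (simp add: div_nat_eqI le_div_geq)
  have gen: "s * (Q * x * y) / w = P * (R * x * y / w)" if "s * Q = P * R" for s Q x y w P R :: complex
  proof -
    have "s * (Q * x * y) / w = (s * Q) * (x * y) / w" by (simp add: mult.assoc)
    then show ?thesis using that by (simp add: mult.assoc)
  qed
  have fact_eq: "of_nat (Suc j) * (P ^ Suc j / fact (Suc j)) = P * (P ^ j / fact j)" for P :: complex and j
    by (simp add: fact_Suc del: of_nat_Suc)
  \<comment> \<open>The term with j = 0 is lost, so the indices shift by one: the factor j + 1
    reduces (\<pi>m)^(j+1) / (j+1)! to \<pi>m times (\<pi>m)^j / j!, while n - 2(j+1) = (n-2) - 2j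
    identifies the trace and the power of 2\<pi>i.\<close>
  have step: "of_nat (Suc j) * trace_coeff m a n D (Suc j) \<tau> / of_real (Im \<tau>) ^ (Suc j - 1) =
      of_real (pi * m) * (trace_coeff m a (n - 2) D j \<tau> / of_real (Im \<tau>) ^ j)" for j
  proof -
    have e1: "int n - 2 * int (Suc j) + a = int (n - 2) - 2 * int j + a" using n by simp
    have e2: "n - 2 * Suc j = n - 2 - 2 * j" by simp
    show ?thesis unfolding trace_coeff_def e1 e2 diff_Suc_1 by (rule gen[OF fact_eq])
  qed
  have "completed_trace m a (n - 2) D psi_J \<tau> =
      (\<Sum>j\<le>(n - 2) div 2. trace_coeff m a (n - 2) D j \<tau> / of_real (Im \<tau>) ^ j)"
    using exp[of "n - 2"] \<tau> unfolding ah_expansion_def by blast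
  then show "lowering (completed_trace m a n D psi_J) \<tau> = - pi * m * completed_trace m a (n - 2) D psi_J \<tau>"
    unfolding lowering_ah_expansion[OF exp \<tau>] N sum.atMost_Suc_shift step sum_distrib_left[symmetric] by simp
qed

end
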